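(* Let $p \geq 5$ be a prime, let $G$ be a finite rational $2$-group, and let $V$ be a non-zero finite dimensional vector space over $\mathbb{F}_p$ on which $G$ acts (linearly) faithfully and with the eigenvector property. Then $p = 5$ and there are a positive integer $n$ and a $2$-subgroup $K$ of the symmetric group $\Sigma_n$ such that $G \cong Q_8 \wr K$, $\dim V = 2n$ and $V \rtimes G \cong \mathbb{M} \wr K$.
   Context: $\mathbb{F}_p$ is the field with $p$ elements, $C_n$ is the cyclic group of order $n$, $Q_8$ is the quaternion group of order $8$ and $\Sigma_n$ is the symmetric group on $n$ letters. All modules (linear actions) are on the right. A finite group $G$ is rational if for every $g \in G$ every generator of the cyclic group $\langle g \rangle$ is conjugate to $g$ in $G$. $G$ acts on an $\mathbb{F}$-vector space $V$ (by $\mathbb{F}$-linear maps) with the eigenvector property if for every $v \in V$ and every $\lambda \in \mathbb{F} \setminus \{0\}$ there exists $g \in G$ such that $vg = \lambda v$. $V \rtimes G$ denotes the semidirect product of the additive group of $V$ by $G$ associated with the action of $G$ on $V$. $\mathbb{M}$ is the Frobenius group $C_5^2 \rtimes Q_8$ of order $200$, where $Q_8$ acts on $C_5^2 = \mathbb{F}_5^2$ as a subgroup of $\mathrm{SL}(2,5)$. For a group $H$ and a subgroup $K$ of $\Sigma_n$, $H \wr K$ is the wreath product $H^n \rtimes K$, where $K$ permutes the $n$ coordinates of $H^n$ via its inclusion in $\Sigma_n$. The trivial group counts as a $2$-group. *)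

theory Defs
  imports "HOL-Analysis.Analysis" "HOL-Algebra.Algebra"
begin

text \<open>Finite 2-groups (the trivial group is the case \<open>k = 0\<close>); since \<open>2 ^ k > 0\<close>, the carrier
  is finite.\<close>

definition two_group :: "('g, 'm) monoid_scheme \<Rightarrow> bool" where
  "two_group G \<longleftrightarrow> group G \<and> (\<exists>k. order G = 2 ^ k)"

definition rational_group :: "('g, 'm) monoid_scheme \<Rightarrow> bool" where
  "rational_group G \<longleftrightarrow> group G \<and> finite (carrier G) \<and>
     (\<forall>g\<in>carrier G. \<forall>x\<in>generate G {g}. generate G {x} = generate G {g} \<longrightarrow>
        (\<exists>h\<in>carrier G. x = inv\<^bsub>G\<^esub> h \<otimes>\<^bsub>G\<^esub> g \<otimes>\<^bsub>G\<^esub> h))"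


section \<open>Right linear actions\<close>

text \<open>\<open>act v g\<close> is \<open>v g\<close>. Only the values at \<open>g \<in> carrier G\<close> matter.\<close>

definition right_linear_action ::
    "('k::field \<Rightarrow> 'v::ab_group_add \<Rightarrow> 'v) \<Rightarrow> ('g, 'm) monoid_scheme \<Rightarrow> ('v \<Rightarrow> 'g \<Rightarrow> 'v) \<Rightarrow> bool" where
  "right_linear_action smul G act \<longleftrightarrow>
     (\<forall>g\<in>carrier G. Vector_Spaces.linear smul smul (\<lambda>v. act v g)) \<and>
     (\<forall>v. act v \<one>\<^bsub>G\<^esub> = v) \<and>
     (\<forall>v. \<forall>g\<in>carrier G. \<forall>h\<in>carrier G. act v (g \<otimes>\<^bsub>G\<^esub> h) = act (act v g) h)"

definition faithful_right_action :: "('g, 'm) monoid_scheme \<Rightarrow> ('v \<Rightarrow> 'g \<Rightarrow> 'v) \<Rightarrow> bool" where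
  "faithful_right_action G act \<longleftrightarrow> (\<forall>g\<in>carrier G. (\<forall>v. act v g = v) \<longrightarrow> g = \<one>\<^bsub>G\<^esub>)"

definition eigenvector_property ::
    "('k::field \<Rightarrow> 'v \<Rightarrow> 'v) \<Rightarrow> ('g, 'm) monoid_scheme \<Rightarrow> ('v \<Rightarrow> 'g \<Rightarrow> 'v) \<Rightarrow> bool" where
  "eigenvector_property smul G act \<longleftrightarrow>
     (\<forall>v l. l \<noteq> 0 \<longrightarrow> (\<exists>g\<in>carrier G. act v g = smul l v))"


section \<open>Semidirect and wreath products\<close>

definition additive_group :: "'v::ab_group_add monoid" where
  "additive_group = \<lparr>carrier = UNIV, mult = (+), one = 0\<rparr>"

text \<open>For a right action of \<open>H\<close> on \<open>N\<close> by automorphisms, the pair \<open>(x, h)\<close> stands for the product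
  \<open>h x\<close>, with \<open>inv h x h = act x h\<close>; hence \<open>(h x) (k y) = (h k) (act x k y)\<close>.\<close>

definition semidirect ::
    "('n, 'a) monoid_scheme \<Rightarrow> ('h, 'b) monoid_scheme \<Rightarrow> ('n \<Rightarrow> 'h \<Rightarrow> 'n) \<Rightarrow> ('n \<times> 'h) monoid" where
  "semidirect N H act =
     \<lparr>carrier = carrier N \<times> carrier H,
      mult = (\<lambda>(x, h) (y, k). (act x k \<otimes>\<^bsub>N\<^esub> y, h \<otimes>\<^bsub>H\<^esub> k)),
      one = (\<one>\<^bsub>N\<^esub>, \<one>\<^bsub>H\<^esub>)\<rparr>"

text \<open>As \<open>sym_group n\<close> multiplies by \<open>(\<circ>)\<close>, composing a tuple with a permutation is a right action.\<close>

definition permute_coords :: "nat \<Rightarrow> (nat \<Rightarrow> 'h) \<Rightarrow> (nat \<Rightarrow> nat) \<Rightarrow> (nat \<Rightarrow> 'h)" where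
  "permute_coords n x \<sigma> = (\<lambda>i\<in>{1..n}. x (\<sigma> i))"

definition wreath ::
    "('h, 'm) monoid_scheme \<Rightarrow> nat \<Rightarrow> (nat \<Rightarrow> nat) set \<Rightarrow> ((nat \<Rightarrow> 'h) \<times> (nat \<Rightarrow> nat)) monoid" where
  "wreath H n K =
     semidirect (product_group {1..n} (\<lambda>_. H)) ((sym_group n)\<lparr>carrier := K\<rparr>) (permute_coords n)"

lemma group_additive_group: "group (additive_group :: 'v::ab_group_add monoid)"
proof (rule groupI)
  fix x :: 'v
  show "\<exists>y\<in>carrier additive_group. y \<otimes>\<^bsub>additive_group\<^esub> x = \<one>\<^bsub>additive_group\<^esub>"
    by (rule bexI[of _ "- x"]) (auto simp: additive_group_def)
qed (auto simp: additive_group_def algebra_simps)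

lemma group_semidirect:
  assumes N: "group N" and H: "group H"
    and hom: "\<And>h. h \<in> carrier H \<Longrightarrow> (\<lambda>x. act x h) \<in> hom N N"
    and one: "\<And>x. x \<in> carrier N \<Longrightarrow> act x \<one>\<^bsub>H\<^esub> = x"
    and mult: "\<And>x h k. x \<in> carrier N \<Longrightarrow> h \<in> carrier H \<Longrightarrow> k \<in> carrier H \<Longrightarrow>
                 act x (h \<otimes>\<^bsub>H\<^esub> k) = act (act x h) k"
  shows "group (semidirect N H act)"
proof -
  interpret N: group N by fact
  interpret H: group H by fact
  have cl [simp, intro]: "act x h \<in> carrier N" if "x \<in> carrier N" "h \<in> carrier H" for x h
    using hom[OF that(2)] that(1) by (auto simp: hom_def)
  have ml: "act (x \<otimes>\<^bsub>N\<^esub> y) h = act x h \<otimes>\<^bsub>N\<^esub> act y h"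
    if "x \<in> carrier N" "y \<in> carrier N" "h \<in> carrier H" for x y h
    using hom[OF that(3)] that(1,2) by (auto simp: hom_def)
  have a1: "act \<one>\<^bsub>N\<^esub> h = \<one>\<^bsub>N\<^esub>" if "h \<in> carrier H" for h
    using ml[of "\<one>\<^bsub>N\<^esub>" "\<one>\<^bsub>N\<^esub>" h] that by (simp add: N.l_cancel_one cl)
  show ?thesis
  proof (rule groupI)
    fix a assume "a \<in> carrier (semidirect N H act)"
    then obtain x h where a: "a = (x, h)" "x \<in> carrier N" "h \<in> carrier H"
      by (auto simp: semidirect_def)
    let ?b = "(act (inv\<^bsub>N\<^esub> x) (inv\<^bsub>H\<^esub> h), inv\<^bsub>H\<^esub> h)"
    have "act (act (inv\<^bsub>N\<^esub> x) (inv\<^bsub>H\<^esub> h)) h = inv\<^bsub>N\<^esub> x"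
      using a by (simp flip: mult add: one)
    then have "?b \<otimes>\<^bsub>semidirect N H act\<^esub> a = \<one>\<^bsub>semidirect N H act\<^esub>"
      using a by (simp add: semidirect_def)
    moreover have "?b \<in> carrier (semidirect N H act)"
      using a by (simp add: semidirect_def)
    ultimately show "\<exists>b\<in>carrier (semidirect N H act).
        b \<otimes>\<^bsub>semidirect N H act\<^esub> a = \<one>\<^bsub>semidirect N H act\<^esub>" by blast
  qed (auto simp: semidirect_def ml mult one a1 N.m_assoc H.m_assoc)
qed

lemma group_wreath:
  assumes H: "group H" and K: "subgroup K (sym_group n)"
  shows "group (wreath H n K)"
  unfolding wreath_def
proof (rule group_semidirect)
  interpret H: group H by fact
  have perm: "\<sigma> permutes {1..n}" if "\<sigma> \<in> K" for \<sigma>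
    using subgroup.subset[OF K] that by (auto simp: sym_group_def)
  show "group (product_group {1..n} (\<lambda>_. H))" by (simp add: H)
  show "group ((sym_group n)\<lparr>carrier := K\<rparr>)"
    by (rule subgroup.subgroup_is_group[OF K sym_group_is_group])
  fix x :: "nat \<Rightarrow> 'a" and \<sigma> \<tau>
  show "(\<lambda>x. permute_coords n x \<sigma>) \<in> hom (product_group {1..n} (\<lambda>_. H)) (product_group {1..n} (\<lambda>_. H))"
    if "\<sigma> \<in> carrier ((sym_group n)\<lparr>carrier := K\<rparr>)"
    using that perm[of \<sigma>] permutes_in_image[of \<sigma> "{1..n}"]
    by (auto simp: hom_def product_group_def permute_coords_def fun_eq_iff PiE_def Pi_def)
  assume x: "x \<in> carrier (product_group {1..n} (\<lambda>_. H))"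
  then show "permute_coords n x \<one>\<^bsub>(sym_group n)\<lparr>carrier := K\<rparr>\<^esub> = x"
    by (auto simp: sym_group_def permute_coords_def fun_eq_iff PiE_def extensional_def)
  show "permute_coords n x (\<sigma> \<otimes>\<^bsub>(sym_group n)\<lparr>carrier := K\<rparr>\<^esub> \<tau>)
      = permute_coords n (permute_coords n x \<sigma>) \<tau>"
    if "\<tau> \<in> carrier ((sym_group n)\<lparr>carrier := K\<rparr>)"
    using that perm[of \<tau>] permutes_in_image[of \<tau> "{1..n}"]
    by (auto simp: sym_group_def permute_coords_def fun_eq_iff)
qed


section \<open>The quaternion group of order 8\<close>

text \<open>\<open>(a, b, c, d)\<close> is the quaternion \<open>a + b i + c j + d k\<close>; the group consists of
  \<open>1, -1, i, -i, j, -j, k, -k\<close>.\<close>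

type_synonym quat = "int \<times> int \<times> int \<times> int"

fun quat_mult :: "quat \<Rightarrow> quat \<Rightarrow> quat" where
  "quat_mult (a, b, c, d) (a', b', c', d') =
     (a * a' - b * b' - c * c' - d * d',
      a * b' + b * a' + c * d' - d * c',
      a * c' - b * d' + c * a' + d * b',
      a * d' + b * c' - c * b' + d * a')"

definition Q8 :: "quat monoid" where
  "Q8 = \<lparr>carrier = {(1,0,0,0), (-1,0,0,0), (0,1,0,0), (0,-1,0,0),
                    (0,0,1,0), (0,0,-1,0), (0,0,0,1), (0,0,0,-1)},
         mult = quat_mult, one = (1,0,0,0)\<rparr>"

lemma quat_mult_assoc: "quat_mult (quat_mult p q) r = quat_mult p (quat_mult q r)"
  by (cases p; cases q; cases r) (simp add: algebra_simps)

lemma group_Q8: "group Q8"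
proof (rule groupI)
  show "x \<otimes>\<^bsub>Q8\<^esub> y \<otimes>\<^bsub>Q8\<^esub> z = x \<otimes>\<^bsub>Q8\<^esub> (y \<otimes>\<^bsub>Q8\<^esub> z)" for x y z
    by (simp add: Q8_def quat_mult_assoc)
qed (auto simp: Q8_def)

lemma order_Q8: "order Q8 = 8"
  by (simp add: Q8_def order_def)


section \<open>The Frobenius group of order 200\<close>

text \<open>The type \<open>5\<close> is the ring of integers modulo 5, and \<open>5^2\<close> consists of row vectors, on which
  matrices act from the right. The representation of \<open>Q8\<close> sends \<open>i\<close> to the diagonal matrix
  with entries \<open>2, -2\<close> and \<open>j\<close> to the matrix with rows \<open>(0, 1)\<close> and \<open>(-1, 0)\<close>.\<close>

definition quat_matrix :: "quat \<Rightarrow> 5^2^2" where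
  "quat_matrix = (\<lambda>(a, b, c, d).
     vector [vector [of_int (a + 2 * b), of_int (c + 2 * d)],
             vector [of_int (- c + 2 * d), of_int (a - 2 * b)]])"

definition frob200 :: "((5^2) \<times> quat) monoid" where
  "frob200 = semidirect additive_group Q8 (\<lambda>v q. v v* quat_matrix q)"

definition SL :: "('a::comm_ring_1^'n^'n) monoid" where
  "SL = \<lparr>carrier = {A. det A = 1}, mult = (**), one = mat 1\<rparr>"

lemma of_int_5_eqI: "(of_int x :: 5) = of_int y" if "x = y + 5 * z"
proof -
  have "(5::5) = 0" by simp
  then have "(of_int (5 * z) :: 5) = 0" by (metis mult_zero_left of_int_mult of_int_numeral)
  with that show ?thesis by simp
qed

lemma quat_matrix_nth:
  "quat_matrix (a, b, c, d) $ 1 $ 1 = of_int (a + 2 * b)"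
  "quat_matrix (a, b, c, d) $ 1 $ 2 = of_int (c + 2 * d)"
  "quat_matrix (a, b, c, d) $ 2 $ 1 = of_int (- c + 2 * d)"
  "quat_matrix (a, b, c, d) $ 2 $ 2 = of_int (a - 2 * b)"
  unfolding quat_matrix_def by (simp_all only: prod.case vector_2)

lemma quat_matrix_mult: "quat_matrix (quat_mult p q) = quat_matrix p ** quat_matrix q"
proof -
  obtain a b c d a' b' c' d' where pq: "p = (a, b, c, d)" "q = (a', b', c', d')"
    by (cases p; cases q)
  show ?thesis
    unfolding pq vec_eq_iff forall_2 matrix_matrix_mult_def sum_2 vec_lambda_beta
      quat_mult.simps quat_matrix_nth of_int_mult[symmetric] of_int_add[symmetric]
    by (intro conjI
        of_int_5_eqI[where z = "- b * b' - d * d'"] of_int_5_eqI[where z = "d * b' - b * d'"]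
        of_int_5_eqI[where z = "b * d' - d * b'"])
      (simp_all add: algebra_simps)
qed

lemma det_quat_matrix: "det (quat_matrix (a, b, c, d)) = of_int (a\<^sup>2 + b\<^sup>2 + c\<^sup>2 + d\<^sup>2)"
  unfolding det_2 quat_matrix_nth of_int_mult[symmetric] of_int_diff[symmetric]
  by (rule of_int_5_eqI[where z = "- b\<^sup>2 - d\<^sup>2"]) (simp add: algebra_simps power2_eq_square)

lemma quat_matrix_hom: "quat_matrix \<in> hom Q8 SL"
proof (rule homI)
  show "quat_matrix q \<in> carrier SL" if "q \<in> carrier Q8" for q
    using that by (auto simp: Q8_def SL_def det_quat_matrix)
qed (simp add: Q8_def SL_def quat_matrix_mult)

lemma inj_on_quat_matrix: "inj_on quat_matrix (carrier Q8)"
proof -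
  have "quat_matrix q $ 1 $ 1 = quat_matrix r $ 1 $ 1 \<Longrightarrow>
        quat_matrix q $ 1 $ 2 = quat_matrix r $ 1 $ 2 \<Longrightarrow> q = r"
    if "q \<in> carrier Q8" "r \<in> carrier Q8" for q r
    using that unfolding Q8_def by (auto simp: quat_matrix_nth)
  then show ?thesis by (auto simp: inj_on_def)
qed

lemma quat_matrix_fixed_point_free:
  assumes q: "q \<in> carrier Q8" "q \<noteq> \<one>\<^bsub>Q8\<^esub>" and v: "v v* quat_matrix q = v"
  shows "v = 0"
proof -
  have "- v = v"
  proof (cases "q = (-1,0,0,0)")
    case True
    then have "v v* quat_matrix q = - v"
      by (simp add: quat_matrix_nth vec_eq_iff vector_matrix_mult_def sum_2 forall_2)
    with v show ?thesis by simp
  next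
    case False
    with q have "quat_mult q q = (-1,0,0,0)" by (auto simp: Q8_def)
    then have "v v* quat_matrix (-1,0,0,0) = v"
      using v by (metis vector_matrix_mul_assoc quat_matrix_mult)
    moreover have "v v* quat_matrix (-1,0,0,0) = - v"
      by (simp add: quat_matrix_nth vec_eq_iff vector_matrix_mult_def sum_2 forall_2)
    ultimately show ?thesis by simp
  qed
  then have "- (v $ i) = v $ i" for i by (metis vector_uminus_component)
  then have "2 * v $ i = 0" for i by (metis add.right_inverse mult_2)
  then have "3 * (2 * v $ i) = 0" for i by simp
  then have "6 * v $ i = 0" for i by (simp flip: mult.assoc)
  moreover have "(6::5) = 1" by simp
  ultimately show ?thesis by (simp add: vec_eq_iff)
qed

lemma group_frob200: "group frob200"
  unfolding frob200_def
proof (rule group_semidirect)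
  show "group (additive_group :: (5^2) monoid)" by (rule group_additive_group)
  show "group Q8" by (rule group_Q8)
  show "(\<lambda>v. v v* quat_matrix q) \<in> hom additive_group additive_group" for q
    by (auto simp: hom_def additive_group_def vec_eq_iff vector_matrix_mult_def sum_2 algebra_simps)
  show "v v* quat_matrix \<one>\<^bsub>Q8\<^esub> = v" for v
    by (simp add: Q8_def quat_matrix_nth vec_eq_iff vector_matrix_mult_def sum_2 forall_2)
  show "v v* quat_matrix (q \<otimes>\<^bsub>Q8\<^esub> r) = v v* quat_matrix q v* quat_matrix r" for v q r
    by (simp add: Q8_def quat_matrix_mult vector_matrix_mul_assoc)
qed

lemma order_frob200: "order frob200 = 200"
  by (simp add: frob200_def semidirect_def order_def additive_group_def Q8_def card_cartesian_product)

end

theory Submission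
  imports Defs
begin

text \<open>For a rational 2-group \<open>g\<close> is conjugate to \<open>g^(1 + 2^j)\<close>, so on every stable subspace the eigenvalues \<open>l\<close> and
  \<open>- l\<close> of \<open>g\<close> have equal multiplicity when \<open>l^2 \<noteq> 1\<close>. If some element of \<open>G\<close>, not a sign, acts as an involution and
  commutes with \<open>G\<close> up to sign, its two eigenspaces are preserved or interchanged by \<open>G\<close>, and both this balance and
  the eigenvector property descend to them. Otherwise some element \<open>c\<close> with \<open>c^2 = - 1\<close> is central up
  to sign, and its centraliser \<open>D\<close> is cyclic of index 2 and acts freely on non-zero vectors. Balance then forces
  \<open>p = 5\<close>, and \<open>D\<close> is regular on the non-zero vectors of an eigenspace of \<open>c\<close>, so that \<open>|D| + 1\<close> is a power of 5,
  \<open>|D| = 4\<close>, the dimension is 2, and \<open>G\<close> acts as \<open>Q\<^sub>8\<close>. So \<open>V\<close> is a sum of \<open>n\<close> planes permuted by \<open>G\<close>, which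
  embeds in \<open>Q\<^sub>8 \<wr> K\<close> with \<open>K\<close> the image of \<open>G\<close> in \<open>\<Sigma>\<^sub>n\<close>.

  For surjectivity, \<open>Q\<^sub>8\<close> has three orbits on \<open>F\<^sub>5\<^sup>2 - {0}\<close>, and a 2-group of permutations has a 3-colouring with
  trivial stabiliser. A vector whose components have orbits prescribed by such a colouring can be scaled by 2 only
  by an element of the base group, whose coefficients are then forced. Varying the colouring in a single coordinate
  produces the full base group \<open>Q\<^sub>8^n\<close>.\<close>

section \<open>Finite 2-groups\<close>

text \<open>Rationality does not pass to subgroups, and a stabiliser need not act faithfully on an
  eigenspace. So the induction carries neither: it carries balance and the eigenvector property, and
  in the primitive case faithfulness is recovered by replacing the group by its image. The scalar 2
  is the one to which the eigenvector property is applied. Over a field with 5 elements 2 * 2 = - 1,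
  so that 2 and - 2 are the eigenvalues of every imaginary quaternion unit, and a vector scaled by 2
  can be prescribed component by component. Three colours, one for each axis i, j, k, are also what
  the colouring argument requires: two would not do for the dihedral group of order 8 on 4
  points.\<close>

lemma even_if_dvd_two_power:
  assumes "(c::nat) dvd 2 ^ k" "c \<noteq> 1" shows "even c"
proof -
  obtain i where "c = 2 ^ i" using assms(1) divides_primepow_nat[OF two_is_prime_nat] by blast
  then show ?thesis using assms(2) by (cases i) auto
qed

text \<open>An orbit has 2-power size, hence is a single point or even. So the number of fixed
  points in \<open>S\<close> has the parity of \<open>card S\<close>, and one fixed point brings a
  second.\<close>

lemma (in group_action) two_group_fixed_point:
  assumes ord: "order G = 2 ^ k" and fin: "finite S" and SE: "S \<subseteq> E"
    and inv: "\<And>g x. g \<in> carrier G \<Longrightarrow> x \<in> S \<Longrightarrow> \<phi> g x \<in> S"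
    and ev: "even (card S)" and a: "a \<in> S" "\<And>g. g \<in> carrier G \<Longrightarrow> \<phi> g a = a"
  obtains b where "b \<in> S" "b \<noteq> a" "\<And>g. g \<in> carrier G \<Longrightarrow> \<phi> g b = b"
proof -
  interpret gh: group_hom G "BijGroup E" \<phi> by (rule group_hom)
  let ?P = "orbit G \<phi> ` S"
  have sub: "orbit G \<phi> x \<subseteq> S" if "x \<in> S" for x
    using inv that by (auto simp: orbit_def)
  have fp: "finite Z" if "Z \<in> ?P" for Z
    using that sub fin by (auto intro: finite_subset)
  have self: "x \<in> orbit G \<phi> x" if "x \<in> S" for x
    using orbit_refl SE that by blast
  have "?P \<subseteq> orbits G E \<phi>" using SE by (auto simp: orbits_def)
  then have dis: "pairwise disjnt ?P"
    unfolding pairwise_def disjnt_def using disjoint_union by blast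
  have un: "\<Union> ?P = S" using sub self by blast
  have cS: "card S = (\<Sum>Z\<in>?P. card Z)"
    using card_Union_disjoint[OF dis fp] un by simp
  have orb_a: "orbit G \<phi> a = {a}"
  proof
    show "{a} \<subseteq> orbit G \<phi> a" using self[OF a(1)] by simp
  qed (use a(2) in \<open>auto simp: orbit_def\<close>)
  then have aP: "{a} \<in> ?P" using a(1) by force
  note hyp = that
  show thesis
  proof (rule ccontr)
    assume no: "\<not> thesis"
    have "even (card Z)" if Z: "Z \<in> ?P - {{a}}" for Z
    proof (rule ccontr)
      assume odd: "odd (card Z)"
      obtain x where x: "x \<in> S" "Z = orbit G \<phi> x" using Z by blast
      then have "card Z dvd 2 ^ k"
        using orbit_stabilizer_theorem[of x] SE ord by (metis dvd_triv_left subsetD)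
      then have "card Z = 1" using odd even_if_dvd_two_power by blast
      then have X1: "Z = {x}" using self x by (metis card_1_singletonE singletonD)
      have "\<phi> g x = x" if "g \<in> carrier G" for g
        using X1 x that by (auto simp: orbit_def)
      moreover have "x \<noteq> a" using Z X1 by blast
      ultimately have thesis by (intro hyp[OF x(1)])
      with no show False ..
    qed
    then have "even (\<Sum>Z\<in>?P - {{a}}. card Z)" by (intro dvd_sum) blast
    moreover have "card S = 1 + (\<Sum>Z\<in>?P - {{a}}. card Z)"
      using cS sum.remove[of ?P "{a}" card] fin aP by simp
    ultimately show False using ev by simp
  qed
qed

context group
begin

lemma cancel_inv_left: "x \<in> carrier G \<Longrightarrow> y \<in> carrier G \<Longrightarrow> x \<otimes> (inv x \<otimes> y) = y"
  by (simp flip: m_assoc)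

lemma cancel_left_inv: "x \<in> carrier G \<Longrightarrow> y \<in> carrier G \<Longrightarrow> inv x \<otimes> (x \<otimes> y) = y"
  by (simp flip: m_assoc)

lemma centralizer_subgroup:
  assumes c: "c \<in> carrier G"
  shows "subgroup {x \<in> carrier G. c \<otimes> x = x \<otimes> c} G" (is "subgroup ?D G")
proof (rule subgroupI)
  show "inv x \<in> ?D" if "x \<in> ?D" for x
  proof -
    have x: "x \<in> carrier G" "c \<otimes> x = x \<otimes> c" using that by auto
    have "c \<otimes> inv x = inv x \<otimes> (x \<otimes> c) \<otimes> inv x" using x(1) c by (simp add: cancel_left_inv)
    also have "\<dots> = inv x \<otimes> c" unfolding x(2)[symmetric] using x(1) c by (simp add: m_assoc)
    finally show ?thesis using x(1) by simp
  qed
  show "x \<otimes> y \<in> ?D" if "x \<in> ?D" "y \<in> ?D" for x y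
  proof -
    have xy: "x \<in> carrier G" "c \<otimes> x = x \<otimes> c" "y \<in> carrier G" "c \<otimes> y = y \<otimes> c" using that by auto
    have "c \<otimes> (x \<otimes> y) = x \<otimes> (c \<otimes> y)" using xy(1,2,3) c by (simp flip: m_assoc)
    also have "\<dots> = x \<otimes> y \<otimes> c" unfolding xy(4) using xy(1,3) c by (simp add: m_assoc)
    finally show ?thesis using xy by simp
  qed
qed (use c in auto)

lemma pow_two_power:
  assumes "x \<in> carrier G" shows "(x [^] ((2::nat) ^ n)) \<otimes> (x [^] ((2::nat) ^ n)) = x [^] ((2::nat) ^ Suc n)"
  using assms by (simp add: nat_pow_mult mult_2)

lemma conj_mult:
  assumes "x \<in> carrier G" "y \<in> carrier G" "z \<in> carrier G"
  shows "inv z \<otimes> (x \<otimes> y) \<otimes> z = (inv z \<otimes> x \<otimes> z) \<otimes> (inv z \<otimes> y \<otimes> z)"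
  using assms by (simp add: m_assoc cancel_inv_left)

text \<open>A relative form of the fact that a non-trivial 2-group has a non-trivial centre.
  Conjugation permutes the cosets of \<open>M\<close> in \<open>D\<close>, whose number is even, and
  fixes the coset \<open>M\<close>; a second fixed coset is central modulo \<open>M\<close>. A
  proper \<open>D\<close> is needed when the centraliser of a single element is compared with a
  cyclic normal subgroup.\<close>

lemma two_group_central_mod:
  assumes ord: "order G = 2 ^ k" and M: "M \<lhd> G" and D: "D \<lhd> G" and MD: "M \<subset> D"
  obtains y where "y \<in> D" "y \<notin> M" "y \<otimes> y \<in> M"
    "\<And>x. x \<in> carrier G \<Longrightarrow> \<exists>d\<in>M. inv x \<otimes> y \<otimes> x = y \<otimes> d"
proof -
  interpret M: normal M G by (rule M)
  interpret D: normal D G by (rule D)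
  have fin: "finite (carrier G)" using ord order_gt_0_iff_finite by auto
  let ?E = "{H. H \<subseteq> carrier G}" and ?\<phi> = "\<lambda>g. \<lambda>H\<in>{H. H \<subseteq> carrier G}. g <# H #> (inv g)"
  interpret act: group_action G ?E ?\<phi> by (rule action_by_conjugation_on_power_set)
  let ?S = "(\<lambda>d. M #> d) ` D"
  have SE: "?S \<subseteq> ?E" using M.subset D.subset r_coset_subset_G by blast
  have conj: "?\<phi> g (M #> d) = M #> (g \<otimes> d \<otimes> inv g)" if g: "g \<in> carrier G" and d: "d \<in> carrier G" for g d
  proof -
    have "?\<phi> g (M #> d) = g <# (M #> d) #> inv g"
      using M.subset d r_coset_subset_G by simp
    also have "\<dots> = M #> (g \<otimes> d \<otimes> inv g)"
    proof -
      have "g <# (M #> d) = (M #> g) #> d"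
        using coset_assoc[OF g d M.subset] M.coset_eq g by metis
      then show ?thesis using g d M.subset by (simp add: coset_mult_assoc m_assoc)
    qed
    finally show ?thesis .
  qed
  let ?D = "G\<lparr>carrier := D\<rparr>"
  interpret GD: group ?D by (rule D.subgroup_is_group) (rule is_group)
  have "?S = rcosets\<^bsub>?D\<^esub> M"
    by (auto simp: RCOSETS_def r_coset_def)
  moreover have "subgroup M ?D"
    using subgroup_incl[OF M.subgroup_axioms D.subgroup_axioms] MD by blast
  ultimately have "card ?S * card M = card D"
    using GD.lagrange by (simp add: order_def)
  moreover have cD: "card D dvd 2 ^ k"
    using lagrange[OF D.subgroup_axioms] ord by (metis dvd_triv_right)
  ultimately have "card ?S dvd 2 ^ k" by (metis dvd_mult_left)
  moreover have "card ?S \<noteq> 1"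
  proof
    assume "card ?S = 1"
    then have "card M = card D" using \<open>card ?S * card M = card D\<close> by simp
    with MD show False
      by (metis D.subset card_subset_eq fin finite_subset psubset_eq)
  qed
  ultimately have ev: "even (card ?S)"
    by (rule even_if_dvd_two_power)
  have M1: "M #> \<one> = M" using M.subset by simp
  have "M \<in> ?S" using D.one_closed M1 by force
  moreover have "?\<phi> g M = M" if "g \<in> carrier G" for g
    using conj[OF that one_closed] M1 that by simp
  moreover have "?\<phi> g Z \<in> ?S" if "g \<in> carrier G" "Z \<in> ?S" for g Z
  proof -
    obtain d where d: "d \<in> D" "Z = M #> d" using \<open>Z \<in> ?S\<close> by blast
    then have "?\<phi> g Z = M #> (g \<otimes> d \<otimes> inv g)"
      using conj[OF \<open>g \<in> carrier G\<close>, of d] D.subset by blast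
    then show ?thesis using D.inv_op_closed2[OF \<open>g \<in> carrier G\<close> d(1)] by blast
  qed
  moreover have "finite ?S" using fin D.subset finite_subset by blast
  ultimately obtain b where b: "b \<in> ?S" "b \<noteq> M" "\<And>g. g \<in> carrier G \<Longrightarrow> ?\<phi> g b = b"
    using act.two_group_fixed_point[OF ord _ SE _ ev, of M] by metis
  then obtain y0 where y0: "y0 \<in> D" "b = M #> y0" by blast
  then have y0G: "y0 \<in> carrier G" using D.subset by blast
  have y0M: "y0 \<notin> M" using b(2) y0 M.rcos_const is_group by blast
  let ?C = "{y \<in> D. \<forall>x\<in>carrier G. \<exists>d\<in>M. inv x \<otimes> y \<otimes> x = y \<otimes> d}"
  have "y0 \<in> ?C"
  proof (simp add: y0, rule ballI)
    fix x assume x: "x \<in> carrier G"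
    have "M #> (inv x \<otimes> y0 \<otimes> x) = M #> y0"
      using b(3)[of "inv x"] conj[of "inv x" y0] x y0 y0G by simp
    then have "inv x \<otimes> y0 \<otimes> x \<in> M #> y0"
      using x y0G M.subgroup_axioms rcos_self by (metis inv_closed m_closed)
    then have "inv x \<otimes> y0 \<otimes> x \<in> y0 <# M" using M.coset_eq y0G by simp
    then show "\<exists>d\<in>M. inv x \<otimes> y0 \<otimes> x = y0 \<otimes> d" by (auto simp: l_coset_def)
  qed
  \<comment> \<open>Squaring keeps an element central modulo \<open>M\<close>, by normality of
    \<open>M\<close>. So the last repeated square of \<open>y0\<close> outside \<open>M\<close> is
    as good as \<open>y0\<close>, and its own square lies in \<open>M\<close>.\<close>
  have sq: "y \<otimes> y \<in> ?C" if "y \<in> ?C" for y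
  proof -
    have yD: "y \<in> D" and yG: "y \<in> carrier G" using that D.subset by auto
    have "\<exists>d\<in>M. inv x \<otimes> (y \<otimes> y) \<otimes> x = y \<otimes> y \<otimes> d" if x: "x \<in> carrier G" for x
    proof -
      obtain d where d: "d \<in> M" "inv x \<otimes> y \<otimes> x = y \<otimes> d" using \<open>y \<in> ?C\<close> x by blast
      have dG: "d \<in> carrier G" using d M.subset by blast
      have "inv x \<otimes> (y \<otimes> y) \<otimes> x = y \<otimes> d \<otimes> (y \<otimes> d)"
        using conj_mult[OF yG yG x] d by simp
      also have "\<dots> = y \<otimes> y \<otimes> (inv y \<otimes> d \<otimes> y \<otimes> d)"
        using yG dG by (simp add: m_assoc cancel_inv_left)
      finally show ?thesis using M.inv_op_closed1[OF yG d(1)] d(1) by blast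
    qed
    then show ?thesis using yD by auto
  qed
  have pw: "y0 [^] ((2::nat) ^ n) \<in> ?C" for n
  proof (induction n)
    case 0 show ?case using \<open>y0 \<in> ?C\<close> y0G by simp
  next
    case (Suc n) show ?case using sq[OF Suc] unfolding pow_two_power[OF y0G] .
  qed
  have "y0 [^] ((2::nat) ^ k) \<in> M" using pow_order_eq_1[OF y0G] ord M.one_closed by simp
  then have ex: "\<exists>n. y0 [^] ((2::nat) ^ n) \<in> M" by blast
  define n where "n = (LEAST n. y0 [^] ((2::nat) ^ n) \<in> M)"
  have n: "y0 [^] ((2::nat) ^ n) \<in> M" unfolding n_def using ex by (rule LeastI_ex)
  have "n \<noteq> 0" using n y0M y0G by (metis nat_pow_eone power_0)
  then obtain l where l: "n = Suc l" using not0_implies_Suc by blast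
  have "y0 [^] ((2::nat) ^ l) \<notin> M" using not_less_Least[of l "\<lambda>n. y0 [^] ((2::nat) ^ n) \<in> M"] l n_def by simp
  with pw[of l] n l pow_two_power[OF y0G, of l] show thesis
    by (intro that[of "y0 [^] ((2::nat) ^ l)"]) auto
qed

lemma two_group_central_quotient:
  assumes "order G = 2 ^ k" "M \<lhd> G" "M \<subset> carrier G"
  obtains y where "y \<in> carrier G" "y \<notin> M" "y \<otimes> y \<in> M"
    "\<And>x. x \<in> carrier G \<Longrightarrow> \<exists>d\<in>M. inv x \<otimes> y \<otimes> x = y \<otimes> d"
proof -
  have "carrier G \<lhd> G" by (simp add: normal_inv_iff subgroup_self)
  from two_group_central_mod[OF assms(1,2) this assms(3)] show thesis using that by blast
qed

end

section \<open>Cyclicity of the centraliser of an element whose square is the central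
  involution\<close>

context group
begin

lemma conj_int_pow:
  assumes "a \<in> carrier G" "x \<in> carrier G"
  shows "inv x \<otimes> (a [^] (i::int)) \<otimes> x = (inv x \<otimes> a \<otimes> x) [^] i"
proof -
  have "(\<lambda>a. inv x \<otimes> a \<otimes> x) \<in> hom G G"
    using assms(2) conj_mult by (auto simp: hom_def)
  from hom_int_pow[OF this assms(1)] show ?thesis using is_group by blast
qed

lemma involution_int_pow:
  assumes "m \<in> carrier G" "m \<otimes> m = \<one>"
  shows "m [^] (i::int) = (if even i then \<one> else m)"
proof -
  have m2: "m [^] (2::int) = \<one>"
    using assms int_pow_mult[OF assms(1), of 1 1] by simp
  show ?thesis
  proof (cases "even i")
    case True
    then obtain j where "i = 2 * j" by blast
    then show ?thesis using int_pow_pow[OF assms(1), of 2 j] m2 by simp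
  next
    case False
    then obtain j where j: "i = 2 * j + 1" using oddE by blast
    then show ?thesis using int_pow_pow[OF assms(1), of 2 j] m2 int_pow_mult[OF assms(1), of "2 * j" 1] assms(1) by simp
  qed
qed

text \<open>Among the cyclic normal subgroups of \<open>G\<close> that contain \<open>c\<close> take
  one of greatest order, generated by \<open>a\<close>; \<open>c\<close> itself qualifies, since its
  conjugates are \<open>c\<close> and its cube. If the centraliser of \<open>c\<close> were larger,
  it would contain an element \<open>y\<close> of order 2 and central modulo the powers of
  \<open>a\<close>. Then either a power of \<open>a\<close> corrects \<open>y\<close> to an
  involution excluded by \<open>noE\<close>, or \<open>y\<close> generates a larger cyclic normal
  subgroup.\<close>

lemma centralizer_of_quarter_cyclic:
  assumes ord: "order G = 2 ^ k"
    and m: "m \<in> carrier G" "m \<noteq> \<one>" "m \<otimes> m = \<one>" "\<And>x. x \<in> carrier G \<Longrightarrow> m \<otimes> x = x \<otimes> m"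
    and noE: "\<And>e. e \<in> carrier G \<Longrightarrow> e \<otimes> e = \<one> \<Longrightarrow>
      (\<And>x. x \<in> carrier G \<Longrightarrow> e \<otimes> x = x \<otimes> e \<or> e \<otimes> x = m \<otimes> (x \<otimes> e)) \<Longrightarrow> e = \<one> \<or> e = m"
    and c: "c \<in> carrier G" "c \<otimes> c = m"
      "\<And>x. x \<in> carrier G \<Longrightarrow> c \<otimes> x = x \<otimes> c \<or> c \<otimes> x = m \<otimes> (x \<otimes> c)"
  obtains a where "a \<in> carrier G"
    "\<And>x. x \<in> carrier G \<Longrightarrow> c \<otimes> x = x \<otimes> c \<Longrightarrow> \<exists>i::int. x = a [^] i"
    "\<And>i::int. a [^] i \<otimes> a [^] i = \<one> \<Longrightarrow> a [^] i = \<one> \<or> a [^] i = m"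
proof -
  have fin: "finite (carrier G)" using ord order_gt_0_iff_finite by auto
  have cm: "c \<otimes> m = m \<otimes> c" using m(4)[OF c(1)] by simp
  have c_conj: "inv x \<otimes> c \<otimes> x = c \<or> inv x \<otimes> c \<otimes> x = m \<otimes> c" if x: "x \<in> carrier G" for x
  proof -
    have "inv x \<otimes> (c \<otimes> x) = c \<or> inv x \<otimes> (c \<otimes> x) = m \<otimes> c"
      using c(3)[OF x] m(4)[of "inv x"] x c(1) m(1)
      by (metis cancel_left_inv inv_closed m_assoc m_closed)
    then show ?thesis using x c(1) by (simp add: m_assoc)
  qed
  define P where "P a \<longleftrightarrow> a \<in> carrier G \<and> (\<exists>q::int. c = a [^] q) \<and>
     (\<forall>x\<in>carrier G. \<exists>j::int. inv x \<otimes> a \<otimes> x = a [^] j)" for a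
  have c3: "m \<otimes> c = c [^] (3::int)"
  proof -
    have "c [^] (3::int) = c [^] (1 + 1 + 1 :: int)" by simp
    also have "\<dots> = m \<otimes> c" using c by (simp only: int_pow_mult int_pow_1)
    finally show ?thesis ..
  qed
  have "P c" unfolding P_def using c_conj c(1) c3 int_pow_1 by metis
  moreover have "\<forall>a. P a \<longrightarrow> ord a < Suc (order G)"
    using ord_le_group_order[OF fin] by (auto simp: P_def le_imp_less_Suc)
  ultimately obtain a where a: "P a" and amax: "\<And>b. P b \<Longrightarrow> ord b \<le> ord a"
    using ex_has_greatest_nat[of P c ord "Suc (order G)"] by blast
  have aG: "a \<in> carrier G" using a by (simp add: P_def)
  obtain q :: int where q: "c = a [^] q" using a by (auto simp: P_def)
  have "ord a dvd 2 ^ k" using ord_dvd_group_order[OF aG] ord by simp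
  then obtain N where N: "ord a = 2 ^ N" using divides_primepow_nat[OF two_is_prime_nat] by blast
  define T where "T = (2::int) ^ N"
  have T0: "T \<noteq> 0" and Tcop: "\<And>x::int. odd x \<Longrightarrow> coprime T x" by (auto simp: T_def)
  have eq_iff: "a [^] i = a [^] j \<longleftrightarrow> T dvd j - i" for i j :: int
    using int_pow_eq[OF aG] N by (simp add: T_def)
  have eq1: "a [^] i = \<one> \<longleftrightarrow> T dvd i" for i :: int
    using int_pow_eq_id[OF aG] N by (simp add: T_def)
  have sq: "a [^] i \<otimes> a [^] i = a [^] (2 * i)" for i :: int
    using int_pow_mult[OF aG, of i i] by simp
  have m_pow: "m = a [^] (2 * q)" using c(2) sq q by simp
  have "a [^] (4 * q) = \<one>" using sq[of "2 * q"] m_pow m(3) by simp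
  then obtain t where t: "4 * q = T * t" using eq1 by blast
  \<comment> \<open>\<open>c\<close> has order exactly 4, so \<open>q\<close> is an odd multiple of
    a quarter of the order of \<open>a\<close>. This oddness later forces \<open>r\<close> to be 1
    modulo 4.\<close>
  have t_odd: "odd t"
  proof
    assume "even t"
    then obtain t' where "t = 2 * t'" by blast
    then have "2 * (2 * q) = 2 * (T * t')" using t by simp
    then have "2 * q = T * t'" by (rule mult_left_cancel[THEN iffD1, rotated]) simp
    then have "a [^] (2 * q) = \<one>" using eq1 by simp
    then show False using m_pow m(2) by simp
  qed
  \<comment> \<open>A cyclic 2-group has only one involution, and \<open>m\<close> is an involution
    among the powers of \<open>a\<close>.\<close>
  have inv_A: "a [^] i = \<one> \<or> a [^] i = m" if "a [^] i \<otimes> a [^] i = \<one>" for i :: int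
  proof -
    have "T dvd 2 * i" using that sq eq1 by simp
    then obtain e where e: "2 * i = T * e" by (rule dvdE)
    show ?thesis
    proof (cases "even e")
      case True
      then obtain e' where "e = 2 * e'" by blast
      then have "2 * i = 2 * (T * e')" using e by simp
      then have "i = T * e'" by (rule mult_left_cancel[THEN iffD1, rotated]) simp
      then show ?thesis using eq1 by simp
    next
      case False
      then have "even (e - t)" using t_odd by simp
      then obtain f where "e - t = 2 * f" by (rule dvdE)
      then have "2 * (i - 2 * q) = T * (2 * f)" using e t by (simp add: algebra_simps)
      then have "2 * (i - 2 * q) = 2 * (T * f)" by simp
      then have "i - 2 * q = T * f" by (rule mult_left_cancel[THEN iffD1, rotated]) simp
      then show ?thesis using eq_iff[of "2 * q" i] m_pow by simp
    qed
  qed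
  define A where "A = generate G {a}"
  define D where "D = {x \<in> carrier G. c \<otimes> x = x \<otimes> c}"
  have A_iff: "u \<in> A \<longleftrightarrow> (\<exists>i::int. u = a [^] i)" for u
    unfolding A_def generate_pow[OF aG] by auto
  have D_iff: "u \<in> D \<longleftrightarrow> u \<in> carrier G \<and> c \<otimes> u = u \<otimes> c" for u
    by (simp add: D_def)
  have Asub: "subgroup A G" unfolding A_def using generate_is_subgroup[of "{a}"] aG by simp
  have Aclosed: "u \<otimes> v \<in> A" if "u \<in> A" "v \<in> A" for u v
    using subgroup.m_closed[OF Asub that] .
  have Aconj: "inv x \<otimes> u \<otimes> x \<in> A" if "x \<in> carrier G" "u \<in> A" for x u
  proof -
    obtain j :: int where "inv x \<otimes> a \<otimes> x = a [^] j" using a \<open>x \<in> carrier G\<close> by (auto simp: P_def)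
    then show ?thesis using conj_int_pow[OF aG that(1)] int_pow_pow[OF aG] that(2) by (auto simp: A_iff)
  qed
  have "A \<lhd> G"
  proof (unfold normal_inv_iff, intro conjI ballI Asub)
    fix x h assume "x \<in> carrier G" "h \<in> A"
    then show "x \<otimes> h \<otimes> inv x \<in> A" using Aconj[of "inv x" h] by simp
  qed
  have Dnorm: "D \<lhd> G"
  proof (unfold normal_inv_iff, intro conjI ballI)
    show "subgroup D G" unfolding D_def by (rule centralizer_subgroup[OF c(1)])
    fix x d assume x: "x \<in> carrier G" and "d \<in> D"
    then have d: "d \<in> carrier G" "c \<otimes> d = d \<otimes> c" by (auto simp: D_iff)
    let ?u = "inv x \<otimes> c \<otimes> x"
    have u: "?u \<in> carrier G" using x c(1) by simp
    have ud: "?u \<otimes> d = d \<otimes> ?u"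
      using c_conj[OF x] d m(4)[OF d(1)] m(1) c(1) by (metis m_assoc)
    have "c \<otimes> (x \<otimes> d \<otimes> inv x) = x \<otimes> (?u \<otimes> d) \<otimes> inv x"
      using x d(1) c(1) by (simp add: m_assoc cancel_inv_left)
    also have "\<dots> = x \<otimes> d \<otimes> inv x \<otimes> c"
      unfolding ud using x d(1) c(1) by (simp add: m_assoc)
    finally show "x \<otimes> d \<otimes> inv x \<in> D" using x d by (simp add: D_iff)
  qed
  have AD: "A \<subseteq> D"
  proof
    fix u assume "u \<in> A"
    then obtain i :: int where i: "u = a [^] i" using A_iff by blast
    have "c \<otimes> u = a [^] (q + i)" "u \<otimes> c = a [^] (i + q)" using int_pow_mult[OF aG] q i by auto
    then show "u \<in> D" using i aG by (simp add: D_iff add.commute)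
  qed
  have "D \<subseteq> A"
  proof (rule ccontr)
    assume "\<not> D \<subseteq> A"
    with AD have "A \<subset> D" by (rule subset_not_subset_eq[THEN iffD2, OF conjI])
    from two_group_central_mod[OF ord \<open>A \<lhd> G\<close> Dnorm this]
    obtain y where y: "y \<in> D" "y \<notin> A" "y \<otimes> y \<in> A"
      and yc: "\<And>x. x \<in> carrier G \<Longrightarrow> \<exists>d\<in>A. inv x \<otimes> y \<otimes> x = y \<otimes> d" by metis
    have yG: "y \<in> carrier G" using y by (simp add: D_iff)
    obtain \<kappa> :: int where \<kappa>: "y \<otimes> y = a [^] \<kappa>" using y(3) A_iff by blast
    obtain r :: int where r: "inv y \<otimes> a \<otimes> y = a [^] r" using a yG by (auto simp: P_def)
    have yconj: "inv y \<otimes> a [^] i \<otimes> y = a [^] (r * i)" for i :: int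
      using conj_int_pow[OF aG yG, of i] r int_pow_pow[OF aG] by simp
    \<comment> \<open>Since \<open>y\<close> fixes \<open>c\<close>, the exponent \<open>r\<close>
      is 1 modulo 4. Since \<open>y \<otimes> y\<close> is a power of \<open>a\<close>, the order
      \<open>T\<close> divides (1 - r)(1 + r), where 1 + r is twice an odd number. So
      \<open>T\<close> divides 2(r - 1), and \<open>y\<close> fixes \<open>a\<close> or multiplies
      it by \<open>m\<close>.\<close>
    have "inv y \<otimes> c \<otimes> y = c" using y(1) c(1) yG by (simp add: D_iff m_assoc cancel_left_inv)
    then have "a [^] (r * q) = a [^] q" using yconj q by simp
    then have "T dvd q - r * q" by (simp add: eq_iff)
    then obtain w0 where w0: "q - r * q = T * w0" by blast
    then have "T * (t * (r - 1)) = T * (- 4 * w0)"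
    proof -
      have "T * (t * (r - 1)) = - 4 * (q - r * q)"
        unfolding mult.assoc[symmetric, of T t] t[symmetric] by (simp add: algebra_simps)
      then show ?thesis unfolding w0 by simp
    qed
    then have "t * (r - 1) = - 4 * w0" using T0 mult_left_cancel by blast
    then have "2 ^ 2 dvd t * (r - 1)" by simp
    moreover have "coprime ((2::int) ^ 2) t" using t_odd unfolding coprime_power_left_iff coprime_left_2_iff_odd by simp
    ultimately have "2 ^ 2 dvd r - 1" using coprime_dvd_mult_right_iff by blast
    then have "4 dvd r - 1" by simp
    then obtain w where w: "r - 1 = 4 * w" by blast
    have "inv y \<otimes> (inv y \<otimes> a \<otimes> y) \<otimes> y = inv (y \<otimes> y) \<otimes> a \<otimes> (y \<otimes> y)"
      using yG aG by (simp add: m_assoc inv_mult_group)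
    also have "\<dots> = a"
      unfolding \<kappa> using aG by (simp add: int_pow_closed m_assoc cancel_left_inv) (metis cancel_left_inv int_pow_1 int_pow_closed int_pow_mult add.commute)
    finally have "a [^] (r * r) = a [^] (1::int)" using r yconj aG by simp
    then have "T dvd 1 - r * r" by (simp add: eq_iff)
    moreover have "1 - r * r = (1 - r) * (2 + (r - 1))" by (simp add: algebra_simps)
    then have "1 - r * r = (2 * (1 - r)) * (1 + 2 * w)" unfolding w by (simp add: algebra_simps)
    ultimately have "T dvd (2 * (1 - r)) * (1 + 2 * w)" by simp
    moreover have "coprime T (1 + 2 * w)" by (simp add: Tcop)
    ultimately have "T dvd 2 * (1 - r)" using coprime_dvd_mult_left_iff by blast
    then have "T dvd 2 * (r - 1)" by (metis dvd_minus_iff minus_diff_eq mult_minus_right)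
    then have "a [^] (r - 1) = \<one> \<or> a [^] (r - 1) = m"
      using inv_A[of "r - 1"] sq eq1 by simp
    moreover have "a [^] r = a [^] (r - 1) \<otimes> a" using int_pow_mult[OF aG, of "r - 1" 1] aG by simp
    ultimately have ay: "inv y \<otimes> a \<otimes> y = a \<or> inv y \<otimes> a \<otimes> y = m \<otimes> a" using r aG by auto
    \<comment> \<open>A conjugate of the involution \<open>?t\<close> is \<open>?t\<close> times a
      power of \<open>a\<close>, because \<open>y\<close> is central modulo these powers. It is
      again an involution, and \<open>td\<close> then leaves only \<open>?t\<close> and
      \<open>?t \<otimes> m\<close>. So \<open>?t\<close> is central up to sign and
      \<open>noE\<close> makes \<open>y\<close> a power of \<open>a\<close>.\<close>
    have key: False if tsq: "y \<otimes> a [^] i \<otimes> (y \<otimes> a [^] i) = \<one>"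
      and td: "\<And>l::int. (y \<otimes> a [^] i \<otimes> a [^] l) \<otimes> (y \<otimes> a [^] i \<otimes> a [^] l) = \<one> \<Longrightarrow> a [^] l = \<one> \<or> a [^] l = m"
      for i :: int
    proof -
      let ?t = "y \<otimes> a [^] i"
      have tG: "?t \<in> carrier G" using yG aG by simp
      have "?t = \<one> \<or> ?t = m"
      proof (rule noE[OF tG tsq])
        fix x assume x: "x \<in> carrier G"
        obtain d where d: "d \<in> A" "inv x \<otimes> y \<otimes> x = y \<otimes> d" using yc[OF x] by blast
        have dG: "d \<in> carrier G" using d(1) aG by (auto simp: A_iff)
        have "inv x \<otimes> ?t \<otimes> x = y \<otimes> d \<otimes> (inv x \<otimes> a [^] i \<otimes> x)"
          using conj_mult[OF yG _ x] aG d(2) by simp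
        also have "\<dots> = ?t \<otimes> (a [^] (- i) \<otimes> d \<otimes> (inv x \<otimes> a [^] i \<otimes> x))"
          using yG aG dG x by (simp add: m_assoc int_pow_neg cancel_inv_left)
        finally have txc: "inv x \<otimes> ?t \<otimes> x = ?t \<otimes> (a [^] (- i) \<otimes> d \<otimes> (inv x \<otimes> a [^] i \<otimes> x))" .
        have "a [^] (- i) \<otimes> d \<otimes> (inv x \<otimes> a [^] i \<otimes> x) \<in> A"
          by (rule Aclosed[OF Aclosed[OF _ d(1)] Aconj[OF x]]) (auto simp: A_iff)
        then obtain l :: int where "a [^] (- i) \<otimes> d \<otimes> (inv x \<otimes> a [^] i \<otimes> x) = a [^] l" using A_iff by blast
        with txc have l: "inv x \<otimes> ?t \<otimes> x = ?t \<otimes> a [^] l" by simp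
        have "(?t \<otimes> a [^] l) \<otimes> (?t \<otimes> a [^] l) = inv x \<otimes> (?t \<otimes> ?t) \<otimes> x"
          using conj_mult[OF tG tG x] l by simp
        also have "\<dots> = \<one>" using tsq x by simp
        finally have "a [^] l = \<one> \<or> a [^] l = m" by (rule td)
        moreover have "?t \<otimes> x = x \<otimes> (?t \<otimes> a [^] l)"
          using l tG x by (metis cancel_inv_left inv_closed m_assoc m_closed)
        moreover have "x \<otimes> (?t \<otimes> m) = m \<otimes> (x \<otimes> ?t)"
          using m(4)[of "x \<otimes> ?t"] x tG m(1) by (simp add: m_assoc)
        ultimately show "?t \<otimes> x = x \<otimes> ?t \<or> ?t \<otimes> x = m \<otimes> (x \<otimes> ?t)"
          using tG x by auto
      qed
      then have "?t \<in> A" using m_pow int_pow_0[of G a] unfolding A_iff by metis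
      moreover have "y = ?t \<otimes> a [^] (- i)" using yG aG by (simp add: m_assoc int_pow_neg)
      ultimately have "y \<in> A" using Aclosed[of ?t "a [^] (- i)"] A_iff by auto
      with y(2) show False ..
    qed
    from ay show False
    proof
      assume "inv y \<otimes> a \<otimes> y = a"
      then have comm: "inv y \<otimes> a [^] i \<otimes> y = a [^] i" for i :: int
        using conj_int_pow[OF aG yG, of i] by simp
      have ya: "a [^] i \<otimes> y = y \<otimes> a [^] i" for i :: int
        using comm[of i] yG aG by (metis cancel_inv_left int_pow_closed inv_closed m_assoc m_closed)
      have sqy: "(y \<otimes> a [^] i) \<otimes> (y \<otimes> a [^] i) = a [^] (\<kappa> + 2 * i)" for i :: int
      proof -
        have "(y \<otimes> a [^] i) \<otimes> (y \<otimes> a [^] i) = y \<otimes> (a [^] i \<otimes> y) \<otimes> a [^] i"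
          using yG aG by (simp add: m_assoc)
        also have "\<dots> = (y \<otimes> y) \<otimes> (a [^] i \<otimes> a [^] i)" unfolding ya using yG aG by (simp add: m_assoc)
        also have "\<dots> = a [^] (\<kappa> + 2 * i)" using \<kappa> sq aG by (simp add: int_pow_mult)
        finally show ?thesis .
      qed
      show False
      proof (cases "even \<kappa>")
        case True
        then obtain j where j: "\<kappa> = 2 * j" by blast
        show False
        proof (rule key[of "- j"])
          show "y \<otimes> a [^] (- j) \<otimes> (y \<otimes> a [^] (- j)) = \<one>" using sqy[of "- j"] j by simp
          fix l :: int
          assume "(y \<otimes> a [^] (- j) \<otimes> a [^] l) \<otimes> (y \<otimes> a [^] (- j) \<otimes> a [^] l) = \<one>"
          then have "(y \<otimes> a [^] (- j + l)) \<otimes> (y \<otimes> a [^] (- j + l)) = \<one>"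
            using yG aG by (simp only: int_pow_mult m_assoc int_pow_closed)
          then have "a [^] (2 * l) = \<one>" using sqy[of "- j + l"] j by simp
          then show "a [^] l = \<one> \<or> a [^] l = m" using inv_A sq by simp
        qed
      next
        case False
        \<comment> \<open>For odd \<open>\<kappa>\<close> the element \<open>y \<otimes> y\<close>
          generates the same group as \<open>a\<close>. So \<open>a\<close> is a power of
          \<open>y\<close>, and the cyclic normal subgroup generated by \<open>y\<close> contradicts
          the choice of \<open>a\<close>.\<close>
        then have "gcd \<kappa> T = 1" using Tcop by (metis coprime_iff_gcd_eq_1 gcd.commute)
        then obtain \<kappa>' v where "\<kappa>' * \<kappa> + v * T = 1" using bezout_int by metis
        then have "1 - \<kappa> * \<kappa>' = T * v" by (simp add: algebra_simps)
        then have "T dvd 1 - \<kappa> * \<kappa>'" by (rule dvdI)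
        then have "a [^] (\<kappa> * \<kappa>') = a [^] (1::int)" by (simp add: eq_iff)
        moreover have y2: "y [^] (2::int) = a [^] \<kappa>" using int_pow_mult[OF yG, of 1 1] \<kappa> yG by simp
        ultimately have ay: "a = y [^] (2 * \<kappa>')"
          using int_pow_pow[OF yG, of 2 \<kappa>'] int_pow_pow[OF aG, of \<kappa> \<kappa>'] aG by simp
        then have api: "a [^] i = y [^] (2 * \<kappa>' * i)" for i :: int using int_pow_pow[OF yG] by simp
        have "P y" unfolding P_def
        proof (intro conjI ballI)
          show "y \<in> carrier G" by (rule yG)
          show "\<exists>q::int. c = y [^] q" using q api by blast
          fix x assume "x \<in> carrier G"
          then obtain d where d: "d \<in> A" "inv x \<otimes> y \<otimes> x = y \<otimes> d" using yc by blast
          then obtain l :: int where "d = a [^] l" using A_iff by blast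
          then have "inv x \<otimes> y \<otimes> x = y [^] (1 + 2 * \<kappa>' * l)"
            using d api int_pow_mult[OF yG, of 1] yG by simp
          then show "\<exists>j::int. inv x \<otimes> y \<otimes> x = y [^] j" by blast
        qed
        then have "ord y \<le> ord a" by (rule amax)
        moreover have "generate G {a} \<subset> generate G {y}"
        proof
          show "generate G {a} \<subseteq> generate G {y}"
            using api unfolding generate_pow[OF aG] generate_pow[OF yG] by blast
          have "y \<in> generate G {y}" by (simp add: generate.incl)
          then show "generate G {a} \<noteq> generate G {y}" using y(2) A_def by auto
        qed
        moreover have "finite (generate G {y})"
          using fin generate_incl[of "{y}"] yG by (auto intro: finite_subset)
        ultimately show False
          using psubset_card_mono[of "generate G {y}" "generate G {a}"] generate_pow_card[OF aG] generate_pow_card[OF yG] by simp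
      qed
    next
      assume "inv y \<otimes> a \<otimes> y = m \<otimes> a"
      then have conj: "inv y \<otimes> a [^] i \<otimes> y = m [^] i \<otimes> a [^] i" for i :: int
        using conj_int_pow[OF aG yG, of i] int_pow_mult_distrib[OF m(4)[OF aG] m(1) aG] by simp
      have mi: "m [^] i = (if even i then \<one> else m)" for i :: int
        by (rule involution_int_pow[OF m(1,3)])
      have ma: "m \<otimes> a [^] i \<noteq> a [^] i" for i :: int
        using m(1,2) aG by simp
      have "inv y \<otimes> (y \<otimes> y) \<otimes> y = y \<otimes> y" using yG by (simp add: m_assoc cancel_left_inv)
      then have "even \<kappa>" using conj[of \<kappa>] \<kappa> mi[of \<kappa>] ma[of \<kappa>] by (auto split: if_splits)
      then obtain j where j: "\<kappa> = 2 * j" by blast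
      have "inv y \<otimes> c \<otimes> y = c" using y(1) c(1) yG by (simp add: D_iff m_assoc cancel_left_inv)
      then have q_even: "even q" using conj[of q] q mi[of q] ma[of q] by (auto split: if_splits)
      have sqy: "(y \<otimes> a [^] i) \<otimes> (y \<otimes> a [^] i) = m [^] i \<otimes> a [^] (2 * j + 2 * i)" for i :: int
      proof -
        have "(y \<otimes> a [^] i) \<otimes> (y \<otimes> a [^] i) = (y \<otimes> y) \<otimes> (inv y \<otimes> a [^] i \<otimes> y) \<otimes> a [^] i"
          using yG aG by (simp add: m_assoc cancel_inv_left)
        also have "\<dots> = m [^] i \<otimes> (a [^] \<kappa> \<otimes> (a [^] i \<otimes> a [^] i))"
          unfolding conj \<kappa> mi using m(1,4) aG by (simp add: m_assoc)
        also have "\<dots> = m [^] i \<otimes> a [^] (2 * j + 2 * i)"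
          using sq j aG by (simp add: int_pow_mult)
        finally show ?thesis .
      qed
      \<comment> \<open>For even \<open>j\<close> the exponent - j cancels everything. For odd
        \<open>j\<close> the exponent q - j is odd, and the square is \<open>m\<close> times
        \<open>a [^] (2 * q)\<close>, which is \<open>m \<otimes> m\<close>.\<close>
      obtain i :: int where i: "(y \<otimes> a [^] i) \<otimes> (y \<otimes> a [^] i) = \<one>"
      proof (cases "even j")
        case True
        then show thesis using that[of "- j"] sqy[of "- j"] mi by simp
      next
        case False
        have "2 * j + 2 * (q - j) = 2 * q" by simp
        then show thesis using that[of "q - j"] sqy[of "q - j"] mi[of "q - j"] False q_even m_pow m(3) by simp
      qed
      show False
      proof (rule key[OF i])
        fix l :: int
        assume "(y \<otimes> a [^] i \<otimes> a [^] l) \<otimes> (y \<otimes> a [^] i \<otimes> a [^] l) = \<one>"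
        then have "(y \<otimes> a [^] (i + l)) \<otimes> (y \<otimes> a [^] (i + l)) = \<one>"
          using yG aG by (simp only: int_pow_mult m_assoc int_pow_closed)
        then have "m [^] (i + l) \<otimes> a [^] (2 * j + 2 * (i + l)) = \<one>" using sqy by simp
        moreover have "m [^] (i + l) \<otimes> a [^] (2 * j + 2 * (i + l)) = m [^] l \<otimes> a [^] (2 * l)"
        proof -
          have "m [^] (i + l) \<otimes> a [^] (2 * j + 2 * (i + l)) = m [^] l \<otimes> m [^] i \<otimes> (a [^] (2 * j + 2 * i) \<otimes> a [^] (2 * l))"
            using m(1) aG by (simp flip: int_pow_mult add: algebra_simps)
          also have "\<dots> = m [^] l \<otimes> ((m [^] i \<otimes> a [^] (2 * j + 2 * i)) \<otimes> a [^] (2 * l))"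
            using m(1) aG by (simp add: m_assoc)
          also have "\<dots> = m [^] l \<otimes> a [^] (2 * l)" using i sqy[of i] aG by simp
          finally show ?thesis .
        qed
        ultimately have ml: "m [^] l \<otimes> a [^] (2 * l) = \<one>" by simp
        show "a [^] l = \<one> \<or> a [^] l = m"
        proof (cases "even l")
          case True
          then show ?thesis using ml mi[of l] inv_A[of l] sq aG by simp
        next
          case False
          \<comment> \<open>An odd \<open>l\<close> would make the order of \<open>a\<close> divide
            4. As \<open>q\<close> is even, \<open>m\<close>, which is \<open>a [^] (2 * q)\<close>,
            would then be trivial.\<close>
          then have "m \<otimes> a [^] (2 * l) = \<one>" using ml mi by simp
          then have "a [^] (2 * l) = m" using m(1,3) aG by (metis int_pow_closed inv_equality inv_inv inv_unique)
          then have "a [^] (4 * l) = \<one>" using sq[of "2 * l"] m(3) by simp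
          then have "T dvd 4 * l" using eq1 by simp
          moreover have "coprime T l" using False by (rule Tcop)
          ultimately have "T dvd (4::int)" using coprime_dvd_mult_left_iff by blast
          moreover have "4 dvd 2 * q" using q_even by auto
          ultimately have "T dvd 2 * q" by (rule dvd_trans)
          then show ?thesis using eq1 m_pow m(2) by simp
        qed
      qed
    qed
  qed
  then show thesis using that[OF aG _ inv_A] A_iff D_iff by blast
qed

end

section \<open>Linear actions of 2-groups\<close>

text \<open>Translation by 1 permutes the ring. Comparing the two sums over the ring gives p * 1 =
  0, so the characteristic is a divisor of \<open>p\<close> other than 1.\<close>

lemma of_nat_eq_0_iff_dvd_card:
  assumes "Factorial_Ring.prime p" "CARD('k::comm_ring_1) = p"
  shows "(of_nat n :: 'k) = 0 \<longleftrightarrow> p dvd n"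
proof -
  have fin: "finite (UNIV :: 'k set)" using assms prime_gt_0_nat by (metis card.infinite less_irrefl)
  have "(\<Sum>x\<in>(UNIV::'k set). x + 1) = (\<Sum>x\<in>UNIV. x)"
    by (rule sum.reindex_bij_witness[of _ "\<lambda>x. x - 1" "\<lambda>x. x + 1"]) auto
  then have "(of_nat p :: 'k) = 0"
    using assms(2) by (simp add: sum.distrib)
  then have "CHAR('k) dvd p" by (simp only: of_nat_eq_0_iff_char_dvd)
  moreover have "CHAR('k) \<noteq> 1" using of_nat_eq_0_iff_char_dvd[of 1, where 'a='k] by simp
  ultimately have "CHAR('k) = p" using assms(1) by (metis prime_nat_iff)
  then show ?thesis by (simp add: of_nat_eq_0_iff_char_dvd)
qed

text \<open>The last term other than 1 among the repeated squares of \<open>l\<close> is a square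
  root of 1, hence - 1.\<close>

lemma power_two_power_eq_minus_one:
  fixes l :: "'k::field"
  assumes "l ^ (2 ^ n) = 1" "l ^ (2 ^ a) \<noteq> 1"
  obtains j where "j \<ge> a" "l ^ (2 ^ j) = - 1"
proof -
  define N where "N = (LEAST n. l ^ (2 ^ n) = 1)"
  have N: "l ^ (2 ^ N) = 1" unfolding N_def using assms(1) by (rule LeastI)
  have "N > a"
  proof (rule ccontr)
    assume "\<not> N > a"
    then have "l ^ (2 ^ a) = (l ^ (2 ^ N)) ^ (2 ^ (a - N))"
      by (simp flip: power_mult power_add)
    then show False using N assms(2) by simp
  qed
  then obtain j where j: "N = Suc j" "j \<ge> a" by (metis Suc_le_D less_eq_Suc_le Suc_le_mono)
  have "l ^ (2 ^ j) \<noteq> 1" using not_less_Least[of j "\<lambda>n. l ^ (2 ^ n) = 1"] j N_def by auto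
  moreover have "(l ^ (2 ^ j)) ^ 2 = 1" using N j by (simp flip: power_mult add: mult.commute)
  ultimately have "l ^ (2 ^ j) = - 1" by (simp add: power2_eq_1_iff)
  then show thesis using j that by blast
qed

definition eigenvectors_on :: "('k::field \<Rightarrow> 'v::ab_group_add \<Rightarrow> 'v) \<Rightarrow> ('g, 'm) monoid_scheme \<Rightarrow> ('v \<Rightarrow> 'g \<Rightarrow> 'v) \<Rightarrow> 'v set \<Rightarrow> bool" where
  "eigenvectors_on smul G act U \<longleftrightarrow> (\<forall>u\<in>U. \<forall>l. l \<noteq> 0 \<longrightarrow> (\<exists>g\<in>carrier G. act u g = smul l u))"

text \<open>The consequence of rationality on which the induction runs. Unlike rationality of \<open>G\<close> it passes to
  the eigenspaces of an involution and their stabilisers. It is asked of all stable \<open>Y\<close>, not only of \<open>U\<close>.\<close>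

definition balanced_on :: "('k::field \<Rightarrow> 'v::ab_group_add \<Rightarrow> 'v) \<Rightarrow> ('g, 'm) monoid_scheme \<Rightarrow> ('v \<Rightarrow> 'g \<Rightarrow> 'v) \<Rightarrow> 'v set \<Rightarrow> bool" where
  "balanced_on smul G act U \<longleftrightarrow> (\<forall>Y g l. module.subspace smul Y \<longrightarrow> Y \<subseteq> U \<longrightarrow>
     (\<forall>y\<in>Y. \<forall>x\<in>carrier G. act y x \<in> Y) \<longrightarrow> g \<in> carrier G \<longrightarrow> l \<noteq> 0 \<longrightarrow> l * l \<noteq> 1 \<longrightarrow>
     card {y \<in> Y. act y g = smul l y} = card {y \<in> Y. act y g = smul (- l) y})"

text \<open>The matrix \<open>quat_matrix q\<close> applied to the column with entries
  \<open>u\<close> and \<open>w\<close>. Its entries are cast into \<open>'k\<close>, which will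
  only be some field with five elements and not the type \<open>5\<close>.\<close>

definition quat_pair :: "('k::field \<Rightarrow> 'v::ab_group_add \<Rightarrow> 'v) \<Rightarrow> quat \<Rightarrow> 'v \<times> 'v \<Rightarrow> 'v \<times> 'v" where
  "quat_pair smul = (\<lambda>(a, b, c, d) (u, w).
     (smul (of_int (a + 2 * b)) u + smul (of_int (c + 2 * d)) w,
      smul (of_int (- c + 2 * d)) u + smul (of_int (a - 2 * b)) w))"

text \<open>All laws are confined to \<open>U\<close>, because the action is later restricted to
  eigenspaces and replaced by maps that are meaningful on \<open>U\<close> alone. Faithfulness is
  left out since it is lost on eigenspaces.\<close>

locale linear_two_group = group G + vector_space smul
  for G :: "('g, 'm) monoid_scheme" (structure)
    and smul :: "'k::field \<Rightarrow> 'v::ab_group_add \<Rightarrow> 'v" (infixr \<open>*\<^sub>k\<close> 75) +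
  fixes act :: "'v \<Rightarrow> 'g \<Rightarrow> 'v" and U :: "'v set"
  assumes two_power_order: "\<exists>k. order G = 2 ^ k"
    and finite_U: "finite U" and subspace_U: "subspace U"
    and act_closed: "u \<in> U \<Longrightarrow> g \<in> carrier G \<Longrightarrow> act u g \<in> U"
    and act_add: "u \<in> U \<Longrightarrow> v \<in> U \<Longrightarrow> g \<in> carrier G \<Longrightarrow> act (u + v) g = act u g + act v g"
    and act_scale: "u \<in> U \<Longrightarrow> g \<in> carrier G \<Longrightarrow> act (l *\<^sub>k u) g = l *\<^sub>k act u g"
    and act_one: "u \<in> U \<Longrightarrow> act u \<one> = u"
    and act_mult: "u \<in> U \<Longrightarrow> g \<in> carrier G \<Longrightarrow> h \<in> carrier G \<Longrightarrow> act u (g \<otimes> h) = act (act u g) h"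
begin

lemmas sub0 = subspace_0[OF subspace_U]
  and sub_add = subspace_add[OF subspace_U]
  and sub_scale = subspace_scale[OF subspace_U]
  and sub_diff = subspace_diff[OF subspace_U]
  and sub_neg = subspace_neg[OF subspace_U]

lemma act_zero: "g \<in> carrier G \<Longrightarrow> act 0 g = 0"
  using act_scale[OF sub0, of g 0] by simp

lemma act_minus: "u \<in> U \<Longrightarrow> g \<in> carrier G \<Longrightarrow> act (- u) g = - act u g"
  using act_scale[of u g "- 1"] by simp

lemma act_diff: "u \<in> U \<Longrightarrow> v \<in> U \<Longrightarrow> g \<in> carrier G \<Longrightarrow> act (u - v) g = act u g - act v g"
  using act_add[of u "- v" g] act_minus[of v g] sub_neg by simp

lemma act_inv_right: "u \<in> U \<Longrightarrow> g \<in> carrier G \<Longrightarrow> act (act u g) (inv g) = u"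
  using act_mult[of u g "inv g"] act_one by simp

lemma act_inv_left: "u \<in> U \<Longrightarrow> g \<in> carrier G \<Longrightarrow> act (act u (inv g)) g = u"
  using act_mult[of u "inv g" g] act_one by simp

lemma act_eq_0_iff: "u \<in> U \<Longrightarrow> g \<in> carrier G \<Longrightarrow> act u g = 0 \<longleftrightarrow> u = 0"
  using act_inv_right[of u g] act_zero by force

lemma act_pow: "u \<in> U \<Longrightarrow> g \<in> carrier G \<Longrightarrow> act u g = l *\<^sub>k u \<Longrightarrow> act u (g [^] (n::nat)) = l ^ n *\<^sub>k u"
proof (induction n)
  case (Suc n)
  then show ?case using act_mult[of u "g [^] n" g] act_scale[of u g "l ^ n"] by (simp add: mult.commute)
qed (simp add: act_one)

text \<open>An element of a 2-group can scale a non-zero vector only by a scalar of 2-power order.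
  The eigenvector property extends this to every non-zero scalar.\<close>

lemma scalar_two_power:
  fixes l :: 'k
  assumes "eigenvectors_on smul G act U" "u \<in> U" "u \<noteq> 0" "l \<noteq> 0"
  obtains n where "l ^ (2 ^ n) = 1"
proof -
  obtain k where k: "order G = 2 ^ k" using two_power_order by blast
  obtain g where g: "g \<in> carrier G" "act u g = l *\<^sub>k u" using assms by (auto simp: eigenvectors_on_def)
  have "act u (g [^] ((2::nat) ^ k)) = l ^ (2 ^ k) *\<^sub>k u" by (rule act_pow[OF assms(2) g])
  moreover have "g [^] ((2::nat) ^ k) = \<one>" using pow_order_eq_1[OF g(1)] k by simp
  ultimately have "l ^ (2 ^ k) *\<^sub>k u = 1 *\<^sub>k u" using act_one assms(2) by simp
  then have "l ^ (2 ^ k) = 1" using assms(3) unfolding scale_cancel_right by simp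
  then show thesis by (rule that)
qed

text \<open>Balance speaks of subspaces stable under all of \<open>G\<close>, whereas those that
  arise are stable only under a subgroup of index 2. Adding one translate repairs this. It is used
  for the centraliser of \<open>c\<close> and for the stabiliser of the eigenspaces of an
  involution.\<close>

lemma translate_sum:
  assumes D: "subgroup D G"
    and idx: "\<And>x y. x \<in> carrier G \<Longrightarrow> y \<in> carrier G \<Longrightarrow> x \<notin> D \<Longrightarrow> y \<notin> D \<Longrightarrow> x \<otimes> y \<in> D"
    and s: "s \<in> carrier G" "s \<notin> D"
    and Y: "subspace Y" "Y \<subseteq> U" "\<And>y x. y \<in> Y \<Longrightarrow> x \<in> D \<Longrightarrow> act y x \<in> Y"
  defines "Z \<equiv> (\<lambda>z. act z s) ` Y"
  defines "Y' \<equiv> {y + w | y w. y \<in> Y \<and> w \<in> Z}"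
  shows "subspace Z" "subspace Y'" "Y' \<subseteq> U" "\<forall>v\<in>Y'. \<forall>x\<in>carrier G. act v x \<in> Y'"
proof -
  interpret D: subgroup D G by (rule D)
  have YU: "y \<in> U" if "y \<in> Y" for y using that Y(2) by blast
  show Z: "subspace Z"
  proof (rule subspaceI)
    show "0 \<in> Z" using subspace_0[OF Y(1)] act_zero[OF s(1)] by (force simp: Z_def)
    show "x + y \<in> Z" if "x \<in> Z" "y \<in> Z" for x y
      using that subspace_add[OF Y(1)] act_add[OF YU YU s(1)] by (auto simp: Z_def image_iff) metis
    show "c *\<^sub>k x \<in> Z" if "x \<in> Z" for c x
      using that subspace_scale[OF Y(1)] act_scale[OF YU s(1)] by (auto simp: Z_def image_iff) metis
  qed
  show "subspace Y'" unfolding Y'_def using subspace_sums[OF Y(1) Z] by simp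
  show "Y' \<subseteq> U" using YU act_closed s(1) sub_add by (auto simp: Y'_def Z_def)
  have inv: "inv x \<notin> D" if "x \<in> carrier G" "x \<notin> D" for x using that D.m_inv_closed[of "inv x"] by auto
  show "\<forall>v\<in>Y'. \<forall>x\<in>carrier G. act v x \<in> Y'"
  proof (intro ballI)
    fix v x assume "v \<in> Y'" and x: "x \<in> carrier G"
    then obtain y z where v: "v = y + act z s" and y: "y \<in> Y" and z: "z \<in> Y" by (auto simp: Y'_def Z_def)
    have vx: "act v x = act y x + act z (s \<otimes> x)"
      using v act_add[OF YU[OF y] act_closed[OF YU[OF z] s(1)] x] act_mult[OF YU[OF z] s(1) x] by simp
    have Y'I: "y + act z s \<in> Y'" if "y \<in> Y" "z \<in> Y" for y z using that by (auto simp: Y'_def Z_def)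
    have via: "act u h = act (act u (h \<otimes> inv s)) s" if "u \<in> Y" "h \<in> carrier G" for u h
      using act_mult[OF YU[OF that(1)], of "h \<otimes> inv s" s] that(2) s(1) by (simp add: m_assoc)
    show "act v x \<in> Y'"
    proof (cases "x \<in> D")
      case True
      have "s \<otimes> x \<notin> D"
      proof
        assume "s \<otimes> x \<in> D"
        then have "s \<otimes> x \<otimes> inv x \<in> D" using True by blast
        then show False using s x by (simp add: m_assoc)
      qed
      then have "s \<otimes> x \<otimes> inv s \<in> D" using idx[OF _ _ _ inv[OF s]] s(1) x by simp
      then have "act z (s \<otimes> x \<otimes> inv s) \<in> Y" using Y(3) z by blast
      then show ?thesis unfolding vx using via[OF z, of "s \<otimes> x"] Y'I Y(3)[OF y True] s(1) x by simp
    next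
      case False
      have "act y (x \<otimes> inv s) \<in> Y" using idx[OF x _ False inv[OF s]] s(1) Y(3) y by simp
      moreover have "act z (s \<otimes> x) \<in> Y" using idx[OF s(1) x s(2) False] Y(3) z by blast
      ultimately have "act z (s \<otimes> x) + act (act y (x \<otimes> inv s)) s \<in> Y'" by (rule Y'I[rotated])
      then show ?thesis unfolding vx via[OF y x] by (simp only: add.commute)
    qed
  qed
qed

end

text \<open>The terminal case of the induction, where nothing is left to split along.
  \<open>prim\<close> speaks of maps on \<open>U\<close> rather than of group elements, so that it
  survives the passage to the image of the group.\<close>

locale primitive_two_group = linear_two_group G smul act U
  for G :: "('g, 'm) monoid_scheme" (structure)
    and smul :: "'k::field \<Rightarrow> 'v::ab_group_add \<Rightarrow> 'v" (infixr \<open>*\<^sub>k\<close> 75)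
    and act :: "'v \<Rightarrow> 'g \<Rightarrow> 'v" and U :: "'v set" +
  fixes p :: nat
  assumes faithful: "\<And>g. g \<in> carrier G \<Longrightarrow> \<forall>u\<in>U. act u g = u \<Longrightarrow> g = \<one>"
    and prime_p: "Factorial_Ring.prime p" "p \<ge> 5" "CARD('k) = p"
    and eig: "eigenvectors_on smul G act U"
    and bal: "balanced_on smul G act U"
    and U_nonzero: "\<exists>u\<in>U. u \<noteq> 0"
    and prim: "\<And>e. e \<in> carrier G \<Longrightarrow> (\<forall>u\<in>U. act (act u e) e = u) \<Longrightarrow>
      (\<forall>x\<in>carrier G. (\<forall>u\<in>U. act (act u x) e = act (act u e) x) \<or>
         (\<forall>u\<in>U. act (act u x) e = - act (act u e) x)) \<Longrightarrow>
      (\<forall>u\<in>U. act u e = u) \<or> (\<forall>u\<in>U. act u e = - u)"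
begin

lemma two_ne_0: "(2::'k) \<noteq> 0" and three_ne_0: "(3::'k) \<noteq> 0"
  using of_nat_eq_0_iff_dvd_card[OF prime_p(1,3), of 2] of_nat_eq_0_iff_dvd_card[OF prime_p(1,3), of 3] prime_p(2)
    dvd_imp_le[of p 2] dvd_imp_le[of p 3] by auto

lemma eq_minus_imp_0: "u = - u \<Longrightarrow> u = (0::'v)"
proof -
  assume "u = - u"
  then have "u + u = 0" by (metis add.right_inverse)
  then have "(1 + 1) *\<^sub>k u = 0" unfolding scale_left_distrib by simp
  then show ?thesis using two_ne_0 by simp
qed

lemma act_inject:
  assumes "g \<in> carrier G" "h \<in> carrier G" "\<And>u. u \<in> U \<Longrightarrow> act u g = act u h"
  shows "g = h"
proof -
  have "\<forall>u\<in>U. act u (g \<otimes> inv h) = u" using assms act_mult act_inv_right by simp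
  then have "g \<otimes> inv h = \<one>" using assms faithful by simp
  then show ?thesis using assms(1,2) by (metis inv_closed inv_equality inv_inv)
qed

lemma ex_doubling:
  obtains u g where "u \<in> U" "u \<noteq> 0" "g \<in> carrier G" "act u g = 2 *\<^sub>k u" "g \<noteq> \<one>"
proof -
  obtain u where u: "u \<in> U" "u \<noteq> 0" using U_nonzero by blast
  obtain g where g: "g \<in> carrier G" "act u g = 2 *\<^sub>k u"
    using eig u(1) two_ne_0 by (auto simp: eigenvectors_on_def)
  have "g \<noteq> \<one>"
  proof
    assume "g = \<one>"
    then have "2 *\<^sub>k u = 1 *\<^sub>k u" using g act_one u(1) by simp
    then have "(2::'k) = 1" using u(2) unfolding scale_cancel_right by simp
    then show False by (metis one_add_one add_cancel_left_right zero_neq_one)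
  qed
  with u g show thesis by (rule that)
qed

lemma minus_one:
  assumes m: "m \<in> carrier G" and mU: "\<forall>u\<in>U. act u m = - u"
  shows "m \<noteq> \<one>" "m \<otimes> m = \<one>" "\<And>x. x \<in> carrier G \<Longrightarrow> m \<otimes> x = x \<otimes> m"
proof -
  show "m \<noteq> \<one>" using U_nonzero mU act_one eq_minus_imp_0 by metis
  show "m \<otimes> m = \<one>" using m mU act_mult sub_neg by (intro faithful) auto
  show "m \<otimes> x = x \<otimes> m" if "x \<in> carrier G" for x
    using that m mU act_mult act_minus act_closed by (intro act_inject) auto
qed

text \<open>Faithfulness turns \<open>prim\<close> into a statement about group elements. It serves
  as the hypothesis \<open>noE\<close> under which the centraliser of \<open>c\<close> is
  cyclic.\<close>

lemma eq_sign_if_almost_central: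
  assumes m: "m \<in> carrier G" and mU: "\<forall>u\<in>U. act u m = - u"
    and x: "x \<in> carrier G" "x \<otimes> x = \<one>"
    and xx: "\<And>y. y \<in> carrier G \<Longrightarrow> x \<otimes> y = y \<otimes> x \<or> x \<otimes> y = m \<otimes> (y \<otimes> x)"
  shows "x = \<one> \<or> x = m"
proof -
  have "(\<forall>u\<in>U. act u x = u) \<or> (\<forall>u\<in>U. act u x = - u)"
  proof (rule prim[OF x(1)])
    show "\<forall>u\<in>U. act (act u x) x = u" using act_mult[of _ x x] x act_one by auto
    show "\<forall>y\<in>carrier G. (\<forall>u\<in>U. act (act u y) x = act (act u x) y) \<or> (\<forall>u\<in>U. act (act u y) x = - act (act u x) y)"
    proof
      fix y assume y: "y \<in> carrier G"
      have "act u (m \<otimes> (y \<otimes> x)) = - act (act u y) x" if u: "u \<in> U" for u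
        using u m mU y x(1) act_mult act_minus act_closed sub_neg by simp
      then show "(\<forall>u\<in>U. act (act u y) x = act (act u x) y) \<or> (\<forall>u\<in>U. act (act u y) x = - act (act u x) y)"
        using xx[OF y] act_mult[OF _ x(1) y] act_mult[OF _ y x(1)] by (metis minus_minus)
    qed
  qed
  then show ?thesis
  proof
    assume "\<forall>u\<in>U. act u x = u"
    then have "x = \<one>" by (rule faithful[OF x(1)])
    then show ?thesis ..
  next
    assume "\<forall>u\<in>U. act u x = - u"
    then have "x = m" using mU by (intro act_inject x(1) m) simp
    then show ?thesis ..
  qed
qed

text \<open>A non-trivial 2-group has a central involution, and \<open>prim\<close> allows it only
  to act as - 1.\<close>

lemma ex_minus_one:
  obtains m where "m \<in> carrier G" "\<And>u. u \<in> U \<Longrightarrow> act u m = - u"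
proof -
  obtain u0 g where "g \<in> carrier G" "g \<noteq> \<one>" using ex_doubling by blast
  then have sub: "{\<one>} \<subset> carrier G" by auto
  obtain k where k: "order G = 2 ^ k" using two_power_order by blast
  from two_group_central_quotient[OF k one_is_normal sub]
  obtain m where m: "m \<in> carrier G" "m \<notin> {\<one>}" "m \<otimes> m \<in> {\<one>}"
    and mc: "\<And>x. x \<in> carrier G \<Longrightarrow> \<exists>d\<in>{\<one>}. inv x \<otimes> m \<otimes> x = m \<otimes> d" by metis
  have cm: "m \<otimes> x = x \<otimes> m" if "x \<in> carrier G" for x
  proof -
    have "inv x \<otimes> m \<otimes> x = m" using mc[OF that] m(1) by simp
    then have "x \<otimes> (inv x \<otimes> (m \<otimes> x)) = x \<otimes> m" using that m(1) by (simp add: m_assoc)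
    then show ?thesis using that m(1) by (simp add: cancel_inv_left)
  qed
  have "(\<forall>u\<in>U. act u m = u) \<or> (\<forall>u\<in>U. act u m = - u)"
  proof (rule prim[OF m(1)])
    show "\<forall>u\<in>U. act (act u m) m = u" using act_mult[of _ m m] m act_one by auto
    show "\<forall>x\<in>carrier G. (\<forall>u\<in>U. act (act u x) m = act (act u m) x) \<or> (\<forall>u\<in>U. act (act u x) m = - act (act u m) x)"
      using act_mult cm m(1) by metis
  qed
  then show thesis using that faithful[OF m(1)] m(1,2) by auto
qed

text \<open>As 3 is not 0, the square of 2 is not 1. So - 1 is among the repeated squares of 2, at
  index 1 or later, and is itself a square.\<close>

lemma ex_sqrt_minus_one: obtains \<iota> :: 'k where "\<iota> * \<iota> = - 1"
proof -
  obtain u0 where u0: "u0 \<in> U" "u0 \<noteq> 0" using U_nonzero by blast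
  obtain n where n: "(2::'k) ^ (2 ^ n) = 1" using scalar_two_power[OF eig u0 two_ne_0] by blast
  have "(2::'k) ^ (2 ^ 1) \<noteq> 1"
  proof
    assume "(2::'k) ^ (2 ^ 1) = 1"
    moreover have "(3::'k) = 2 ^ (2 ^ 1) - 1" by simp
    ultimately have "(3::'k) = 0" by simp
    with three_ne_0 show False ..
  qed
  from power_two_power_eq_minus_one[OF n this] obtain j where j: "j \<ge> 1" "(2::'k) ^ (2 ^ j) = - 1" by blast
  then obtain i where i: "j = Suc i" by (cases j) auto
  have "(2::nat) ^ Suc i = 2 ^ i + 2 ^ i" by simp
  then have "(2::'k) ^ (2 ^ i) * 2 ^ (2 ^ i) = - 1"
    using j(2) unfolding i by (metis power_add)
  then show thesis by (rule that)
qed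

text \<open>\<open>c\<close> comes from the centre of the quotient by the two signs. Its square is
  \<open>m\<close>, since otherwise \<open>c\<close> would be an involution, central up to sign and
  not a sign. That some \<open>s\<close> fails to commute with \<open>c\<close> is the first use of
  balance.\<close>

lemma ex_quarter:
  obtains m c s where "m \<in> carrier G" "\<And>u. u \<in> U \<Longrightarrow> act u m = - u"
    "c \<in> carrier G" "c \<otimes> c = m" "\<And>x. x \<in> carrier G \<Longrightarrow> c \<otimes> x = x \<otimes> c \<or> c \<otimes> x = m \<otimes> (x \<otimes> c)"
    "s \<in> carrier G" "c \<otimes> s = m \<otimes> (s \<otimes> c)"
    "\<And>x y. x \<in> carrier G \<Longrightarrow> y \<in> carrier G \<Longrightarrow> c \<otimes> x = x \<otimes> c \<Longrightarrow> c \<otimes> y = y \<otimes> c \<Longrightarrow> x \<otimes> y = y \<otimes> x"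
    "\<And>x. x \<in> carrier G \<Longrightarrow> c \<otimes> x = x \<otimes> c \<Longrightarrow> x \<otimes> x = \<one> \<Longrightarrow> x = \<one> \<or> x = m"
proof -
  obtain m where m0: "m \<in> carrier G" "\<And>u. u \<in> U \<Longrightarrow> act u m = - u" using ex_minus_one by blast
  have mU: "\<forall>u\<in>U. act u m = - u" using m0(2) by blast
  note m = m0 minus_one[OF m0(1) mU] and noE = eq_sign_if_almost_central[OF m0(1) mU]
  obtain u0 g where u0: "u0 \<in> U" "u0 \<noteq> 0" and g: "g \<in> carrier G" "act u0 g = 2 *\<^sub>k u0" "g \<noteq> \<one>" by (rule ex_doubling)
  moreover have "g \<noteq> m"
  proof
    assume "g = m"
    then have "2 *\<^sub>k u0 = (- 1) *\<^sub>k u0" using g m(2) u0(1) by simp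
    then have "(2::'k) = - 1" using u0(2) unfolding scale_cancel_right by simp
    then have "(3::'k) = 0" by (simp add: eq_neg_iff_add_eq_0)
    with three_ne_0 show False ..
  qed
  ultimately have sub: "{\<one>, m} \<subset> carrier G" using m(1) by auto
  have mm: "inv m = m" using m(1,4) by (simp add: inv_equality)
  have Z: "{\<one>, m} \<lhd> G"
  proof (unfold normal_inv_iff, intro conjI ballI)
    show "subgroup {\<one>, m} G" by (rule subgroupI) (use m(1,4) mm in auto)
    fix x h assume "x \<in> carrier G" "h \<in> {\<one>, m}"
    then show "x \<otimes> h \<otimes> inv x \<in> {\<one>, m}"
      using m(1) m(5)[of x, symmetric] by (auto simp: m_assoc)
  qed
  obtain k where k: "order G = 2 ^ k" using two_power_order by blast
  from two_group_central_quotient[OF k Z sub]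
  obtain c where c: "c \<in> carrier G" "c \<notin> {\<one>, m}" "c \<otimes> c \<in> {\<one>, m}"
    and cc: "\<And>x. x \<in> carrier G \<Longrightarrow> \<exists>d\<in>{\<one>, m}. inv x \<otimes> c \<otimes> x = c \<otimes> d" by metis
  have cx: "c \<otimes> x = x \<otimes> c \<or> c \<otimes> x = m \<otimes> (x \<otimes> c)" if x: "x \<in> carrier G" for x
  proof -
    obtain d where d: "d \<in> {\<one>, m}" "inv x \<otimes> c \<otimes> x = c \<otimes> d" using cc[OF x] by blast
    have dG: "d \<in> carrier G" using d m(1) by auto
    have "c \<otimes> x = x \<otimes> (inv x \<otimes> c \<otimes> x)" using x c(1) by (simp add: m_assoc cancel_inv_left)
    also have "\<dots> = (x \<otimes> c) \<otimes> d" unfolding d(2) using x c(1) dG by (simp add: m_assoc)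
    finally show ?thesis using d(1) m(5)[of "x \<otimes> c"] x c(1) by auto
  qed
  have c2: "c \<otimes> c = m" using c noE[OF c(1) _ cx] by blast
  have "\<exists>s\<in>carrier G. c \<otimes> s \<noteq> s \<otimes> c"
  proof (rule ccontr)
    assume "\<not> ?thesis"
    then have cen: "\<And>x. x \<in> carrier G \<Longrightarrow> c \<otimes> x = x \<otimes> c" by blast
    obtain \<iota> :: 'k where i: "\<iota> * \<iota> = - 1" by (rule ex_sqrt_minus_one)
    \<comment> \<open>If \<open>c\<close> is central, its eigenspace for a square root of - 1 is
      stable under \<open>G\<close>, yet its only vector that \<open>c\<close> scales by the
      opposite value is 0. Balance makes the eigenspace zero.\<close>
    have no: "v = 0" if i: "\<iota> * \<iota> = - 1" and v: "v \<in> U" "act v c = \<iota> *\<^sub>k v" for v and \<iota> :: 'k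
    proof -
      let ?Y = "{v \<in> U. act v c = \<iota> *\<^sub>k v}"
      have "subspace ?Y"
        by (rule subspaceI) (auto simp: sub0 sub_add sub_scale act_zero act_add act_scale c(1) scale_right_distrib scale_left_commute)
      moreover have "\<forall>y\<in>?Y. \<forall>x\<in>carrier G. act y x \<in> ?Y"
      proof (intro ballI)
        fix y x assume y: "y \<in> ?Y" and x: "x \<in> carrier G"
        have "act (act y x) c = act (act y c) x"
          using cen[OF x] y x c(1) act_mult[of y x c] act_mult[of y c x] by simp
        then show "act y x \<in> ?Y" using y x by (auto simp: act_closed act_scale)
      qed
      moreover have "\<iota> \<noteq> 0" "\<iota> * \<iota> \<noteq> 1" using i two_ne_0 by (auto simp: eq_neg_iff_add_eq_0)
      ultimately have "card {y \<in> ?Y. act y c = \<iota> *\<^sub>k y} = card {y \<in> ?Y. act y c = (- \<iota>) *\<^sub>k y}"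
        using bal c(1) unfolding balanced_on_def by blast
      moreover have "{y \<in> ?Y. act y c = (- \<iota>) *\<^sub>k y} \<subseteq> {0}"
      proof
        fix y assume "y \<in> {y \<in> ?Y. act y c = (- \<iota>) *\<^sub>k y}"
        then have "\<iota> *\<^sub>k y = - (\<iota> *\<^sub>k y)" by auto
        then have "\<iota> *\<^sub>k y = 0" by (rule eq_minus_imp_0)
        then show "y \<in> {0}" using \<open>\<iota> \<noteq> 0\<close> by simp
      qed
      then have "card {y \<in> ?Y. act y c = (- \<iota>) *\<^sub>k y} \<le> 1"
        using card_mono[of "{0::'v}"] by simp
      ultimately have "card {y \<in> ?Y. act y c = \<iota> *\<^sub>k y} \<le> 1" by simp
      moreover have "finite {y \<in> ?Y. act y c = \<iota> *\<^sub>k y}" using finite_U by simp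
      moreover have "{0, v} \<subseteq> {y \<in> ?Y. act y c = \<iota> *\<^sub>k y}" using v sub0 act_zero c(1) by simp
      ultimately have "card {0, v} \<le> 1" by (meson card_mono le_trans)
      then show "v = 0" by (auto simp: card_insert_if split: if_splits)
    qed
    \<comment> \<open>\<open>y\<close> is scaled by \<open>\<iota>\<close> and therefore vanishes.
      Then \<open>u0\<close> is scaled by the opposite square root, and vanishes too.\<close>
    define y where "y = act u0 c + \<iota> *\<^sub>k u0"
    have uc: "act u0 c \<in> U" using u0 c(1) act_closed by simp
    have u0cc: "act (act u0 c) c = - u0" using act_mult[OF u0(1) c(1) c(1)] c2 m(2)[OF u0(1)] by simp
    have "act y c = \<iota> *\<^sub>k y"
      unfolding y_def using u0 uc c(1) u0cc i by (simp add: act_add act_scale sub_scale scale_right_distrib)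
    moreover have "y \<in> U" unfolding y_def using uc u0 by (simp add: sub_add sub_scale)
    ultimately have "y = 0" using no[OF i] by blast
    then have "act u0 c = (- \<iota>) *\<^sub>k u0" unfolding y_def by (simp add: eq_neg_iff_add_eq_0)
    then have "u0 = 0" using no[of "- \<iota>" u0] i u0(1) by simp
    with u0(2) show False ..
  qed
  then obtain s where s: "s \<in> carrier G" "c \<otimes> s = m \<otimes> (s \<otimes> c)" using cx by blast
  obtain a where a: "a \<in> carrier G" "\<And>x. x \<in> carrier G \<Longrightarrow> c \<otimes> x = x \<otimes> c \<Longrightarrow> \<exists>i::int. x = a [^] i"
    "\<And>i::int. a [^] i \<otimes> a [^] i = \<one> \<Longrightarrow> a [^] i = \<one> \<or> a [^] i = m"
    using centralizer_of_quarter_cyclic[OF k m(1,3,4,5) noE c(1) c2 cx] by blast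
  show thesis
  proof (rule that[OF m0 c(1) c2 cx s])
    show "x \<otimes> y = y \<otimes> x" if xy: "x \<in> carrier G" "y \<in> carrier G" "c \<otimes> x = x \<otimes> c" "c \<otimes> y = y \<otimes> c" for x y
    proof -
      obtain i j :: int where "x = a [^] i" "y = a [^] j" using a(2) xy by metis
      then show ?thesis using a(1) by (metis add.commute int_pow_mult)
    qed
    show "x = \<one> \<or> x = m" if "x \<in> carrier G" "c \<otimes> x = x \<otimes> c" "x \<otimes> x = \<one>" for x
      using a(2)[OF that(1,2)] a(3) that(3) by metis
  qed
qed

end

section \<open>The primitive case\<close>

text \<open>For even \<open>f\<close> the right side is 1 modulo 3, so that 3 would divide a power
  of 2. For odd \<open>f\<close> it is 5 modulo 8, which leaves only the exponent 2.\<close>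

lemma two_power_Suc_eq_five_power:
  assumes "2 ^ n + 1 = (5::nat) ^ f"
  shows "(2::nat) ^ n = 4"
proof (cases "even f")
  case True
  then obtain h where h: "f = 2 * h" by blast
  have "(5::nat) ^ f mod 3 = 25 ^ h mod 3" unfolding h by (simp add: power_mult)
  also have "\<dots> = (25 mod 3) ^ h mod 3" by (simp only: power_mod)
  finally have "(2 ^ n + 1) mod 3 = (1::nat)" using assms by simp
  then have "(3::nat) dvd 2 ^ n" by presburger
  moreover have "Factorial_Ring.prime (3::nat)" by simp
  ultimately have "(3::nat) dvd 2" using prime_dvd_power by blast
  then show ?thesis by simp
next
  case False
  then obtain h where h: "f = 2 * h + 1" using oddE by blast
  have "(5::nat) ^ f mod 8 = (5 * (25 ^ h mod 8)) mod 8" unfolding h by (simp add: power_mult mod_mult_right_eq)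
  also have "(25::nat) ^ h mod 8 = (25 mod 8) ^ h mod 8" by (simp only: power_mod)
  finally have m: "(2 ^ n + 1) mod 8 = (5::nat)" using assms by simp
  show ?thesis
  proof (cases "n \<ge> 3")
    case True
    then have "(2::nat) ^ n = 8 * 2 ^ (n - 3)" using power_add[of "2::nat" 3 "n - 3"] by simp
    then show ?thesis using m by simp
  next
    case False
    then have "n = 0 \<or> n = 1 \<or> n = 2" by auto
    then show ?thesis using m by auto
  qed
qed

section \<open>Counting the vectors of a span over a finite field\<close>

lemma (in vector_space) card_span_independent:
  assumes "finite B" "independent B" "finite (UNIV :: 'a set)"
  shows "finite (span B) \<and> card (span B) = CARD('a) ^ card B"
  using assms(1,2)
proof induction
  case empty
  show ?case by simp
next
  case (insert b B)
  have notin: "b \<notin> span B" and ind: "independent B" using insert.prems insert.hyps(2) by (auto simp: independent_insert)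
  have f: "card (span B) = CARD('a) ^ card B" "finite (span B)" using insert.IH[OF ind] by auto
  have "bij_betw (\<lambda>(c, v). scale c b + v) (UNIV \<times> span B) (span (insert b B))"
  proof (rule bij_betwI')
    fix x y :: "'a \<times> 'b" assume xy: "x \<in> UNIV \<times> span B" "y \<in> UNIV \<times> span B"
    obtain c v d w where cv: "x = (c, v)" "y = (d, w)" by (cases x; cases y)
    have "c = d \<and> v = w" if e: "scale c b + v = scale d b + w"
    proof -
      have "scale (c - d) b = w - v" using e by (simp add: scale_left_diff_distrib algebra_simps)
      moreover have "w - v \<in> span B" using xy cv by (auto intro: span_diff)
      ultimately have *: "scale (c - d) b \<in> span B" by simp
      have "c = d"
      proof (rule ccontr)
        assume "c \<noteq> d"
        then have "b = scale (inverse (c - d)) (scale (c - d) b)" by simp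
        then show False using notin span_scale[OF *, of "inverse (c - d)"] by simp
      qed
      then show ?thesis using e by simp
    qed
    then show "((case x of (c, v) \<Rightarrow> scale c b + v) = (case y of (c, v) \<Rightarrow> scale c b + v)) = (x = y)"
      using cv by auto
  next
    fix x assume "x \<in> (UNIV :: 'a set) \<times> span B"
    then obtain c v where "x = (c, v)" "v \<in> span B" by blast
    moreover from this have "scale c b + v - scale c b \<in> span B" by simp
    ultimately show "(case x of (c, v) \<Rightarrow> scale c b + v) \<in> span (insert b B)"
      by (auto simp: span_insert intro: exI[of _ c])
  next
    fix y assume "y \<in> span (insert b B)"
    then obtain k where "y - scale k b \<in> span B" by (auto simp: span_insert)
    then show "\<exists>x\<in>UNIV \<times> span B. y = (case x of (c, v) \<Rightarrow> scale c b + v)"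
      by (intro bexI[of _ "(k, y - scale k b)"]) auto
  qed
  then have "card ((UNIV :: 'a set) \<times> span B) = card (span (insert b B))" "finite ((UNIV :: 'a set) \<times> span B) \<longleftrightarrow> finite (span (insert b B))"
    by (auto dest: bij_betw_same_card bij_betw_finite)
  then show ?case using f assms(3) insert.hyps by (simp add: card_cartesian_product)
qed

lemma (in vector_space) card_subspace:
  assumes "finite S" "subspace S" "finite (UNIV :: 'a set)"
  shows "card S = CARD('a) ^ dim S"
proof -
  obtain B where B: "B \<subseteq> S" "independent B" "S \<subseteq> span B" "card B = dim S" by (rule basis_exists)
  then have "span B = S" using assms(2) by (metis span_minimal subset_antisym)
  then show ?thesis using card_span_independent[OF finite_subset[OF B(1) assms(1)] B(2) assms(3)] B(4) by simp
qed

lemma (in vector_space) finite_span: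
  assumes "finite B" "finite (UNIV :: 'a set)"
  shows "finite (span B)"
proof -
  obtain C where C: "C \<subseteq> B" "independent C" "B \<subseteq> span C" by (rule maximal_independent_subset)
  then have "span B \<subseteq> span C" by (simp add: span_minimal)
  then show ?thesis
    using card_span_independent[OF finite_subset[OF C(1) assms(1)] C(2) assms(2)] finite_subset by blast
qed

section \<open>The eigenspaces of \<open>c\<close> and the quaternion action\<close>

context primitive_two_group
begin

lemma minus_scale_eq_imp_0: "l \<noteq> 0 \<Longrightarrow> l *\<^sub>k u = (- l) *\<^sub>k u \<Longrightarrow> u = 0"
  using eq_minus_imp_0[of "l *\<^sub>k u"] by simp

lemma primitive_structure:
  obtains u w where "u \<in> U" "w \<in> U" "p = 5" "U \<subseteq> {a *\<^sub>k u + b *\<^sub>k w | a b. True}" "25 \<le> card U"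
    "\<And>x. x \<in> carrier G \<Longrightarrow> \<exists>q\<in>carrier Q8. (act u x, act w x) = quat_pair smul q (u, w)"
proof (rule ex_quarter)
  fix m c s assume m0: "m \<in> carrier G" "\<And>u. u \<in> U \<Longrightarrow> act u m = - u"
    and c: "c \<in> carrier G" "c \<otimes> c = m" "\<And>x. x \<in> carrier G \<Longrightarrow> c \<otimes> x = x \<otimes> c \<or> c \<otimes> x = m \<otimes> (x \<otimes> c)"
    and s: "s \<in> carrier G" "c \<otimes> s = m \<otimes> (s \<otimes> c)"
    and Dcomm: "\<And>x y. x \<in> carrier G \<Longrightarrow> y \<in> carrier G \<Longrightarrow> c \<otimes> x = x \<otimes> c \<Longrightarrow> c \<otimes> y = y \<otimes> c \<Longrightarrow> x \<otimes> y = y \<otimes> x"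
    and Dinv: "\<And>x. x \<in> carrier G \<Longrightarrow> c \<otimes> x = x \<otimes> c \<Longrightarrow> x \<otimes> x = \<one> \<Longrightarrow> x = \<one> \<or> x = m"
  have mU: "\<forall>u\<in>U. act u m = - u" using m0(2) by blast
  note m = m0 minus_one[OF m0(1) mU]
  obtain k where k: "order G = 2 ^ k" using two_power_order by blast
  define D where "D = {x \<in> carrier G. c \<otimes> x = x \<otimes> c}"
  have D_iff: "x \<in> D \<longleftrightarrow> x \<in> carrier G \<and> c \<otimes> x = x \<otimes> c" for x by (simp add: D_def)
  have DG: "x \<in> carrier G" if "x \<in> D" for x using that by (simp add: D_iff)
  have Dsub: "subgroup D G" unfolding D_def by (rule centralizer_subgroup[OF c(1)])
  interpret D: subgroup D G by (rule Dsub)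
  have cD: "c \<in> D" and mD: "m \<in> D" using c(1) m(1) m(5)[OF c(1)] by (auto simp: D_iff)
  \<comment> \<open>The repeated squares of a non-trivial \<open>x\<close> in \<open>D\<close> end
    in an involution of \<open>D\<close>. This is \<open>m\<close>, which fixes no non-zero
    vector.\<close>
  have free: "x = \<one>" if x: "x \<in> D" and u: "u \<in> U" "u \<noteq> 0" "act u x = u" for x u
  proof (rule ccontr)
    assume "x \<noteq> \<one>"
    have xG: "x \<in> carrier G" using x by (rule DG)
    define N where "N = (LEAST n. x [^] ((2::nat) ^ n) = \<one>)"
    have "x [^] ((2::nat) ^ k) = \<one>" using pow_order_eq_1[OF xG] k by simp
    then have N: "x [^] ((2::nat) ^ N) = \<one>" unfolding N_def by (rule LeastI)
    have "N \<noteq> 0" using N \<open>x \<noteq> \<one>\<close> xG by (metis nat_pow_eone power_0)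
    then obtain l where l: "N = Suc l" using not0_implies_Suc by blast
    let ?t = "x [^] ((2::nat) ^ l)"
    have t1: "?t \<noteq> \<one>" using not_less_Least[of l "\<lambda>n. x [^] ((2::nat) ^ n) = \<one>"] l N_def by simp
    have "x [^] n \<in> D" for n :: nat by (induction n) (use x in auto)
    then have tD: "?t \<in> D" .
    have "?t \<otimes> ?t = \<one>" using pow_two_power[OF xG, of l] N l by simp
    then have "?t = m" using Dinv tD t1 by (auto simp: D_iff)
    moreover have "act u ?t = 1 ^ (2 ^ l) *\<^sub>k u" using u xG by (intro act_pow) auto
    ultimately have "u = - u" using m(2)[OF u(1)] by simp
    then have "u = 0" by (rule eq_minus_imp_0)
    with u(2) show False ..
  qed
  have free2: "x = y" if "x \<in> D" "y \<in> D" "u \<in> U" "u \<noteq> 0" "act u x = act u y" for x y u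
  proof -
    have "act u (x \<otimes> inv y) = u"
      using that act_mult[OF that(3) DG DG, of x "inv y"] act_inv_right[OF that(3) DG, of y] by simp
    then have "x \<otimes> inv y = \<one>" using free[of "x \<otimes> inv y" u] that by simp
    then show ?thesis using that DG by (metis inv_closed inv_equality inv_inv)
  qed
  obtain u0 where u0: "u0 \<in> U" "u0 \<noteq> 0" using U_nonzero by blast
  define E where "E \<iota> = {u \<in> U. act u c = \<iota> *\<^sub>k u}" for \<iota>
  have E_sub: "subspace (E \<iota>)" for \<iota>
    unfolding E_def by (rule subspaceI) (auto simp: sub0 sub_add sub_scale act_zero act_add act_scale c(1) scale_right_distrib scale_left_commute)
  have EU: "u \<in> U" if "u \<in> E \<iota>" for u \<iota> using that by (simp add: E_def)
  have keep: "act u x \<in> E \<iota>" if "u \<in> E \<iota>" "x \<in> D" for u x \<iota>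
  proof -
    have u: "u \<in> U" "act u c = \<iota> *\<^sub>k u" using that by (auto simp: E_def)
    have x: "x \<in> carrier G" "c \<otimes> x = x \<otimes> c" using that by (auto simp: D_iff)
    have "act (act u x) c = act (act u c) x"
      using act_mult[OF u(1) x(1) c(1)] act_mult[OF u(1) c(1) x(1)] x(2) by simp
    also have "\<dots> = \<iota> *\<^sub>k act u x" using u x(1) act_scale by simp
    finally show ?thesis using u(1) x(1) act_closed by (simp add: E_def)
  qed
  \<comment> \<open>An element outside \<open>D\<close> conjugates \<open>c\<close> to
    \<open>m \<otimes> c\<close>, which acts as the negative of \<open>c\<close>.\<close>
  have swap: "act u x \<in> E (- \<iota>)" if "u \<in> E \<iota>" "x \<in> carrier G" "x \<notin> D" for u x \<iota>
  proof -
    have u: "u \<in> U" "act u c = \<iota> *\<^sub>k u" using that by (auto simp: E_def)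
    have x: "x \<in> carrier G" "c \<otimes> x = m \<otimes> (x \<otimes> c)" using that c(3) by (auto simp: D_iff)
    have "act (act u c) x = act (act (act u m) x) c"
      using act_mult[OF u(1) c(1) x(1)] act_mult[OF u(1) m(1), of "x \<otimes> c"] act_mult[OF act_closed[OF u(1) m(1)] x(1) c(1)] x c(1) by simp
    also have "\<dots> = - act (act u x) c" using m(2)[OF u(1)] act_minus act_closed u(1) x(1) c(1) by simp
    finally have "act (act u x) c = - (\<iota> *\<^sub>k act u x)" using u x(1) act_scale by (simp add: minus_equation_iff)
    then show ?thesis using u(1) x(1) act_closed by (simp add: E_def)
  qed
  have E_int: "u = 0" if "\<iota> \<noteq> 0" "u \<in> E \<iota>" "u \<in> E (- \<iota>)" for u \<iota>
    using minus_scale_eq_imp_0[OF that(1), of u] that(2,3) by (simp add: E_def)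
  have inD: "x \<in> D" if "\<iota> \<noteq> 0" "u \<in> E \<iota>" "u \<noteq> 0" "x \<in> carrier G" "act u x \<in> E \<iota>" for u x \<iota>
    using E_int[OF that(1) that(5)] swap[OF that(2,4)] act_eq_0_iff[OF EU[OF that(2)] that(4)] that(3) by blast
  have decomp: "\<exists>v\<in>E \<iota>. \<exists>w\<in>E (- \<iota>). u = v + w" if i: "\<iota> * \<iota> = - 1" and u: "u \<in> U" for u and \<iota> :: 'k
  proof -
    have uc: "act u c \<in> U" using u c(1) act_closed by simp
    have ucc: "act (act u c) c = - u" using act_mult[OF u c(1) c(1)] c(2) m(2)[OF u] by simp
    let ?v = "inverse 2 *\<^sub>k (u - \<iota> *\<^sub>k act u c)" and ?w = "inverse 2 *\<^sub>k (u + \<iota> *\<^sub>k act u c)"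
    have "?v + ?w = inverse 2 *\<^sub>k (u + u)" unfolding scale_right_distrib[symmetric] by simp
    also have "u + u = 2 *\<^sub>k u" using scale_left_distrib[of 1 1 u] by simp
    finally have "u = ?v + ?w" using two_ne_0 by simp
    moreover have "?v \<in> E \<iota>"
      using u uc c(1) ucc i by (simp add: E_def act_diff act_scale sub_scale sub_diff scale_left_commute[of \<iota>] scale_right_diff_distrib)
    moreover have "?w \<in> E (- \<iota>)"
      using u uc c(1) ucc i by (simp add: E_def act_add act_scale sub_scale sub_add scale_left_commute[of \<iota>] scale_right_distrib)
    ultimately show ?thesis by blast
  qed
  have sD: "s \<notin> D"
  proof
    assume "s \<in> D"
    then have "m \<otimes> (s \<otimes> c) = \<one> \<otimes> (s \<otimes> c)" using s c(1) by (simp add: D_iff)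
    then have "m = \<one>" using m(1) s(1) c(1) by (metis m_closed one_closed r_cancel)
    with m(3) show False ..
  qed
  have E_nz: "\<exists>u\<in>E \<iota>. u \<noteq> 0" if i: "\<iota> * \<iota> = - 1" for \<iota> :: 'k
  proof -
    obtain v w where vw: "v \<in> E \<iota>" "w \<in> E (- \<iota>)" "u0 = v + w" using decomp[OF i u0(1)] by blast
    then have "v \<noteq> 0 \<or> w \<noteq> 0" using u0(2) by auto
    then show ?thesis
    proof
      assume "w \<noteq> 0"
      then have "act w s \<noteq> 0" using act_eq_0_iff[OF EU[OF vw(2)] s(1)] by simp
      moreover have "act w s \<in> E \<iota>" using swap[OF vw(2) s(1) sD] by simp
      ultimately show ?thesis by blast
    qed (use vw in blast)
  qed
  \<comment> \<open>Two interchanges bring \<open>E \<iota>\<close> back to itself, and an element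
    that keeps even one non-zero vector inside \<open>E \<iota>\<close> lies in
    \<open>D\<close>.\<close>
  have idx: "x \<otimes> y \<in> D" if "x \<in> carrier G" "y \<in> carrier G" "x \<notin> D" "y \<notin> D" for x y
  proof -
    obtain \<iota> :: 'k where i: "\<iota> * \<iota> = - 1" by (rule ex_sqrt_minus_one)
    then have i0: "\<iota> \<noteq> 0" by auto
    obtain u where u: "u \<in> E \<iota>" "u \<noteq> 0" using E_nz[OF i] by blast
    have "act (act u x) y \<in> E \<iota>" using swap[OF swap[OF u(1) that(1,3)] that(2,4)] by simp
    then show ?thesis using inD[OF i0 u, of "x \<otimes> y"] act_mult[OF EU[OF u(1)] that(1,2)] that by simp
  qed
  have inv_notin: "inv x \<notin> D" if "x \<in> carrier G" "x \<notin> D" for x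
    using that D.m_inv_closed[of "inv x"] by auto
  \<comment> \<open>Otherwise \<open>2 ^ q\<close> is a square root \<open>\<eta>\<close> of \<open>-1\<close> for some even \<open>q\<close>. If \<open>b\<close> doubles a vector of \<open>E \<eta>\<close> then \<open>b ^ q = c\<close>, so
    eigenvectors of \<open>b\<close> for the eigenvalue \<open>-2\<close> also lie in \<open>E \<eta>\<close>. But \<open>b\<close> doubles all of \<open>Y' \<inter> E \<eta>\<close>.\<close>
  have p5: "p = 5"
  proof (rule ccontr)
    assume "p \<noteq> 5"
    \<comment> \<open>The difference is 15, which vanishes for no prime above 5. So the repeated
      squares of 2 reach - 1 at index 2 or later; this makes \<open>?q\<close> even, so that 2 and -
      2 have the same power with exponent \<open>?q\<close>.\<close>
    have "(2::'k) ^ (2 ^ 2) \<noteq> 1"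
    proof
      assume "(2::'k) ^ (2 ^ 2) = 1"
      moreover have "(of_nat 15 :: 'k) = 2 ^ (2 ^ 2) - 1" by simp
      ultimately have "(of_nat 15 :: 'k) = 0" by simp
      then have "p dvd 3 * 5" using of_nat_eq_0_iff_dvd_card[OF prime_p(1,3), of 15] by simp
      then have "p dvd 3 \<or> p dvd 5" using prime_p(1) prime_dvd_mult_iff by blast
      then have "p \<le> 5" by (auto dest: dvd_imp_le)
      with \<open>p \<noteq> 5\<close> prime_p(2) show False by simp
    qed
    moreover obtain n where "(2::'k) ^ (2 ^ n) = 1" using scalar_two_power[OF eig u0 two_ne_0] by blast
    ultimately obtain j0 where j0: "j0 \<ge> 2" "(2::'k) ^ (2 ^ j0) = - 1"
      using power_two_power_eq_minus_one by blast
    then obtain j where j: "j0 = Suc (Suc j)" by (metis Suc_le_D numeral_2_eq_2 Suc_le_mono)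
    let ?l = "2::'k" and ?q = "(2::nat) ^ Suc j"
    obtain \<eta> where \<eta>: "\<eta> = ?l ^ ?q" by blast
    have "2 ^ j0 = ?q + ?q" unfolding j by simp
    then have \<eta>2: "\<eta> * \<eta> = - 1" using j0(2) \<eta> by (metis power_add)
    then have \<eta>0: "\<eta> \<noteq> 0" by auto
    have \<eta>': "(- ?l) ^ ?q = \<eta>" unfolding \<eta> by simp
    obtain u where u: "u \<in> E \<eta>" "u \<noteq> 0" using E_nz[OF \<eta>2] by blast
    obtain b where b: "b \<in> carrier G" "act u b = ?l *\<^sub>k u"
      using eig EU[OF u(1)] two_ne_0 by (auto simp: eigenvectors_on_def)
    have bD: "b \<in> D" using inD[OF \<eta>0 u b(1)] b(2) subspace_scale[OF E_sub u(1)] by simp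
    have bq: "b [^] n \<in> D" for n :: nat by (induction n) (use bD in auto)
    have "act u (b [^] ?q) = \<eta> *\<^sub>k u" using act_pow[OF EU[OF u(1)] b] \<eta> by simp
    then have "act u (b [^] ?q) = act u c" using u by (simp add: E_def)
    then have bqc: "b [^] ?q = c" using free2[OF bq cD EU[OF u(1)] u(2)] by simp
    define Y where "Y = {v \<in> E \<eta>. act v b = ?l *\<^sub>k v}"
    have Ysub: "subspace Y"
      unfolding Y_def using E_sub[of \<eta>] b(1)
      by (intro subspaceI) (auto simp: subspace_0 subspace_add subspace_scale act_zero act_add[OF EU EU] act_scale[OF EU] scale_right_distrib scale_left_commute)
    have YD: "act v x \<in> Y" if "v \<in> Y" "x \<in> D" for v x
    proof -
      have v: "v \<in> E \<eta>" "act v b = ?l *\<^sub>k v" using that by (auto simp: Y_def)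
      have "act (act v x) b = act (act v b) x"
        using act_mult[OF EU[OF v(1)]] Dcomm that(2) bD DG by (metis D_iff)
      also have "\<dots> = ?l *\<^sub>k act v x" using v act_scale EU DG that(2) by simp
      finally show ?thesis using keep[OF v(1) that(2)] by (simp add: Y_def)
    qed
    have YU: "v \<in> U" if "v \<in> Y" for v using that EU by (auto simp: Y_def)
    define Y' where "Y' = {y + w | y w. y \<in> Y \<and> w \<in> (\<lambda>z. act z s) ` Y}"
    have Y'I: "y + act z s \<in> Y'" if "y \<in> Y" "z \<in> Y" for y z using that by (auto simp: Y'_def)
    have "Y \<subseteq> U" using YU by blast
    from translate_sum[OF Dsub idx s(1) sD Ysub this YD]
    have "subspace Y'" and Y'U: "Y' \<subseteq> U" and "\<forall>y\<in>Y'. \<forall>x\<in>carrier G. act y x \<in> Y'"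
      unfolding Y'_def by simp_all
    moreover have "?l \<noteq> 0" "?l * ?l \<noteq> 1"
    proof -
      show "?l \<noteq> 0" by (rule two_ne_0)
      show "?l * ?l \<noteq> 1"
      proof
        assume "?l * ?l = 1"
        moreover have "(3::'k) = 2 * 2 - 1" by simp
        ultimately have "(3::'k) = 0" by simp
        then show False using three_ne_0 by contradiction
      qed
    qed
    ultimately have card_eq: "card {y \<in> Y'. act y b = ?l *\<^sub>k y} = card {y \<in> Y'. act y b = (- ?l) *\<^sub>k y}"
      using bal b(1) Y'U unfolding balanced_on_def by blast
    have fin: "finite Y'" using Y'U finite_U finite_subset by blast
    have Y0: "0 \<in> Y'" using Y'I[of 0 0] subspace_0[OF Ysub] act_zero[OF s(1)] by simp
    have uY: "u \<in> Y" using u b by (simp add: Y_def)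
    then have "u \<in> Y'" using Y'I[of u 0] subspace_0[OF Ysub] act_zero[OF s(1)] by simp
    then have "card {0, u} \<le> card {y \<in> Y'. act y b = ?l *\<^sub>k y}"
      using fin Y0 b act_zero[OF b(1)] by (intro card_mono) auto
    then have "2 \<le> card {y \<in> Y'. act y b = (- ?l) *\<^sub>k y}" using u(2) card_eq by simp
    then have "\<not> {y \<in> Y'. act y b = (- ?l) *\<^sub>k y} \<subseteq> {0}"
      using card_mono[of "{0::'v}" "{y \<in> Y'. act y b = (- ?l) *\<^sub>k y}"] by auto
    then obtain v where v: "v \<in> Y'" "act v b = (- ?l) *\<^sub>k v" "v \<noteq> 0" by blast
    then obtain y z where yz: "v = y + act z s" "y \<in> Y" "z \<in> Y" by (auto simp: Y'_def)
    have zE: "act z s \<in> E (- \<eta>)" using swap[OF _ s(1) sD] yz(3) by (auto simp: Y_def)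
    have yE: "y \<in> E \<eta>" "act y b = ?l *\<^sub>k y" using yz by (auto simp: Y_def)
    have e1: "act v b = ?l *\<^sub>k y + act (act z s) b"
      using yz act_add[OF EU[OF yE(1)] EU[OF zE] b(1)] yE(2) by simp
    have "?l *\<^sub>k y + act (act z s) b = - (?l *\<^sub>k y) - ?l *\<^sub>k act z s"
      using e1 v(2) yz(1) by (simp add: scale_right_distrib)
    then have "(?l *\<^sub>k y + act (act z s) b) - act (act z s) b + ?l *\<^sub>k y
        = (- (?l *\<^sub>k y) - ?l *\<^sub>k act z s) - act (act z s) b + ?l *\<^sub>k y" by (rule arg_cong)
    then have e2: "?l *\<^sub>k y + ?l *\<^sub>k y = - act (act z s) b - ?l *\<^sub>k act z s" by simp
    have q: "- act (act z s) b - ?l *\<^sub>k act z s \<in> E (- \<eta>)"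
      using keep[OF zE bD] zE E_sub[of "- \<eta>"] by (simp add: subspace_diff subspace_neg subspace_scale)
    have q2: "?l *\<^sub>k y + ?l *\<^sub>k y \<in> E \<eta>"
      using yE E_sub[of \<eta>] by (simp add: subspace_add subspace_scale)
    have "?l *\<^sub>k y + ?l *\<^sub>k y = 0" using E_int[OF \<eta>0 q2] q unfolding e2 .
    then have "?l *\<^sub>k y = - (?l *\<^sub>k y)" by (simp only: eq_neg_iff_add_eq_0)
    then have "?l *\<^sub>k y = 0" by (rule eq_minus_imp_0)
    then have "y = 0" using two_ne_0 by simp
    then have vE: "v \<in> E (- \<eta>)" using yz zE by simp
    have "act v c = \<eta> *\<^sub>k v" using act_pow[OF EU[OF vE] b(1) v(2), of ?q] \<eta>' bqc by simp
    moreover have "act v c = (- \<eta>) *\<^sub>k v" using vE by (simp add: E_def)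
    ultimately have "v = 0" using minus_scale_eq_imp_0[OF \<eta>0] by simp
    with v(3) show False ..
  qed
  have five: "(5::'k) = 0" using of_nat_eq_0_iff_dvd_card[OF prime_p(1,3), of 5] p5 by simp
  have tt: "(2::'k) * 2 = - 1"
  proof -
    have "(2::'k) * 2 + 1 = 5" by simp
    then have "(2::'k) * 2 + 1 = 0" using five by simp
    then show ?thesis by (simp only: eq_neg_iff_add_eq_0)
  qed
  let ?P = "E 2" and ?M = "E (- 2)"
  \<comment> \<open>An element of \<open>D\<close> scaling \<open>v + w\<close> by 2 would agree
    with \<open>c\<close> on \<open>v\<close> and equal \<open>c\<close> by freeness, but
    \<open>c\<close> scales \<open>w\<close> by - 2. Outside \<open>D\<close> the element
    interchanges the eigenspaces, and comparing components gives both equations.\<close>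
  have eigsum: "\<exists>g\<in>carrier G. g \<notin> D \<and> act v g = 2 *\<^sub>k w \<and> act w g = 2 *\<^sub>k v"
    if v: "v \<in> ?P" "v \<noteq> 0" and w: "w \<in> ?M" "w \<noteq> 0" for v w
  proof -
    obtain g where g: "g \<in> carrier G" "act (v + w) g = 2 *\<^sub>k (v + w)"
      using eig sub_add[OF EU[OF v(1)] EU[OF w(1)]] two_ne_0 by (auto simp: eigenvectors_on_def)
    have e: "act v g + act w g = 2 *\<^sub>k v + 2 *\<^sub>k w"
      using g act_add[OF EU[OF v(1)] EU[OF w(1)]] by (simp add: scale_right_distrib)
    have gD: "g \<notin> D"
    proof
      assume gD: "g \<in> D"
      have ab: "act v g - 2 *\<^sub>k v = 2 *\<^sub>k w - act w g" using e by (simp add: algebra_simps)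
      have P: "act v g - 2 *\<^sub>k v \<in> ?P" using keep[OF v(1) gD] v(1) E_sub by (simp add: subspace_diff subspace_scale)
      have M: "2 *\<^sub>k w - act w g \<in> ?M" using keep[OF w(1) gD] w(1) E_sub by (simp add: subspace_diff subspace_scale)
      have z1: "act v g - 2 *\<^sub>k v = 0" by (rule E_int[OF two_ne_0 P]) (unfold ab, rule M)
      then have z2: "2 *\<^sub>k w - act w g = 0" unfolding ab .
      have "act v g = act v c" using v(1) z1 by (simp add: E_def)
      then have "g = c" by (rule free2[OF gD cD EU[OF v(1)] v(2)])
      then have "2 *\<^sub>k w = (- 2) *\<^sub>k w" using z2 w(1) by (simp add: E_def)
      then have "w = 0" by (rule minus_scale_eq_imp_0[OF two_ne_0])
      with w(2) show False ..
    qed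
    have ab: "act v g - 2 *\<^sub>k w = 2 *\<^sub>k v - act w g" using e by (simp add: algebra_simps)
    have M: "act v g - 2 *\<^sub>k w \<in> ?M" using swap[OF v(1) g(1) gD] w(1) E_sub by (simp add: subspace_diff subspace_scale)
    have P: "2 *\<^sub>k v - act w g \<in> ?P" using swap[OF w(1) g(1) gD] v(1) E_sub[of 2] by (simp add: subspace_diff subspace_scale)
    have z2: "2 *\<^sub>k v - act w g = 0" by (rule E_int[OF two_ne_0 P]) (unfold ab[symmetric], rule M)
    then have z1: "act v g - 2 *\<^sub>k w = 0" unfolding ab .
    show ?thesis using g(1) gD z1 z2 by auto
  qed
  obtain u where u: "u \<in> ?P" "u \<noteq> 0" using E_nz[OF tt] by blast
  obtain u2 where u2: "u2 \<in> ?M" "u2 \<noteq> 0" using E_nz[of "- 2"] tt by auto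
  have uU: "u \<in> U" using EU[OF u(1)] .
  have finP: "finite ?P" using finite_U by (simp add: E_def)
  \<comment> \<open>For surjectivity, \<open>eigsum\<close> sends both \<open>u\<close> and
    \<open>v\<close> to the same multiple of \<open>u2\<close>. The quotient of the two elements
    carries \<open>u\<close> to \<open>v\<close>, and keeps \<open>E 2\<close>, so it lies in
    \<open>D\<close>.\<close>
  have bij: "bij_betw (\<lambda>d. act u d) D (?P - {0})"
  proof (rule bij_betwI')
    show "(act u x = act u y) = (x = y)" if "x \<in> D" "y \<in> D" for x y using free2[OF that uU u(2)] by blast
    show "act u x \<in> ?P - {0}" if "x \<in> D" for x using keep[OF u(1) that] act_eq_0_iff[OF uU DG[OF that]] u(2) by simp
    show "\<exists>x\<in>D. v = act u x" if v: "v \<in> ?P - {0}" for v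
    proof -
      obtain g where g: "g \<in> carrier G" "act u g = 2 *\<^sub>k u2" using eigsum[OF u u2] by blast
      obtain h where h: "h \<in> carrier G" "act v h = 2 *\<^sub>k u2" using eigsum[OF _ _ u2] v by blast
      have "act (2 *\<^sub>k u2) (inv h) = v" using act_inv_right[OF EU h(1), of v 2] h(2) v by simp
      then have "act u (g \<otimes> inv h) = v" using act_mult[OF uU g(1), of "inv h"] g h(1) by simp
      then show ?thesis using inD[OF two_ne_0 u, of "g \<otimes> inv h"] g(1) h(1) v by auto
    qed
  qed
  have "card D dvd 2 ^ k" using lagrange[OF Dsub] k by (metis dvd_triv_right)
  then obtain n where n: "card D = 2 ^ n" using divides_primepow_nat[OF two_is_prime_nat] by blast
  have "0 \<in> ?P" using E_sub subspace_0 by blast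
  then have "card ?P > 0" using finP card_gt_0_iff by blast
  then have DP: "card D + 1 = card ?P"
    using bij_betw_same_card[OF bij] card_Diff_singleton[OF \<open>0 \<in> ?P\<close>] by simp
  moreover have "finite (UNIV :: 'k set)" using prime_p(2,3) card.infinite by force
  then obtain f where "card ?P = CARD('k) ^ f" using card_subspace[OF finP E_sub] by blast
  ultimately have "2 ^ n + 1 = (5::nat) ^ f" using n p5 prime_p(3) by simp
  then have D4: "card D = 4" using two_power_Suc_eq_five_power n by simp
  then have P5: "card ?P = 5" using DP by simp
  have D_eq: "D = {\<one>, c, m, m \<otimes> c}"
  proof -
    have "m \<otimes> c \<in> D" using mD cD by blast
    then have sub: "{\<one>, c, m, m \<otimes> c} \<subseteq> D" using mD cD by auto
    have c1: "c \<noteq> \<one>" "c \<noteq> m" using c(2) m(3,4) by auto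
    have "m \<otimes> c \<noteq> m \<otimes> m" using c1(2) m(1) c(1) by simp
    then have mc: "m \<otimes> c \<noteq> \<one>" using m(4) by simp
    have mc2: "m \<otimes> c \<noteq> c" "m \<otimes> c \<noteq> m" using c1(1) m(1,3) c(1) by simp_all
    then have "card {\<one>, c, m, m \<otimes> c} = 4" using c1 m(3) mc mc2 by (simp add: card_insert_if eq_commute[of _ "m \<otimes> c"])
    then show ?thesis using sub D4 card_subset_eq[of D "{\<one>, c, m, m \<otimes> c}"] D.subset
      by (metis card.infinite zero_neq_numeral)
  qed
  \<comment> \<open>\<open>c\<close> and \<open>g\<close> play the parts of i and j:
    \<open>c\<close> scales \<open>u\<close> and \<open>w\<close> by 2 and - 2, while
    \<open>g\<close> takes \<open>u\<close> to \<open>w\<close> and \<open>w\<close> to - u, because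
    2 * 2 = - 1.\<close>
  obtain g where g: "g \<in> carrier G" "g \<notin> D" "act u g = 2 *\<^sub>k u2" "act u2 g = 2 *\<^sub>k u" using eigsum[OF u u2] by blast
  define w where "w = act u g"
  have wU: "w \<in> U" and wM: "w \<in> ?M" unfolding w_def using act_closed[OF uU g(1)] swap[OF u(1) g(1,2)] by auto
  have w0: "w \<noteq> 0" unfolding w_def using act_eq_0_iff[OF uU g(1)] u(2) by simp
  have wg: "act w g = - u"
  proof -
    have "act w g = (2 * 2) *\<^sub>k u"
      unfolding w_def g(3) using act_scale[OF EU[OF u2(1)] g(1)] g(4) by (simp only: scale_scale)
    then show ?thesis unfolding tt by simp
  qed
  have uc: "act u c = 2 *\<^sub>k u" and wc: "act w c = - (2 *\<^sub>k w)" using u(1) wM by (auto simp: E_def)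
  have lines: "?P \<subseteq> range (\<lambda>a. a *\<^sub>k u)"
  proof -
    have "inj (\<lambda>a. a *\<^sub>k u)" using u(2) by (simp add: inj_on_def)
    then have "card (range (\<lambda>a. a *\<^sub>k u)) = 5" using card_image prime_p(3) p5 by metis
    moreover have "range (\<lambda>a. a *\<^sub>k u) \<subseteq> ?P" using subspace_scale[OF E_sub u(1)] by blast
    ultimately have "range (\<lambda>a. a *\<^sub>k u) = ?P" using card_subset_eq[OF finP, of "range (\<lambda>a. a *\<^sub>k u)"] P5 by simp
    then show ?thesis by blast
  qed
  show thesis
  proof (rule that[OF uU wU p5])
    show "U \<subseteq> {a *\<^sub>k u + b *\<^sub>k w | a b. True}"
    proof
      fix v assume "v \<in> U"
      then obtain v1 v2 where v: "v1 \<in> ?P" "v2 \<in> ?M" "v = v1 + v2" using decomp[OF tt] by blast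
      obtain a where a: "v1 = a *\<^sub>k u" using lines v(1) by blast
      have "inv g \<notin> D" using inv_notin g(1,2) by blast
      then have "act v2 (inv g) \<in> ?P" using swap[OF v(2), of "inv g"] g(1) by simp
      then obtain b where "act v2 (inv g) = b *\<^sub>k u" using lines by blast
      then have "v2 = b *\<^sub>k w" using act_inv_left[OF EU[OF v(2)] g(1)] act_scale[OF uU g(1)] w_def by metis
      then show "v \<in> {a *\<^sub>k u + b *\<^sub>k w | a b. True}" using a v(3) by blast
    qed
    show "25 \<le> card U"
    proof -
      let ?f = "\<lambda>(a, b). a *\<^sub>k u + b *\<^sub>k w"
      have "inj_on ?f UNIV"
      proof (rule inj_onI, clarify)
        fix a b a' b' assume "a *\<^sub>k u + b *\<^sub>k w = a' *\<^sub>k u + b' *\<^sub>k w"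
        then have e: "(a - a') *\<^sub>k u = (b' - b) *\<^sub>k w" by (simp add: scale_left_diff_distrib algebra_simps)
        have P: "(a - a') *\<^sub>k u \<in> ?P" and M: "(b' - b) *\<^sub>k w \<in> ?M" using subspace_scale[OF E_sub u(1)] subspace_scale[OF E_sub wM] by auto
        have z1: "(a - a') *\<^sub>k u = 0" by (rule E_int[OF two_ne_0 P]) (unfold e, rule M)
        then have "(b' - b) *\<^sub>k w = 0" unfolding e .
        with z1 have "(a - a') *\<^sub>k u = 0" "(b' - b) *\<^sub>k w = 0" .
        then show "a = a' \<and> b = b'" using u(2) w0 by simp
      qed
      then have "card (range ?f) = CARD('k \<times> 'k)" by (simp add: card_image)
      also have "\<dots> = 25" using prime_p(3) p5 by simp
      finally have "card (range ?f) = 25" .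
      moreover have "range ?f \<subseteq> U" using sub_add sub_scale uU wU by auto
      ultimately show ?thesis using card_mono[OF finite_U] by metis
    qed
    fix x assume x: "x \<in> carrier G"
    have um: "act u m = - u" and wm: "act w m = - w" using m(2) uU wU by auto
    have umc: "act u (m \<otimes> c) = - (2 *\<^sub>k u)" and wmc: "act w (m \<otimes> c) = 2 *\<^sub>k w"
      using act_mult[OF uU m(1) c(1)] act_mult[OF wU m(1) c(1)] um wm uc wc act_minus[OF uU c(1)] act_minus[OF wU c(1)] by auto
    have dd: "\<exists>q\<in>carrier Q8. (act u d, act w d) = quat_pair smul q (u, w)" if "d \<in> D" for d
    proof -
      have "d = \<one> \<or> d = c \<or> d = m \<or> d = m \<otimes> c" using that D_eq by blast
      then show ?thesis
        by (elim disjE) (simp_all add: Q8_def quat_pair_def act_one[OF uU] act_one[OF wU] uc wc um wm umc wmc)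
    qed
    show "\<exists>q\<in>carrier Q8. (act u x, act w x) = quat_pair smul q (u, w)"
    proof (cases "x \<in> D")
      case False
      \<comment> \<open>Outside \<open>D\<close>, \<open>x\<close> is an element of \<open>D\<close>
        followed by \<open>g\<close>. The four elements of \<open>D\<close> and their products with
        \<open>g\<close> account for the eight quaternions.\<close>
      then have d: "x \<otimes> inv g \<in> D" (is "?d \<in> D") using idx[OF x _ _ inv_notin[OF g(1,2)]] g(1) by simp
      have xg: "act v x = act (act v ?d) g" if "v \<in> U" for v
        using act_mult[OF that, of ?d g] x g(1) by (simp add: m_assoc)
      have "?d = \<one> \<or> ?d = c \<or> ?d = m \<or> ?d = m \<otimes> c" using d D_eq by blast
      then show ?thesis
        by (elim disjE) (simp_all add: Q8_def quat_pair_def xg[OF uU] xg[OF wU] act_one[OF uU] act_one[OF wU] uc wc um wm umc wmc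
          act_scale[OF uU g(1)] act_scale[OF wU g(1)] act_minus[OF sub_scale[OF uU] g(1)] act_minus[OF sub_scale[OF wU] g(1)]
          act_minus[OF uU g(1)] act_minus[OF wU g(1)] wg w_def[symmetric])
    qed (use dd in blast)
  qed
qed

end

lemma (in group_hom) order_dvd_if_surj:
  assumes "h ` carrier G = carrier H"
  shows "order H dvd order G"
proof -
  have "(\<lambda>C. the_elem (h ` C)) \<in> iso (G Mod (kernel G H h)) H"
    using FactGroup_iso_set[OF assms] .
  then have "order H = order (G Mod (kernel G H h))"
    unfolding order_def iso_def using bij_betw_same_card by fastforce
  moreover have "order (G Mod (kernel G H h)) * card (kernel G H h) = order G"
    using G.lagrange[OF subgroup_kernel] by (simp add: order_def FactGroup_def)
  ultimately show ?thesis by (metis dvd_triv_left)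
qed

section \<open>Quaternion frames\<close>

definition frame_points :: "('v \<times> 'v) set \<Rightarrow> 'v set" where
  "frame_points F = fst ` F \<union> snd ` F"

text \<open>With respect to such pairs the matrices of \<open>G\<close> are monomial with
  coefficients in \<open>Q8\<close>.\<close>

definition quat_stable :: "('k::field \<Rightarrow> 'v::ab_group_add \<Rightarrow> 'v) \<Rightarrow> ('g, 'm) monoid_scheme \<Rightarrow> ('v \<Rightarrow> 'g \<Rightarrow> 'v) \<Rightarrow> ('v \<times> 'v) set \<Rightarrow> bool" where
  "quat_stable smul G act F \<longleftrightarrow> (\<forall>f\<in>F. \<forall>g\<in>carrier G. \<exists>q\<in>carrier Q8. \<exists>f'\<in>F.
     (act (fst f) g, act (snd f) g) = quat_pair smul q f')"

text \<open>Linear independence is replaced by a lower bound on the size of \<open>U\<close>.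
  Together with spanning it is equivalent over a field with five elements, and it passes to unions
  and translates of frames by counting alone.\<close>

definition has_quat_frame :: "('k::field \<Rightarrow> 'v::ab_group_add \<Rightarrow> 'v) \<Rightarrow> ('g, 'm) monoid_scheme \<Rightarrow> ('v \<Rightarrow> 'g \<Rightarrow> 'v) \<Rightarrow> 'v set \<Rightarrow> bool" where
  "has_quat_frame smul G act U \<longleftrightarrow> (\<exists>F. finite F \<and> frame_points F \<subseteq> U \<and>
     U \<subseteq> module.span smul (frame_points F) \<and> 25 ^ card F \<le> card U \<and>
     quat_stable smul G act F)"

context linear_two_group
begin

text \<open>The maps that \<open>G\<close> induces on \<open>U\<close> form a group acting
  faithfully on \<open>U\<close>. Composition is taken in the opposite order since the action is on
  the right.\<close>

lemma restricted_images:
  defines "rho \<equiv> \<lambda>g. \<lambda>u\<in>U. act u g"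
  defines "R \<equiv> \<lparr>carrier = rho ` carrier G, mult = (\<lambda>f h. compose U h f), one = rho \<one>\<rparr>"
  shows "linear_two_group R smul (\<lambda>u f. f u) U"
proof -
  have rho: "rho g u = act u g" if "u \<in> U" for g u using that by (simp add: rho_def)
  have mult: "rho (g \<otimes> h) = compose U (rho h) (rho g)" if "g \<in> carrier G" "h \<in> carrier G" for g h
    using that act_mult act_closed by (auto simp: rho_def compose_def fun_eq_iff)
  have car: "carrier R = rho ` carrier G" and mR: "f \<otimes>\<^bsub>R\<^esub> h = compose U h f" for f h
    by (simp_all add: R_def)
  have oneR: "\<one>\<^bsub>R\<^esub> u = u" if "u \<in> U" for u using that by (simp add: R_def rho act_one)
  have "rho \<in> hom G R"
    using mult by (auto simp: hom_def R_def)
  have "group R"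
  proof (rule groupI)
    show "x \<otimes>\<^bsub>R\<^esub> y \<in> carrier R" if "x \<in> carrier R" "y \<in> carrier R" for x y
      using that mult by (auto simp: R_def) (metis imageI m_closed)
    show "\<one>\<^bsub>R\<^esub> \<in> carrier R" by (simp add: R_def)
    show "x \<otimes>\<^bsub>R\<^esub> y \<otimes>\<^bsub>R\<^esub> z = x \<otimes>\<^bsub>R\<^esub> (y \<otimes>\<^bsub>R\<^esub> z)"
      if xyz: "x \<in> carrier R" "y \<in> carrier R" "z \<in> carrier R" for x y z
    proof -
      obtain g h k where "x = rho g" "y = rho h" "z = rho k" "g \<in> carrier G" "h \<in> carrier G" "k \<in> carrier G"
        using xyz by (auto simp: R_def)
      then show ?thesis by (simp add: R_def m_assoc flip: mult)
    qed
    show "\<one>\<^bsub>R\<^esub> \<otimes>\<^bsub>R\<^esub> x = x" if "x \<in> carrier R" for x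
      using that by (auto simp: R_def simp flip: mult)
    show "\<exists>y\<in>carrier R. y \<otimes>\<^bsub>R\<^esub> x = \<one>\<^bsub>R\<^esub>" if x: "x \<in> carrier R" for x
    proof -
      obtain g where "x = rho g" "g \<in> carrier G" using x by (auto simp: R_def)
      then show ?thesis by (intro bexI[of _ "rho (inv g)"]) (auto simp: R_def simp flip: mult)
    qed
  qed
  then interpret h: group_hom G R rho
    using \<open>rho \<in> hom G R\<close> by (simp add: group_hom_def group_hom_axioms_def is_group)
  have "order R dvd order G" by (rule h.order_dvd_if_surj) (simp add: car)
  moreover obtain k where "order G = 2 ^ k" using two_power_order by blast
  ultimately have "order R dvd 2 ^ k" by simp
  then have "\<exists>k. order R = 2 ^ k" using divides_primepow_nat[OF two_is_prime_nat] by blast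
  show "linear_two_group R smul (\<lambda>u f. f u) U"
  proof (intro linear_two_group.intro linear_two_group_axioms.intro \<open>group R\<close> vector_space_axioms)
    show "\<exists>k. order R = 2 ^ k" by fact
  qed (auto simp: finite_U subspace_U car mR oneR rho act_closed act_add act_scale act_one act_mult sub_add sub_scale compose_def)
qed

end

text \<open>All hypotheses on the action, and the conclusion, depend only on the maps induced on
  \<open>U\<close>. Hence the group may be replaced by these maps, where faithfulness holds.\<close>

lemma has_quat_frame_primitive:
  fixes G :: "('g, 'm) monoid_scheme" and smul :: "'k::field \<Rightarrow> 'v::ab_group_add \<Rightarrow> 'v"
  assumes lin: "linear_two_group G smul act U"
    and p: "Factorial_Ring.prime p" "p \<ge> 5" "CARD('k) = p"
    and eig: "eigenvectors_on smul G act U" and bal: "balanced_on smul G act U"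
    and nz: "\<exists>u\<in>U. u \<noteq> 0"
    and prim: "\<And>e. e \<in> carrier G \<Longrightarrow> (\<forall>u\<in>U. act (act u e) e = u) \<Longrightarrow>
      (\<forall>x\<in>carrier G. (\<forall>u\<in>U. act (act u x) e = act (act u e) x) \<or>
         (\<forall>u\<in>U. act (act u x) e = - act (act u e) x)) \<Longrightarrow>
      (\<forall>u\<in>U. act u e = u) \<or> (\<forall>u\<in>U. act u e = - u)"
  shows "p = 5 \<and> has_quat_frame smul G act U"
proof -
  interpret L: linear_two_group G smul act U by fact
  define rho where "rho = (\<lambda>g. \<lambda>u\<in>U. act u g)"
  define R where "R = \<lparr>carrier = rho ` carrier G, mult = (\<lambda>f h. compose U h f), one = rho \<one>\<^bsub>G\<^esub>\<rparr>"
  have linR: "linear_two_group R smul (\<lambda>u f. f u) U"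
    unfolding R_def rho_def by (rule L.restricted_images)
  have rho: "rho g u = act u g" if "u \<in> U" for g u using that by (simp add: rho_def)
  have car: "carrier R = rho ` carrier G" by (simp add: R_def)
  interpret R: linear_two_group R smul "\<lambda>u f. f u" U by fact
  interpret P: primitive_two_group R smul "\<lambda>u f. f u" U p
  proof
    fix g assume g: "g \<in> carrier R" "\<forall>u\<in>U. g u = u"
    then show "g = \<one>\<^bsub>R\<^esub>" using L.act_one by (auto simp: car R_def rho_def fun_eq_iff)
  next
    show "eigenvectors_on smul R (\<lambda>u f. f u) U"
      using eig rho by (auto simp: eigenvectors_on_def car)
    show "balanced_on smul R (\<lambda>u f. f u) U"
      unfolding balanced_on_def
    proof (intro allI impI)
      fix Y g and l :: 'k
      assume Y: "module.subspace smul Y" "Y \<subseteq> U" and st: "\<forall>y\<in>Y. \<forall>x\<in>carrier R. x y \<in> Y"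
        and g: "g \<in> carrier R" and l: "l \<noteq> 0" "l * l \<noteq> 1"
      obtain g' where g': "g = rho g'" "g' \<in> carrier G" using g by (auto simp: car)
      have eq: "g y = act y g'" if "y \<in> Y" for y using g' rho that Y(2) by auto
      have "\<forall>y\<in>Y. \<forall>x\<in>carrier G. act y x \<in> Y" using st rho Y(2) by (auto simp: car subset_iff)
      then have "card {y \<in> Y. act y g' = smul l y} = card {y \<in> Y. act y g' = smul (- l) y}"
        using bal Y g'(2) l unfolding balanced_on_def by blast
      moreover have "{y \<in> Y. g y = smul r y} = {y \<in> Y. act y g' = smul r y}" for r using eq by auto
      ultimately show "card {y \<in> Y. g y = smul l y} = card {y \<in> Y. g y = smul (- l) y}" by (simp only:)
    qed
  next
    fix e assume e: "e \<in> carrier R" "\<forall>u\<in>U. e (e u) = u"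
      "\<forall>x\<in>carrier R. (\<forall>u\<in>U. e (x u) = x (e u)) \<or> (\<forall>u\<in>U. e (x u) = - x (e u))"
    obtain e' where e': "e = rho e'" "e' \<in> carrier G" using e(1) by (auto simp: car)
    have "(\<forall>u\<in>U. act u e' = u) \<or> (\<forall>u\<in>U. act u e' = - u)"
    proof (rule prim[OF e'(2)])
      show "\<forall>u\<in>U. act (act u e') e' = u" using e(2) e' rho L.act_closed by simp
      show "\<forall>x\<in>carrier G. (\<forall>u\<in>U. act (act u x) e' = act (act u e') x) \<or> (\<forall>u\<in>U. act (act u x) e' = - act (act u e') x)"
        using e(3) e' rho L.act_closed by (simp add: car)
    qed
    then show "(\<forall>u\<in>U. e u = u) \<or> (\<forall>u\<in>U. e u = - u)" using e'(1) rho by simp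
  qed (use p nz in auto)
  show ?thesis
  proof (rule P.primitive_structure)
    fix u w assume p5: "p = 5" and span: "U \<subseteq> {smul a u + smul b w | a b. True}" and c: "25 \<le> card U"
      and q: "\<And>x. x \<in> carrier R \<Longrightarrow> \<exists>q\<in>carrier Q8. (x u, x w) = quat_pair smul q (u, w)"
      and uw: "u \<in> U" "w \<in> U"
    have "has_quat_frame smul G act U"
      unfolding has_quat_frame_def
    proof (intro exI[of _ "{(u, w)}"] conjI)
      show "U \<subseteq> module.span smul (frame_points {(u, w)})"
      proof
        fix v assume "v \<in> U"
        then obtain a b where "v = smul a u + smul b w" using span by blast
        then show "v \<in> module.span smul (frame_points {(u, w)})"
          by (simp add: frame_points_def L.span_add L.span_scale L.span_base)
      qed
      show "quat_stable smul G act {(u, w)}"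
        unfolding quat_stable_def using q uw rho by (fastforce simp: car)
    qed (use c uw in \<open>auto simp: frame_points_def\<close>)
      with p5 show ?thesis ..
  qed
qed

section \<open>Splitting along an involution\<close>

lemma (in linear_two_group) quat_pair_act:
  assumes "u \<in> U" "w \<in> U" "g \<in> carrier G"
  shows "(act (fst (quat_pair smul q (u, w))) g, act (snd (quat_pair smul q (u, w))) g)
    = quat_pair smul q (act u g, act w g)"
  using assms by (cases q) (simp add: quat_pair_def act_add act_scale sub_scale)

lemma (in linear_two_group) subgroup_on_subspace:
  assumes N: "subgroup N G" and W: "subspace W" "W \<subseteq> U"
    and st: "\<And>u x. u \<in> W \<Longrightarrow> x \<in> N \<Longrightarrow> act u x \<in> W"
  shows "linear_two_group (G\<lparr>carrier := N\<rparr>) smul act W"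
proof (intro linear_two_group.intro linear_two_group_axioms.intro vector_space_axioms)
  show "group (G\<lparr>carrier := N\<rparr>)" by (rule subgroup.subgroup_is_group[OF N is_group])
  obtain k where "order G = 2 ^ k" using two_power_order by blast
  then have "card N dvd 2 ^ k" using lagrange[OF N] by (metis dvd_triv_right)
  then show "\<exists>k. order (G\<lparr>carrier := N\<rparr>) = 2 ^ k"
    using divides_primepow_nat[OF two_is_prime_nat] by (auto simp: order_def)
  show "finite W" using W(2) finite_U finite_subset by blast
qed (use W subgroup.mem_carrier[OF N] in \<open>auto simp: st act_add act_scale act_one act_mult subset_iff\<close>)

locale split_two_group = linear_two_group G smul act U
  for G :: "('g, 'm) monoid_scheme" (structure)
    and smul :: "'k::field \<Rightarrow> 'v::ab_group_add \<Rightarrow> 'v" (infixr \<open>*\<^sub>k\<close> 75)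
    and act :: "'v \<Rightarrow> 'g \<Rightarrow> 'v" and U :: "'v set" +
  fixes e :: 'g
  assumes e: "e \<in> carrier G" and ee: "\<And>u. u \<in> U \<Longrightarrow> act (act u e) e = u"
    and comm: "\<And>x. x \<in> carrier G \<Longrightarrow> (\<forall>u\<in>U. act (act u x) e = act (act u e) x) \<or>
      (\<forall>u\<in>U. act (act u x) e = - act (act u e) x)"
    and e_ne: "\<exists>u\<in>U. act u e \<noteq> u" "\<exists>u\<in>U. act u e \<noteq> - u"
    and two: "(2::'k) \<noteq> 0"
begin

definition "U1 = {u \<in> U. act u e = u}"
definition "U2 = {u \<in> U. act u e = - u}"
text \<open>Since the action need not be faithful, the centraliser is that of the map given by
  \<open>e\<close>. It is the stabiliser of both eigenspaces, and the elements outside it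
  interchange them.\<close>

definition "N = {x \<in> carrier G. \<forall>u\<in>U. act (act u x) e = act (act u e) x}"

lemma U1: "u \<in> U1 \<Longrightarrow> u \<in> U" "u \<in> U1 \<Longrightarrow> act u e = u"
  and U2: "u \<in> U2 \<Longrightarrow> u \<in> U" "u \<in> U2 \<Longrightarrow> act u e = - u"
  by (auto simp: U1_def U2_def)

lemma subspace_U1: "subspace U1" and subspace_U2: "subspace U2"
  unfolding U1_def U2_def by (auto intro!: subspaceI simp: sub0 sub_add sub_scale act_zero act_add act_scale e)

lemma finite_U1: "finite U1" and finite_U2: "finite U2"
  using finite_U by (auto simp: U1_def U2_def)

lemma eigenspaces_disjoint:
  assumes "u \<in> U1" "u \<in> U2"
  shows "u = 0"
proof -
  have "u + u = 0" using U1(2)[OF assms(1)] U2(2)[OF assms(2)] by (metis add.right_inverse)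
  then have "(1 + 1) *\<^sub>k u = 0" unfolding scale_left_distrib by simp
  then show ?thesis using two by simp
qed

lemma decomp_unique:
  assumes "y + w = y' + w'" "y \<in> U1" "y' \<in> U1" "w \<in> U2" "w' \<in> U2"
  shows "y = y' \<and> w = w'"
proof -
  have "y - y' = w' - w" using assms(1) by (simp add: algebra_simps)
  moreover have d: "y - y' \<in> U1" "w' - w \<in> U2" using assms subspace_U1 subspace_U2 by (auto simp: subspace_diff)
  ultimately have "y - y' = 0" by (intro eigenspaces_disjoint) simp_all
  then show ?thesis using assms(1) by simp
qed

lemma projections:
  assumes "u \<in> U"
  shows "u + act u e \<in> U1" "u - act u e \<in> U2"
  using assms e ee[OF assms] act_closed[OF assms e] by (auto simp: U1_def U2_def act_add act_diff sub_add sub_diff add.commute)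

lemma decomposition:
  assumes u: "u \<in> U"
  shows "\<exists>y\<in>U1. \<exists>w\<in>U2. u = y + w"
proof -
  have "u = inverse 2 *\<^sub>k (u + act u e) + inverse 2 *\<^sub>k (u - act u e)"
  proof -
    have "inverse 2 *\<^sub>k (u + act u e) + inverse 2 *\<^sub>k (u - act u e) = inverse 2 *\<^sub>k (u + u)"
      unfolding scale_right_distrib[symmetric] by simp
    also have "u + u = 2 *\<^sub>k u" using scale_left_distrib[of 1 1 u] by simp
    finally show ?thesis using two by simp
  qed
  then show ?thesis using projections[OF u] subspace_U1 subspace_U2 subspace_scale by metis
qed

lemma card_sumset:
  assumes "A \<subseteq> U1" "B \<subseteq> U2"
  shows "card {y + w | y w. y \<in> A \<and> w \<in> B} = card A * card B"
proof -
  have "inj_on (\<lambda>(y, w). y + w) (A \<times> B)"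
  proof (rule inj_onI, clarify)
    fix y w y' w' assume "y + w = y' + w'" "y \<in> A" "w \<in> B" "y' \<in> A" "w' \<in> B"
    then show "y = y' \<and> w = w'" using decomp_unique[of y w y' w'] assms by blast
  qed
  then have "card ((\<lambda>(y, w). y + w) ` (A \<times> B)) = card A * card B"
    by (simp add: card_image card_cartesian_product)
  moreover have "(\<lambda>(y, w). y + w) ` (A \<times> B) = {y + w | y w. y \<in> A \<and> w \<in> B}" by auto
  ultimately show ?thesis by simp
qed

lemma card_U: "card U = card U1 * card U2"
proof -
  have "U = {y + w | y w. y \<in> U1 \<and> w \<in> U2}" using decomposition U1(1) U2(1) sub_add by blast
  then show ?thesis using card_sumset[of U1 U2] by simp
qed

lemma U1_nonzero: "\<exists>u\<in>U1. u \<noteq> 0"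
proof -
  obtain u where u: "u \<in> U" "act u e \<noteq> - u" using e_ne(2) by blast
  then have "u + act u e \<noteq> 0" by (metis add_eq_0_iff)
  then show ?thesis using projections(1)[OF u(1)] by blast
qed

lemma U2_nonzero: "\<exists>u\<in>U2. u \<noteq> 0"
proof -
  obtain u where u: "u \<in> U" "act u e \<noteq> u" using e_ne by blast
  then have "u - act u e \<noteq> 0" by auto
  then show ?thesis using projections(2)[OF u(1)] by blast
qed

lemma card_U1_less: "card U1 < card U" and card_U2_less: "card U2 < card U"
proof -
  have c2: "2 \<le> card W" if "finite W" "subspace W" and nz: "\<exists>u\<in>W. u \<noteq> 0" for W
  proof -
    obtain u where u: "u \<in> W" "u \<noteq> 0" using nz by blast
    then have "card {0, u} \<le> card W" using that subspace_0 by (intro card_mono) auto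
    then show ?thesis using u by simp
  qed
  show "card U1 < card U" "card U2 < card U"
    using card_U c2[OF finite_U1 subspace_U1 U1_nonzero] c2[OF finite_U2 subspace_U2 U2_nonzero] by auto
qed

lemma N_carrier: "x \<in> N \<Longrightarrow> x \<in> carrier G"
  by (simp add: N_def)

lemma act_U1_N:
  assumes "u \<in> U1" "x \<in> N"
  shows "act u x \<in> U1"
  using assms act_closed by (auto simp: U1_def N_def)

lemma act_U2_N:
  assumes "u \<in> U2" "x \<in> N"
  shows "act u x \<in> U2"
  using assms act_closed act_minus by (auto simp: U2_def N_def)

lemma anticommute:
  assumes "x \<in> carrier G" "x \<notin> N" "u \<in> U"
  shows "act (act u x) e = - act (act u e) x"
  using comm[OF assms(1)] assms by (auto simp: N_def)

lemma act_U1_not_N: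
  assumes "u \<in> U1" "x \<in> carrier G" "x \<notin> N"
  shows "act u x \<in> U2"
  using anticommute[OF assms(2,3)] U1[OF assms(1)] act_closed assms(2) by (auto simp: U2_def)

lemma act_U2_not_N:
  assumes "u \<in> U2" "x \<in> carrier G" "x \<notin> N"
  shows "act u x \<in> U1"
  using anticommute[OF assms(2,3)] U2[OF assms(1)] act_closed act_minus assms(2) by (auto simp: U1_def)

text \<open>Elements outside \<open>N\<close> send \<open>U1\<close> into \<open>U2\<close>, so a
  single non-zero vector decides membership.\<close>

lemma in_N_if_act_U1:
  assumes "u \<in> U1" "u \<noteq> 0" "x \<in> carrier G" "act u x \<in> U1"
  shows "x \<in> N"
  using eigenspaces_disjoint[OF assms(4)] act_U1_not_N[OF assms(1,3)] act_eq_0_iff[OF U1(1)[OF assms(1)] assms(3)] assms(2) by blast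

lemma N_subgroup: "subgroup N G"
proof -
  obtain u1 where u1: "u1 \<in> U1" "u1 \<noteq> 0" using U1_nonzero by blast
  have N1: "\<one> \<in> N" using in_N_if_act_U1[OF u1, of "\<one>"] u1 U1 act_one by simp
  have Ninv: "inv x \<in> N" if "x \<in> N" for x
  proof (rule ccontr)
    assume n: "inv x \<notin> N"
    have "act (act u1 (inv x)) x \<in> U2" using act_U2_N[OF act_U1_not_N[OF u1(1) _ n] that] N_carrier[OF that] by simp
    then show False using act_inv_left[OF U1(1)[OF u1(1)] N_carrier[OF that]] eigenspaces_disjoint u1 by simp
  qed
  show ?thesis
  proof (rule subgroupI)
    show "x \<otimes> y \<in> N" if "x \<in> N" "y \<in> N" for x y
      using in_N_if_act_U1[OF u1, of "x \<otimes> y"] act_mult[OF U1(1)[OF u1(1)] N_carrier[OF that(1)] N_carrier[OF that(2)]]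
        act_U1_N[OF act_U1_N[OF u1(1) that(1)] that(2)] N_carrier that by simp
  qed (use N1 Ninv N_carrier in auto)
qed

lemma N_index:
  assumes "x \<in> carrier G" "y \<in> carrier G" "x \<notin> N" "y \<notin> N"
  shows "x \<otimes> y \<in> N"
proof -
  obtain u1 where u1: "u1 \<in> U1" "u1 \<noteq> 0" using U1_nonzero by blast
  then show ?thesis
    using in_N_if_act_U1[OF u1, of "x \<otimes> y"] act_mult[OF U1(1)[OF u1(1)] assms(1,2)]
      act_U2_not_N[OF act_U1_not_N[OF u1(1) assms(1,3)] assms(2,4)] assms by simp
qed

lemma inv_notin_N: "x \<in> carrier G \<Longrightarrow> x \<notin> N \<Longrightarrow> inv x \<notin> N"
  using subgroup.m_inv_closed[OF N_subgroup, of "inv x"] by auto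

lemma linear_two_group_N:
  shows "linear_two_group (G\<lparr>carrier := N\<rparr>) smul act U1" "linear_two_group (G\<lparr>carrier := N\<rparr>) smul act U2"
proof -
  show "linear_two_group (G\<lparr>carrier := N\<rparr>) smul act U1"
    by (rule subgroup_on_subspace[OF N_subgroup subspace_U1 _ act_U1_N]) (use U1(1) in blast)
  show "linear_two_group (G\<lparr>carrier := N\<rparr>) smul act U2"
    by (rule subgroup_on_subspace[OF N_subgroup subspace_U2 _ act_U2_N]) (use U2(1) in blast)
qed

text \<open>An element that scales a non-zero vector of \<open>U1\<close> keeps it in
  \<open>U1\<close>, and so lies in \<open>N\<close>.\<close>

lemma eigenvectors_on_U1:
  assumes eig: "eigenvectors_on smul G act U"
  shows "eigenvectors_on smul (G\<lparr>carrier := N\<rparr>) act U1"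
  unfolding eigenvectors_on_def
proof (intro ballI allI impI)
  fix u and l :: 'k assume u: "u \<in> U1" and l: "l \<noteq> 0"
  obtain g where g: "g \<in> carrier G" "act u g = l *\<^sub>k u"
    using eig U1(1)[OF u] l by (auto simp: eigenvectors_on_def)
  show "\<exists>g\<in>carrier (G\<lparr>carrier := N\<rparr>). act u g = l *\<^sub>k u"
  proof (cases "u = 0")
    case True
    then show ?thesis using subgroup.one_closed[OF N_subgroup] act_zero[of "\<one>"] by (intro bexI[of _ "\<one>"]) auto
  next
    case False
    then have "g \<in> N" using in_N_if_act_U1[OF u _ g(1)] g(2) subspace_scale[OF subspace_U1 u] by simp
    then show ?thesis using g(2) by auto
  qed
qed

text \<open>Let \<open>a r\<close> and \<open>b r\<close> be the numbers of vectors scaled by \<open>r\<close> under \<open>g\<close> in \<open>Y\<close> and in its translate \<open>Z\<close>.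
  Balance of \<open>g\<close> and of \<open>g \<otimes> e\<close> on \<open>Y + Z\<close> gives \<open>a l * b l = a (- l) * b (- l)\<close> and
  \<open>a l * b (- l) = a (- l) * b l\<close>, whence \<open>(a l)\<^sup>2 = (a (- l))\<^sup>2\<close>.\<close>

lemma balanced_on_U1:
  assumes bal: "balanced_on smul G act U" and s: "s \<in> carrier G" "s \<notin> N"
  shows "balanced_on smul (G\<lparr>carrier := N\<rparr>) act U1"
  unfolding balanced_on_def
proof (intro allI impI)
  fix Y g and l :: 'k
  assume Y: "subspace Y" "Y \<subseteq> U1" and st: "\<forall>y\<in>Y. \<forall>x\<in>carrier (G\<lparr>carrier := N\<rparr>). act y x \<in> Y"
    and g: "g \<in> carrier (G\<lparr>carrier := N\<rparr>)" and l: "l \<noteq> 0" "l * l \<noteq> 1"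
  have YU: "y \<in> U" if "y \<in> Y" for y using that Y(2) U1(1) by blast
  have gN: "g \<in> N" and gG: "g \<in> carrier G" using g N_carrier by auto
  have stN: "act y x \<in> Y" if "y \<in> Y" "x \<in> N" for y x using st that by simp
  define Z where "Z = (\<lambda>z. act z s) ` Y"
  have ZU: "Z \<subseteq> U2" using act_U1_not_N[OF _ s] Y(2) by (auto simp: Z_def)
  define Y' where "Y' = {y + w | y w. y \<in> Y \<and> w \<in> Z}"
  have "Y \<subseteq> U" using YU by blast
  note sum = translate_sum[OF N_subgroup N_index s Y(1) this stN, folded Z_def, folded Y'_def]
  let ?A = "\<lambda>r. {y \<in> Y. act y g = r *\<^sub>k y}" and ?B = "\<lambda>r. {w \<in> Z. act w g = r *\<^sub>k w}"
  have gw: "act w g \<in> U2" if "w \<in> Z" for w using act_U2_N[OF _ gN] ZU that by blast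
  have gy: "act y g \<in> U1" if "y \<in> Y" for y using act_U1_N[OF _ gN] Y(2) that by blast
  have S1: "{v \<in> Y'. act v g = r *\<^sub>k v} = {y + w | y w. y \<in> ?A r \<and> w \<in> ?B r}" for r
  proof -
    have "act (y + w) g = r *\<^sub>k (y + w) \<longleftrightarrow> act y g = r *\<^sub>k y \<and> act w g = r *\<^sub>k w" if yw: "y \<in> Y" "w \<in> Z" for y w
    proof -
      have yw': "y \<in> U1" "w \<in> U2" using yw Y(2) ZU by auto
      have "act (y + w) g = act y g + act w g" using act_add[OF U1(1)[OF yw'(1)] U2(1)[OF yw'(2)] gG] .
      then show ?thesis
        using decomp_unique[OF _ gy[OF yw(1)] subspace_scale[OF subspace_U1 yw'(1), of r] gw[OF yw(2)] subspace_scale[OF subspace_U2 yw'(2), of r]]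
        unfolding scale_right_distrib by auto
    qed
    then show ?thesis by (auto simp: Y'_def)
  qed
  \<comment> \<open>As \<open>e\<close> acts as 1 on \<open>Y\<close> and as - 1 on
    \<open>Z\<close>, passing from \<open>g\<close> to \<open>g \<otimes> e\<close> negates the
    eigenvalue on \<open>Z\<close> only.\<close>
  have S2: "{v \<in> Y'. act v (g \<otimes> e) = r *\<^sub>k v} = {y + w | y w. y \<in> ?A r \<and> w \<in> ?B (- r)}" for r
  proof -
    have "act (y + w) (g \<otimes> e) = r *\<^sub>k (y + w) \<longleftrightarrow> act y g = r *\<^sub>k y \<and> act w g = (- r) *\<^sub>k w" if yw: "y \<in> Y" "w \<in> Z" for y w
    proof -
      have wU: "w \<in> U" using yw(2) ZU U2(1) by blast
      have ac: "act (y + w) (g \<otimes> e) = act y g + - act w g"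
        using act_mult[OF sub_add[OF YU[OF yw(1)] wU] gG e] act_add[OF YU[OF yw(1)] wU gG]
          act_add[OF U1(1)[OF gy[OF yw(1)]] U2(1)[OF gw[OF yw(2)]] e] U1(2)[OF gy[OF yw(1)]] U2(2)[OF gw[OF yw(2)]] by simp
      have yw': "y \<in> U1" "w \<in> U2" using yw Y(2) ZU by auto
      have mi: "act w g = (- r) *\<^sub>k w \<longleftrightarrow> - act w g = r *\<^sub>k w" by (metis scale_minus_left minus_minus)
      show ?thesis
        using decomp_unique[OF _ gy[OF yw(1)] subspace_scale[OF subspace_U1 yw'(1), of r] subspace_neg[OF subspace_U2 gw[OF yw(2)]] subspace_scale[OF subspace_U2 yw'(2), of r]]
        unfolding ac mi scale_right_distrib by auto
    qed
    then show ?thesis by (auto simp: Y'_def)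
  qed
  have ge: "g \<otimes> e \<in> carrier G" using gG e by simp
  have "card {v \<in> Y'. act v g = l *\<^sub>k v} = card {v \<in> Y'. act v g = (- l) *\<^sub>k v}"
    using bal sum(2-4) gG l unfolding balanced_on_def by blast
  then have e1: "card (?A l) * card (?B l) = card (?A (- l)) * card (?B (- l))"
    unfolding S1 using Y(2) ZU by (subst (asm) (1 2) card_sumset) auto
  have "card {v \<in> Y'. act v (g \<otimes> e) = l *\<^sub>k v} = card {v \<in> Y'. act v (g \<otimes> e) = (- l) *\<^sub>k v}"
    using bal sum(2-4) ge l unfolding balanced_on_def by blast
  then have e2: "card (?A l) * card (?B (- l)) = card (?A (- l)) * card (?B (- (- l)))"
    unfolding S2 using Y(2) ZU by (subst (asm) (1 2) card_sumset) auto
  \<comment> \<open>The zero vector is counted, so the counts on \<open>Z\<close> can be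
    cancelled.\<close>
  have Bpos: "card (?B r) > 0" for r
  proof -
    have "0 \<in> ?B r" using subspace_0[OF sum(1)] act_zero[OF gG] by simp
    moreover have "finite Z" using ZU finite_U2 by (rule finite_subset)
    then have "finite (?B r)" by simp
    ultimately show ?thesis using card_gt_0_iff by blast
  qed
  have "(card (?A l) * card (?A l)) * (card (?B l) * card (?B (- l)))
      = (card (?A l) * card (?B l)) * (card (?A l) * card (?B (- l)))" by (simp only: ac_simps)
  also have "\<dots> = (card (?A (- l)) * card (?A (- l))) * (card (?B l) * card (?B (- l)))"
    unfolding e1 e2 by (simp only: ac_simps minus_minus)
  finally have "card (?A l) * card (?A l) = card (?A (- l)) * card (?A (- l))"
    using Bpos[of l] Bpos[of "- l"] by (simp only: mult_right_cancel mult_eq_0_iff neq0_conv[symmetric] simp_thms)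
  then have "(card (?A l))\<^sup>2 = (card (?A (- l)))\<^sup>2" by (simp only: power2_eq_square)
  then show "card (?A l) = card (?A (- l))" by simp
qed

lemma has_quat_frame_union:
  assumes N: "N = carrier G" and fr: "has_quat_frame smul G act U1" "has_quat_frame smul G act U2"
  shows "has_quat_frame smul G act U"
proof -
  from fr(1) obtain F1 where F1: "finite F1" "frame_points F1 \<subseteq> U1" "U1 \<subseteq> span (frame_points F1)" "25 ^ card F1 \<le> card U1"
    "quat_stable smul G act F1" unfolding has_quat_frame_def by blast
  from fr(2) obtain F2 where F2: "finite F2" "frame_points F2 \<subseteq> U2" "U2 \<subseteq> span (frame_points F2)" "25 ^ card F2 \<le> card U2"
    "quat_stable smul G act F2" unfolding has_quat_frame_def by blast
  show ?thesis
    unfolding has_quat_frame_def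
  proof (intro exI[of _ "F1 \<union> F2"] conjI)
    show "frame_points (F1 \<union> F2) \<subseteq> U" using F1(2) F2(2) U1(1) U2(1) by (auto simp: frame_points_def)
    have "span (frame_points F1) \<subseteq> span (frame_points (F1 \<union> F2))"
      "span (frame_points F2) \<subseteq> span (frame_points (F1 \<union> F2))"
      by (auto intro!: span_mono simp: frame_points_def)
    then have "U1 \<subseteq> span (frame_points (F1 \<union> F2))" "U2 \<subseteq> span (frame_points (F1 \<union> F2))"
      using F1(3) F2(3) by auto
    then show "U \<subseteq> span (frame_points (F1 \<union> F2))"
      using decomposition span_add by blast
    have "(25::nat) ^ card (F1 \<union> F2) \<le> 25 ^ (card F1 + card F2)"
      by (intro power_increasing card_Un_le) simp
    also have "\<dots> \<le> card U" unfolding card_U power_add using F1(4) F2(4) by (rule mult_le_mono)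
    finally show "25 ^ card (F1 \<union> F2) \<le> card U" .
    show "quat_stable smul G act (F1 \<union> F2)" using F1(5) F2(5) unfolding quat_stable_def by blast
  qed (use F1(1) F2(1) in simp)
qed

text \<open>\<open>s\<close> carries \<open>U1\<close> onto \<open>U2\<close>, so a frame of
  \<open>U1\<close> and its translate by \<open>s\<close> together serve for \<open>U\<close>. An
  element outside \<open>N\<close> is an element of \<open>N\<close> followed by
  \<open>s\<close>.\<close>

lemma has_quat_frame_induced:
  assumes s: "s \<in> carrier G" "s \<notin> N" and fr: "has_quat_frame smul (G\<lparr>carrier := N\<rparr>) act U1"
  shows "has_quat_frame smul G act U"
proof -
  have isN: "inv s \<in> carrier G" "inv s \<notin> N" using s inv_notin_N by auto
  from fr obtain F1 where F1: "finite F1" "frame_points F1 \<subseteq> U1" "U1 \<subseteq> span (frame_points F1)" "25 ^ card F1 \<le> card U1"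
    and F1': "quat_stable smul (G\<lparr>carrier := N\<rparr>) act F1"
    unfolding has_quat_frame_def by blast
  have F1q: "\<exists>q\<in>carrier Q8. \<exists>f'\<in>F1. (act (fst f) g, act (snd f) g) = quat_pair smul q f'"
    if "f \<in> F1" "g \<in> N" for f g using F1' that by (simp add: quat_stable_def)
  define S where "S = (\<lambda>f. (act (fst f) s, act (snd f) s))"
  define F where "F = F1 \<union> S ` F1"
  have fU: "fst f \<in> U1" "snd f \<in> U1" if "f \<in> F1" for f using that F1(2) by (auto simp: frame_points_def)
  have key: "\<exists>q\<in>carrier Q8. \<exists>f'\<in>F. (act (fst f) h, act (snd f) h) = quat_pair smul q f'"
    if f: "f \<in> F1" and h: "h \<in> carrier G" for f h
  proof (cases "h \<in> N")
    case True
    then show ?thesis using F1q[OF f] unfolding F_def by blast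
  next
    case False
    then have "h \<otimes> inv s \<in> N" (is "?h \<in> N") using N_index[OF h isN(1) _ isN(2)] by simp
    then obtain q f' where q: "q \<in> carrier Q8" "f' \<in> F1" "(act (fst f) ?h, act (snd f) ?h) = quat_pair smul q f'"
      using F1q[OF f] by blast
    have hs: "act u h = act (act u ?h) s" if "u \<in> U" for u
      using act_mult[OF that, of ?h s] h s(1) by (simp add: m_assoc)
    have "(act (fst f) h, act (snd f) h) = (act (fst (quat_pair smul q f')) s, act (snd (quat_pair smul q f')) s)"
      using hs fU[OF f] U1(1) by (simp flip: q(3))
    also have "\<dots> = quat_pair smul q (S f')"
      using quat_pair_act[OF U1(1)[OF fU(1)[OF q(2)]] U1(1)[OF fU(2)[OF q(2)]] s(1), of q] by (simp add: S_def)
    finally show ?thesis using q(1,2) by (auto simp: F_def)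
  qed
  show ?thesis
    unfolding has_quat_frame_def
  proof (intro exI[of _ F] conjI)
    show "finite F" using F1(1) by (simp add: F_def)
    show "frame_points F \<subseteq> U"
      using fU U1(1) act_closed s(1) by (auto simp: F_def S_def frame_points_def)
    show "U \<subseteq> span (frame_points F)"
    proof
      fix u assume "u \<in> U"
      then obtain y w where u: "y \<in> U1" "w \<in> U2" "u = y + w" using decomposition by blast
      have "span (frame_points F1) \<subseteq> span (frame_points F)"
        by (auto intro!: span_mono simp: frame_points_def F_def)
      then have "y \<in> span (frame_points F)" using F1(3) u(1) by blast
      moreover have "span (frame_points F1) \<subseteq> {v \<in> U. act v s \<in> span (frame_points F)}"
      proof (rule span_minimal)
        have "act (fst f) s \<in> frame_points F \<and> act (snd f) s \<in> frame_points F" if "f \<in> F1" for f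
        proof -
          have "S f \<in> F" using that by (simp add: F_def)
          then have "fst (S f) \<in> frame_points F \<and> snd (S f) \<in> frame_points F" unfolding frame_points_def by blast
          then show ?thesis by (simp add: S_def)
        qed
        then show "frame_points F1 \<subseteq> {v \<in> U. act v s \<in> span (frame_points F)}"
          using fU U1(1) span_base unfolding frame_points_def[of F1] by blast
        show "subspace {v \<in> U. act v s \<in> span (frame_points F)}"
          by (rule subspaceI) (auto simp: sub0 sub_add sub_scale act_zero act_add act_scale s(1)
              span_zero span_add span_scale)
      qed
      then have "act (act w (inv s)) s \<in> span (frame_points F)"
        using F1(3) act_U2_not_N[OF u(2) isN] by blast
      then have "w \<in> span (frame_points F)" using act_inv_left[OF U2(1)[OF u(2)] s(1)] by simp
      ultimately show "u \<in> span (frame_points F)" using u(3) span_add by blast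
    qed
    have "card U1 = card U2"
    proof (rule bij_betw_same_card[of "\<lambda>u. act u s"], rule bij_betwI[where g = "\<lambda>u. act u (inv s)"])
      show "(\<lambda>u. act u s) \<in> U1 \<rightarrow> U2" using act_U1_not_N[OF _ s] by blast
      show "(\<lambda>u. act u (inv s)) \<in> U2 \<rightarrow> U1" using act_U2_not_N[OF _ isN] by blast
    qed (use act_inv_left act_inv_right U1(1) U2(1) s(1) in auto)
    have "card F \<le> card F1 + card F1"
      unfolding F_def using card_Un_le[of F1 "S ` F1"] card_image_le[OF F1(1), of S] by linarith
    then have "(25::nat) ^ card F \<le> 25 ^ (card F1 + card F1)" by (intro power_increasing) simp_all
    also have "\<dots> \<le> card U"
      unfolding card_U power_add \<open>card U1 = card U2\<close>[symmetric] using F1(4) F1(4) by (rule mult_le_mono)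
    finally show "25 ^ card F \<le> card U" .
    show "quat_stable smul G act F"
      unfolding quat_stable_def
    proof (intro ballI)
      fix f h assume f: "f \<in> F" and h: "h \<in> carrier G"
      from f consider "f \<in> F1" | f1 where "f1 \<in> F1" "f = S f1" by (auto simp: F_def)
      then show "\<exists>q\<in>carrier Q8. \<exists>f'\<in>F. (act (fst f) h, act (snd f) h) = quat_pair smul q f'"
      proof cases
        case 1 then show ?thesis using key h by blast
      next
        case 2
        \<comment> \<open>Applying \<open>h\<close> to a translated pair is applying
          \<open>s \<otimes> h\<close> to the original one, which \<open>key\<close> covers.\<close>
        have "s \<otimes> h \<in> carrier G" using s(1) h by simp
        from key[OF 2(1) this] show ?thesis
          using act_mult[OF U1(1)[OF fU(1)[OF 2(1)]] s(1) h] act_mult[OF U1(1)[OF fU(2)[OF 2(1)]] s(1) h] 2(2)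
          by (simp add: S_def)
      qed
    qed
  qed
qed

end

text \<open>Induction on the dimension. An element acting as an involution other than a sign, and commuting
  with \<open>G\<close> up to sign, splits \<open>U\<close> into two eigenspaces, which \<open>G\<close> either preserves or interchanges.\<close>

lemma has_quat_frame_exists:
  fixes G :: "('g, 'm) monoid_scheme" and smul :: "'k::field \<Rightarrow> 'v::ab_group_add \<Rightarrow> 'v"
  assumes p: "Factorial_Ring.prime p" "p \<ge> 5" "CARD('k) = p"
    and "linear_two_group G smul act U"
    and "eigenvectors_on smul G act U" and "balanced_on smul G act U"
    and "\<exists>u\<in>U. u \<noteq> 0"
  shows "p = 5 \<and> has_quat_frame smul G act U"
  using assms(4-)
proof (induction "card U" arbitrary: G U rule: less_induct)
  case (less U G)
  interpret L: linear_two_group G smul act U by (rule less.prems(1))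
  note eig = less.prems(2) and bal = less.prems(3)
  show ?case
  proof (cases "\<exists>e\<in>carrier G. (\<forall>u\<in>U. act (act u e) e = u) \<and>
      (\<forall>x\<in>carrier G. (\<forall>u\<in>U. act (act u x) e = act (act u e) x) \<or>
         (\<forall>u\<in>U. act (act u x) e = - act (act u e) x)) \<and>
      \<not> (\<forall>u\<in>U. act u e = u) \<and> \<not> (\<forall>u\<in>U. act u e = - u)")
    case False
    show ?thesis
      by (rule has_quat_frame_primitive[OF less.prems(1) p eig bal less.prems(4)]) (use False in blast)
  next
    case True
    then obtain e where e: "e \<in> carrier G" "\<And>u. u \<in> U \<Longrightarrow> act (act u e) e = u"
      and comm: "\<And>x. x \<in> carrier G \<Longrightarrow> (\<forall>u\<in>U. act (act u x) e = act (act u e) x) \<or>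
         (\<forall>u\<in>U. act (act u x) e = - act (act u e) x)"
      and e_ne: "\<exists>u\<in>U. act u e \<noteq> u" "\<exists>u\<in>U. act u e \<noteq> - u" by blast
    have two: "(2::'k) \<noteq> 0"
      using of_nat_eq_0_iff_dvd_card[OF p(1,3), of 2] p(2) dvd_imp_le[of p 2] by auto
    interpret S: split_two_group G smul act U e
      by (intro split_two_group.intro split_two_group_axioms.intro less.prems(1) e comm e_ne two)
    show ?thesis
    proof (cases "S.N = carrier G")
      case True
      have G: "G\<lparr>carrier := S.N\<rparr> = G" using True by simp
      \<comment> \<open>Quantifying balance over all stable subspaces lets it restrict to both
        eigenspaces at once.\<close>
      have bal': "balanced_on smul G act W" if "W \<subseteq> U" for W
        using bal that by (simp add: balanced_on_def)
      have eig2: "eigenvectors_on smul G act S.U2" using eig S.U2(1) by (simp add: eigenvectors_on_def)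
      have "p = 5 \<and> has_quat_frame smul G act S.U1"
        by (rule less.hyps[OF S.card_U1_less S.linear_two_group_N(1)[unfolded G] S.eigenvectors_on_U1[OF eig, unfolded G] bal' S.U1_nonzero])
          (use S.U1(1) in blast)
      moreover have "p = 5 \<and> has_quat_frame smul G act S.U2"
        by (rule less.hyps[OF S.card_U2_less S.linear_two_group_N(2)[unfolded G] eig2 bal' S.U2_nonzero]) (use S.U2(1) in blast)
      ultimately show ?thesis using S.has_quat_frame_union[OF True] by blast
    next
      case False
      then obtain s where s: "s \<in> carrier G" "s \<notin> S.N" using S.N_carrier by blast
      show ?thesis
        using less.hyps[OF S.card_U1_less S.linear_two_group_N(1) S.eigenvectors_on_U1[OF eig] S.balanced_on_U1[OF bal s] S.U1_nonzero]
          S.has_quat_frame_induced[OF s] by blast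
    qed
  qed
qed

section \<open>Distinguishing colourings\<close>

definition asymmetric_colouring :: "('a \<Rightarrow> 'a) set \<Rightarrow> 'a set \<Rightarrow> ('a \<Rightarrow> nat) \<Rightarrow> bool" where
  "asymmetric_colouring K \<Omega> c \<longleftrightarrow> (\<forall>x\<in>\<Omega>. c x < 3) \<and> (\<forall>\<sigma>\<in>K. (\<forall>x\<in>\<Omega>. c (\<sigma> x) = c x) \<longrightarrow> \<sigma> = id)"

text \<open>The point set is arbitrary rather than an interval, because the induction passes to a
  set of orbit representatives.\<close>

definition permutation_group :: "('a \<Rightarrow> 'a) set \<Rightarrow> 'a set \<Rightarrow> bool" where
  "permutation_group K \<Omega> \<longleftrightarrow> (\<forall>\<sigma>\<in>K. \<sigma> permutes \<Omega>) \<and> group \<lparr>carrier = K, mult = (\<circ>), one = id\<rparr>"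

text \<open>Induction via the orbits of a central involution \<open>z\<close>: the orbit \<open>{x, z x}\<close> of a non-fixed point gets the
  two colours different from the one its class carries in the quotient colouring, in either order. The
  strengthening by \<open>d\<close>, a second colour allowed at \<open>\<omega>\<close>, is what separates single coordinates in the wreath product.\<close>

lemma distinguishing_colourings:
  assumes "finite \<Omega>" "permutation_group K \<Omega>" "card K = 2 ^ k" "\<omega> \<in> \<Omega>"
  shows "\<exists>c d. c \<omega> \<noteq> d \<and> asymmetric_colouring K \<Omega> c \<and> asymmetric_colouring K \<Omega> (c(\<omega> := d))"
  using assms
proof (induction "card \<Omega>" arbitrary: \<Omega> K k rule: less_induct)
  case (less \<Omega> K)
  let ?K = "\<lparr>carrier = K, mult = (\<circ>), one = id\<rparr>"
  interpret K: group ?K using less.prems(2) by (simp add: permutation_group_def)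
  have perm: "\<sigma> permutes \<Omega>" if "\<sigma> \<in> K" for \<sigma> using less.prems(2) that by (simp add: permutation_group_def)
  show ?case
  proof (cases "K = {id}")
    case True
    then show ?thesis
      by (intro exI[of _ "\<lambda>_. 0"] exI[of _ 1]) (auto simp: asymmetric_colouring_def)
  next
    case False
    have idK: "id \<in> K" using K.one_closed by simp
    have "{\<one>\<^bsub>?K\<^esub>} \<subset> carrier ?K" using False idK by auto
    moreover have "order ?K = 2 ^ k" using less.prems(3) by (simp add: order_def)
    ultimately obtain z where z: "z \<in> K" "z \<noteq> id" "z \<circ> z = id"
      and zc: "\<And>x. x \<in> K \<Longrightarrow> \<exists>d\<in>{id}. inv\<^bsub>?K\<^esub> x \<circ> z \<circ> x = z \<circ> d"
      using K.two_group_central_quotient[OF _ K.one_is_normal, of k]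
      by (metis (no_types, lifting) monoid.select_convs(1) monoid.select_convs(2) partial_object.select_convs(1) singleton_iff)
    have comm: "z (\<sigma> x) = \<sigma> (z x)" if s: "\<sigma> \<in> K" for \<sigma> x
    proof -
      have "inv\<^bsub>?K\<^esub> \<sigma> \<circ> z \<circ> \<sigma> = z" using zc[OF s] by simp
      then have "\<sigma> \<circ> (inv\<^bsub>?K\<^esub> \<sigma> \<circ> z \<circ> \<sigma>) = \<sigma> \<circ> z" by simp
      moreover have "\<sigma> \<circ> inv\<^bsub>?K\<^esub> \<sigma> = id" using K.r_inv[of \<sigma>] s by simp
      ultimately have "z \<circ> \<sigma> = \<sigma> \<circ> z" by (metis comp_assoc id_comp)
      then show ?thesis by (metis comp_apply)
    qed
    have zz: "z (z x) = x" for x using z(3) by (metis comp_apply id_apply)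
    have zO: "z x \<in> \<Omega> \<longleftrightarrow> x \<in> \<Omega>" for x using permutes_in_image[OF perm[OF z(1)]] .
    \<comment> \<open>\<open>r\<close> picks one point of each orbit of \<open>z\<close>. The point
      \<open>\<omega>\<close> represents its own orbit, so that it remains available in the
      quotient.\<close>
    define r where "r x = (if \<omega> \<in> {x, z x} then \<omega> else (SOME y. y \<in> {x, z x}))" for x
    have r_in: "r x = x \<or> r x = z x" for x
    proof (cases "\<omega> \<in> {x, z x}")
      case False
      then have "r x = (SOME y. y \<in> {x, z x})" by (simp add: r_def)
      moreover have "(SOME y. y \<in> {x, z x}) \<in> {x, z x}" unfolding some_in_eq by simp
      ultimately show ?thesis by auto
    qed (auto simp: r_def)
    have rz: "r (z x) = r x" for x
    proof -
      have "{z x, z (z x)} = {x, z x}" using zz by auto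
      then show ?thesis unfolding r_def by simp
    qed
    have rr: "r (r x) = r x" for x using r_in[of x] rz by auto
    define R where "R = r ` \<Omega>"
    have r\<omega>: "r \<omega> = \<omega>" by (simp add: r_def)
    have RO: "R \<subseteq> \<Omega>"
      unfolding R_def using r_in zO by (metis image_subsetI)
    have rR: "r x = x" if "x \<in> R" for x using that rr by (auto simp: R_def)
    have rin: "r x \<in> R" if "x \<in> \<Omega>" for x using that by (auto simp: R_def)
    have \<omega>R: "\<omega> \<in> R" using rin[OF less.prems(4)] r\<omega> by simp
    obtain x0 where x0: "z x0 \<noteq> x0" using z(2) by (auto simp: fun_eq_iff)
    then have x0O: "x0 \<in> \<Omega>" using perm[OF z(1)] by (auto simp: permutes_def)
    have "card R < card \<Omega>"
    proof -
      have "\<not> inj_on r \<Omega>" using rz[of x0] x0 x0O zO by (auto simp: inj_on_def)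
      then have "card R \<noteq> card \<Omega>" using less.prems(1) by (simp add: R_def inj_on_iff_eq_card)
      then show ?thesis using card_mono[OF less.prems(1) RO] by simp
    qed
    have sO: "\<sigma> x \<in> \<Omega> \<longleftrightarrow> x \<in> \<Omega>" if "\<sigma> \<in> K" for \<sigma> x using permutes_in_image[OF perm[OF that]] .
    \<comment> \<open>The permutation induced on the orbits of \<open>z\<close>, read on
      representatives; it is the identity elsewhere, as \<open>permutes\<close> demands.\<close>
    define q where "q \<sigma> = (\<lambda>x. if x \<in> R then r (\<sigma> x) else x)" for \<sigma>
    have rs: "r (\<sigma> (r x)) = r (\<sigma> x)" if "\<sigma> \<in> K" for \<sigma> x
      using r_in[of x] rz[of "\<sigma> x"] comm[OF that] by metis
    have q_comp: "q (\<sigma> \<circ> \<tau>) = q \<sigma> \<circ> q \<tau>" if "\<sigma> \<in> K" "\<tau> \<in> K" for \<sigma> \<tau>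
      using that rs rin sO RO by (auto simp: q_def fun_eq_iff)
    have q_id: "q id = id" using rR by (auto simp: q_def fun_eq_iff)
    have q_inv: "q \<sigma> \<circ> q (inv\<^bsub>?K\<^esub> \<sigma>) = id" "q (inv\<^bsub>?K\<^esub> \<sigma>) \<circ> q \<sigma> = id" "inv\<^bsub>?K\<^esub> \<sigma> \<in> K" if s: "\<sigma> \<in> K" for \<sigma>
      using K.r_inv[of \<sigma>] K.l_inv[of \<sigma>] K.inv_closed[of \<sigma>] s q_id by (simp_all flip: q_comp)
    have q_perm: "q \<sigma> permutes R" if s: "\<sigma> \<in> K" for \<sigma>
    proof (rule bij_imp_permutes)
      show "bij_betw (q \<sigma>) R R"
      proof (rule bij_betwI[where g = "q (inv\<^bsub>?K\<^esub> \<sigma>)"])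
        show "q \<sigma> \<in> R \<rightarrow> R" using s sO rin RO by (auto simp: q_def)
        show "q (inv\<^bsub>?K\<^esub> \<sigma>) \<in> R \<rightarrow> R" using q_inv(3)[OF s] sO rin RO by (auto simp: q_def)
        show "q (inv\<^bsub>?K\<^esub> \<sigma>) (q \<sigma> x) = x" for x using q_inv(2)[OF s] by (metis comp_apply id_apply)
        show "q \<sigma> (q (inv\<^bsub>?K\<^esub> \<sigma>) x) = x" for x using q_inv(1)[OF s] by (metis comp_apply id_apply)
      qed
    qed (simp add: q_def)
    let ?Q = "\<lparr>carrier = q ` K, mult = (\<circ>), one = id\<rparr>"
    have grQ: "group ?Q"
    proof (rule groupI)
      show "x \<otimes>\<^bsub>?Q\<^esub> y \<in> carrier ?Q" if "x \<in> carrier ?Q" "y \<in> carrier ?Q" for x y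
        using that q_comp K.m_closed by (auto simp flip: q_comp)
      show "\<one>\<^bsub>?Q\<^esub> \<in> carrier ?Q" using idK q_id by force
      show "\<exists>y\<in>carrier ?Q. y \<otimes>\<^bsub>?Q\<^esub> x = \<one>\<^bsub>?Q\<^esub>" if "x \<in> carrier ?Q" for x
        using that q_inv by auto
    qed (auto simp: comp_assoc)
    have "group_hom ?K ?Q q"
      using grQ K.is_group q_comp by (auto simp: group_hom_def group_hom_axioms_def hom_def)
    then have "card (q ` K) dvd card K"
      using group_hom.order_dvd_if_surj[of ?K ?Q q] by (simp add: order_def)
    then obtain k' where "card (q ` K) = 2 ^ k'"
      using less.prems(3) divides_primepow_nat[OF two_is_prime_nat] by metis
    moreover have "permutation_group (q ` K) R" using grQ q_perm by (auto simp: permutation_group_def)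
    ultimately obtain C d where Cd: "C \<omega> \<noteq> d" "asymmetric_colouring (q ` K) R C" "asymmetric_colouring (q ` K) R (C(\<omega> := d))"
      using less.hyps[OF \<open>card R < card \<Omega>\<close> finite_subset[OF RO less.prems(1)] _ _ \<omega>R] by blast
    \<comment> \<open>The two colours on a 2-orbit determine its class colour, so a symmetry of
      \<open>c\<close> induces a symmetry of \<open>C\<close> on the classes, hence the identity
      there. The two colours differ, so the symmetry cannot swap the orbit either. Fixed points and
      2-orbits are not confused, as everything commutes with \<open>z\<close>.\<close>
    define lift where "lift C c \<longleftrightarrow> (\<forall>x\<in>R. c x < 3 \<and> c (z x) < 3 \<and>
        (if z x = x then c x = C x else {c x, c (z x)} = {..<3} - {C x}))" for C c :: "'a \<Rightarrow> nat"
    have lift: "asymmetric_colouring K \<Omega> c" if l: "lift C c" and C: "asymmetric_colouring (q ` K) R C" for C c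
      unfolding asymmetric_colouring_def
    proof (intro conjI ballI impI)
      fix x assume x: "x \<in> \<Omega>"
      have "x = r x \<or> x = z (r x)" using r_in[of x] zz by auto
      then show "c x < 3" using l rin[OF x] unfolding lift_def by metis
    next
      fix \<sigma> assume s: "\<sigma> \<in> K" and pres: "\<forall>x\<in>\<Omega>. c (\<sigma> x) = c x"
      have C3: "C x < 3" if "x \<in> R" for x using C that by (simp add: asymmetric_colouring_def)
      have "C (q \<sigma> x) = C x" if x: "x \<in> R" for x
      proof -
        have xO: "x \<in> \<Omega>" "z x \<in> \<Omega>" using x RO zO by auto
        define y where "y = r (\<sigma> x)"
        have yR: "y \<in> R" using rin sO[OF s] xO by (simp add: y_def)
        have y: "y = \<sigma> x \<or> y = \<sigma> (z x)" using r_in[of "\<sigma> x"] comm[OF s] by (auto simp: y_def)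
        have "C y = C x"
        proof (cases "z x = x")
          case True
          then have "y = \<sigma> x" "z y = y" using y comm[OF s, of x] by auto
          then show ?thesis using l x yR True pres xO by (auto simp: lift_def)
        next
          case False
          have "z y \<noteq> y"
          proof
            assume "z y = y"
            then have "\<sigma> (z x) = \<sigma> x" using y comm[OF s] zz by metis
            then show False using False permutes_inj[OF perm[OF s]] by (auto simp: inj_def)
          qed
          moreover have "{c y, c (z y)} = {c x, c (z x)}"
            using y comm[OF s] zz pres xO by (metis insert_commute)
          ultimately have "{..<3} - {C y} = {..<3} - {C x}" using l x yR False unfolding lift_def by metis
          then show ?thesis using C3[OF x] C3[OF yR] by blast
        qed
        then show ?thesis using x by (simp add: q_def y_def)
      qed
      then have qs: "q \<sigma> = id" using C s by (auto simp: asymmetric_colouring_def)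
      have fixR: "\<sigma> x = x" if x: "x \<in> R" for x
      proof -
        have "r (\<sigma> x) = x" using fun_cong[OF qs, of x] x by (simp add: q_def)
        then have "\<sigma> x = x \<or> \<sigma> x = z x" using r_in[of "\<sigma> x"] zz by metis
        moreover have "c x \<noteq> c (z x)" if "z x \<noteq> x"
        proof
          assume "c x = c (z x)"
          moreover have "{..<3} - {C x} = {c x, c (z x)}" using l x that by (simp add: lift_def)
          ultimately have "card ({..<3} - {C x}) = 1" by simp
          moreover have "card ({..<3} - {C x}) = 2" using C3[OF x] by simp
          ultimately show False by simp
        qed
        ultimately show ?thesis using pres x RO by (metis subsetD)
      qed
      have "\<sigma> x = x" for x
      proof (cases "x \<in> \<Omega>")
        case True
        have "x = r x \<or> x = z (r x)" using r_in[of x] zz by auto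
        then show ?thesis using fixR[OF rin[OF True]] comm[OF s, of "r x"] by metis
      next
        case False
        then show ?thesis using perm[OF s] by (simp add: permutes_def)
      qed
      then show "\<sigma> = id" by auto
    qed
    have C3: "C x < 3" if "x \<in> R" for x using Cd(2) that by (simp add: asymmetric_colouring_def)
    have d3: "d < 3" using Cd(3) \<omega>R by (simp add: asymmetric_colouring_def) (metis fun_upd_same)
    \<comment> \<open>A particular lift: a representative takes the colour cyclically after that of
      its class, its partner the one after that.\<close>
    define base where "base x = (if z x = x then C x else if x \<in> R then (C x + 1) mod 3 else (C (z x) + 2) mod 3)" for x
    have notR: "z x \<notin> R" if "x \<in> R" "z x \<noteq> x" for x using rR[OF that(1)] rR[of "z x"] rz[of x] that by auto
    have mod3: "{(a + 1) mod 3, (a + 2) mod 3} = {..<3} - {a}" if "a < 3" for a :: nat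
    proof -
      have "a = 0 \<or> a = 1 \<or> a = 2" using that by auto
      then consider "a = 0" | "a = 1" | "a = 2" by blast
      then show ?thesis
      proof cases
        case 1
        have "{..<3::nat} - {0} = {1, 2}" by auto
        then show ?thesis using 1 by (simp add: numeral_2_eq_2)
      next
        case 2
        have "{..<3::nat} - {1} = {2, 0}" by auto
        then show ?thesis using 2 by (simp add: numeral_2_eq_2)
      next
        case 3
        have "{..<3::nat} - {2} = {0, 1}" by auto
        then show ?thesis using 3 by simp
      qed
    qed
    have base: "base x < 3 \<and> base (z x) < 3 \<and> (if z x = x then base x = C x else {base x, base (z x)} = {..<3} - {C x})"
      if x: "x \<in> R" for x
      using C3[OF x] notR[OF x] x zz mod3[OF C3[OF x]] by (auto simp: base_def)
    show ?thesis
    proof (cases "z \<omega> = \<omega>")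
      case True
      have "lift C base" using base by (simp add: lift_def)
      moreover have "lift (C(\<omega> := d)) (base(\<omega> := d))"
        unfolding lift_def
      proof
        fix x assume x: "x \<in> R"
        show "(base(\<omega> := d)) x < 3 \<and> (base(\<omega> := d)) (z x) < 3 \<and>
          (if z x = x then (base(\<omega> := d)) x = (C(\<omega> := d)) x
           else {(base(\<omega> := d)) x, (base(\<omega> := d)) (z x)} = {..<3} - {(C(\<omega> := d)) x})"
        proof (cases "x = \<omega>")
          case False
          then have "z x \<noteq> \<omega>" using True zz by metis
          then show ?thesis using False base[OF x] by simp
        qed (use True d3 in simp)
      qed
      moreover have "base \<omega> \<noteq> d" using Cd(1) True by (simp add: base_def)
      ultimately show ?thesis using lift Cd(2,3) by blast
    next
      case False
      \<comment> \<open>With the third colour \<open>t\<close> on \<open>z \<omega>\<close>, the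
        colour \<open>d\<close> at \<open>\<omega>\<close> suits the class colour
        \<open>C \<omega>\<close>, and the colour \<open>C \<omega>\<close> suits the class colour
        \<open>d\<close>. So the lifts of the two class colourings differ at \<open>\<omega>\<close>
        alone.\<close>
      obtain t where t: "t < 3" "t \<noteq> C \<omega>" "t \<noteq> d"
      proof -
        have "card ({..<3::nat} - {C \<omega>, d}) = 1" using C3[OF \<omega>R] d3 Cd(1) by (simp add: card_Diff_subset)
        then show thesis using that by (metis DiffE card_1_singletonE insertCI lessThan_iff singletonI)
      qed
      have three: "{u, t} = {..<3} - {v}" if "u < 3" "v < 3" "u \<noteq> v" "t \<noteq> u" "t \<noteq> v" for u v
        using that t(1) by auto
      define c where "c = base(\<omega> := d, z \<omega> := t)"
      have cc: "c \<omega> = d" "c (z \<omega>) = t" using False by (auto simp: c_def)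
      have other: "c x = base x \<and> c (z x) = base (z x)" if "x \<in> R" "x \<noteq> \<omega>" for x
        using that notR[OF \<omega>R False] zz unfolding c_def by (metis fun_upd_other)
      have "lift C c"
        unfolding lift_def
      proof
        fix x assume x: "x \<in> R"
        show "c x < 3 \<and> c (z x) < 3 \<and> (if z x = x then c x = C x else {c x, c (z x)} = {..<3} - {C x})"
        proof (cases "x = \<omega>")
          case True
          then show ?thesis using False cc d3 t three[of d "C \<omega>"] C3[OF \<omega>R] Cd(1) by auto
        qed (use other x base in simp)
      qed
      moreover have "lift (C(\<omega> := d)) (c(\<omega> := C \<omega>))"
        unfolding lift_def
      proof
        fix x assume x: "x \<in> R"
        show "(c(\<omega> := C \<omega>)) x < 3 \<and> (c(\<omega> := C \<omega>)) (z x) < 3 \<and>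
          (if z x = x then (c(\<omega> := C \<omega>)) x = (C(\<omega> := d)) x
           else {(c(\<omega> := C \<omega>)) x, (c(\<omega> := C \<omega>)) (z x)} = {..<3} - {(C(\<omega> := d)) x})"
        proof (cases "x = \<omega>")
          case True
          then show ?thesis using False cc d3 t three[of "C \<omega>" d] C3[OF \<omega>R] Cd(1) by auto
        next
          case xo: False
          then have "z x \<noteq> \<omega>" using notR[OF x] \<omega>R xo by metis
          then show ?thesis using xo other[OF x xo] base[OF x] by simp
        qed
      qed
      moreover have "c \<omega> \<noteq> C \<omega>" using cc Cd(1) by simp
      ultimately show ?thesis using lift Cd(2,3) by blast
    qed
  qed
qed

section \<open>Coordinates over the field with five elements\<close>

lemma of_int_eq_0_iff_five:
  assumes "CARD('k::comm_ring_1) = 5"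
  shows "(of_int z :: 'k) = 0 \<longleftrightarrow> 5 dvd z"
proof -
  have *: "(of_nat m :: 'k) = 0 \<longleftrightarrow> 5 dvd m" for m
    using of_nat_eq_0_iff_dvd_card[of 5, where 'k='k] assms by simp
  show ?thesis
    by (cases z rule: int_cases2) (auto simp: * int_dvd_int_iff[of 5, simplified])
qed

text \<open>The identification of the type \<open>5\<close> with an abstract field of five elements;
  there the integer chosen does not matter.\<close>

definition five_cast :: "5 \<Rightarrow> 'k::field" where
  "five_cast y = of_int (SOME z. of_int z = y)"

lemma five_cast_of_int:
  assumes "CARD('k::field) = 5"
  shows "(five_cast (of_int z) :: 'k) = of_int z"
proof -
  define z' where "z' = (SOME z'. (of_int z' :: 5) = of_int z)"
  have "(of_int z' :: 5) = of_int z" unfolding z'_def by (rule someI) (rule refl)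
  then have "(of_int (z' - z) :: 5) = 0" by simp
  moreover have "CARD(5) = 5" by simp
  ultimately have "5 dvd z' - z" using of_int_eq_0_iff_five by blast
  then have "(of_int (z' - z) :: 'k) = 0" using of_int_eq_0_iff_five[OF assms] by blast
  then show ?thesis by (simp add: five_cast_def z'_def)
qed

lemma five_cases: obtains z where "(y::5) = of_int z"
  by (cases y) auto

lemma five_cast_hom:
  assumes "CARD('k::field) = 5"
  shows "five_cast (x + y) = (five_cast x + five_cast y :: 'k)"
    "five_cast (x * y) = (five_cast x * five_cast y :: 'k)"
    "five_cast 0 = (0 :: 'k)" "five_cast 1 = (1 :: 'k)"
    "five_cast x = (0 :: 'k) \<longleftrightarrow> x = 0" "surj (five_cast :: 5 \<Rightarrow> 'k)"
proof -
  obtain a b where ab: "x = of_int a" "y = of_int b" using five_cases by metis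
  note c = five_cast_of_int[OF assms]
  show "five_cast (x + y) = (five_cast x + five_cast y :: 'k)"
    using c[of "a + b"] c[of a] c[of b] ab by simp
  show "five_cast (x * y) = (five_cast x * five_cast y :: 'k)"
    using c[of "a * b"] c[of a] c[of b] ab by simp
  show "five_cast 0 = (0 :: 'k)" "five_cast 1 = (1 :: 'k)" using c[of 0] c[of 1] by simp_all
  have z: "five_cast x = (0 :: 'k) \<longleftrightarrow> x = 0" for x
  proof -
    obtain a where a: "x = of_int a" by (rule five_cases)
    show ?thesis using c[of a] of_int_eq_0_iff_five[OF assms, of a] of_int_eq_0_iff_five[where 'k=5, of a] a by simp
  qed
  then show "five_cast x = (0 :: 'k) \<longleftrightarrow> x = 0" .
  have "inj (five_cast :: 5 \<Rightarrow> 'k)"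
  proof (rule injI)
    fix x y assume e: "five_cast x = (five_cast y :: 'k)"
    obtain a b where ab: "x = of_int a" "y = of_int b" using five_cases by metis
    then have "five_cast (of_int (a - b)) = (0 :: 'k)" using c[of "a - b"] c[of a] c[of b] e by simp
    then show "x = y" using z ab by simp
  qed
  then have "card (range (five_cast :: 5 \<Rightarrow> 'k)) = CARD('k)" using assms by (simp add: card_image)
  then show "surj (five_cast :: 5 \<Rightarrow> 'k)"
    using assms by (metis card.infinite card_subset_eq subset_UNIV zero_neq_numeral)
qed

definition pair_comb :: "('k::field \<Rightarrow> 'v::ab_group_add \<Rightarrow> 'v) \<Rightarrow> 5^2 \<Rightarrow> 'v \<times> 'v \<Rightarrow> 'v" where
  "pair_comb smul y f = smul (five_cast (y $ 1)) (fst f) + smul (five_cast (y $ 2)) (snd f)"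

lemma quat_pair_eq_cast:
  fixes smul :: "'k::field \<Rightarrow> 'v::ab_group_add \<Rightarrow> 'v"
  assumes "CARD('k) = 5"
  shows "quat_pair smul q f =
    (smul (five_cast (quat_matrix q $ 1 $ 1)) (fst f) + smul (five_cast (quat_matrix q $ 1 $ 2)) (snd f),
     smul (five_cast (quat_matrix q $ 2 $ 1)) (fst f) + smul (five_cast (quat_matrix q $ 2 $ 2)) (snd f))"
  by (cases q; cases f) (simp only: quat_pair_def quat_matrix_nth five_cast_of_int[OF assms] prod.case fst_conv snd_conv)

context vector_space
begin

lemma quat_pair_mult:
  assumes "CARD('a) = 5"
  shows "quat_pair scale p (quat_pair scale q f) = quat_pair scale (quat_mult p q) f"
  unfolding quat_pair_eq_cast[OF assms] quat_matrix_mult matrix_matrix_mult_def sum_2 vec_lambda_beta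
    five_cast_hom(1,2)[OF assms]
  by (simp add: scale_left_distrib scale_right_distrib ac_simps)

text \<open>Associativity of row times matrix times column.\<close>

lemma pair_comb_quat_pair:
  assumes "CARD('a) = 5"
  shows "pair_comb scale y (quat_pair scale q f) = pair_comb scale (y v* quat_matrix q) f"
  unfolding pair_comb_def quat_pair_eq_cast[OF assms] vector_matrix_mult_def sum_2 vec_lambda_beta
    five_cast_hom(1,2)[OF assms]
  by (simp add: scale_left_distrib scale_right_distrib ac_simps)

lemma pair_comb_add:
  assumes "CARD('a) = 5"
  shows "pair_comb scale (y + z) f = pair_comb scale y f + pair_comb scale z f"
  by (simp add: pair_comb_def five_cast_hom(1)[OF assms] scale_left_distrib ac_simps)

lemma pair_comb_scale:
  assumes "CARD('a) = 5"
  shows "pair_comb scale (c *s y) f = scale (five_cast c) (pair_comb scale y f)"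
  by (simp add: pair_comb_def five_cast_hom(2)[OF assms] scale_right_distrib)

lemma pair_comb_0:
  assumes "CARD('a) = 5"
  shows "pair_comb scale 0 f = 0"
  by (simp add: pair_comb_def five_cast_hom(3)[OF assms])

end

text \<open>Constant on the orbits of \<open>Q8\<close>, of which there are three on the non-zero vectors; each consists of
  the vectors on the two eigenlines of \<open>\<plusminus>i\<close>, of \<open>\<plusminus>j\<close> or of \<open>\<plusminus>k\<close>.\<close>

definition colour :: "5^2 \<Rightarrow> 5" where
  "colour y = (y $ 1 * y $ 2) ^ 2"

lemma sixteen_eq_1: "(16::5) = 1" by simp

lemma colour_quat: "q \<in> carrier Q8 \<Longrightarrow> colour (y v* quat_matrix q) = colour y"
  by (auto simp: Q8_def colour_def vector_matrix_mult_def sum_2 quat_matrix_nth power2_eq_square sixteen_eq_1 ac_simps)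

lemma colour_scale: "colour (2 *s y) = colour y"
proof -
  have "colour (2 *s y) = 16 * colour y" by (simp add: colour_def power2_eq_square)
  then show ?thesis unfolding sixteen_eq_1 by simp
qed

definition quat_axis :: "quat \<Rightarrow> nat" where
  "quat_axis = (\<lambda>(a, b, c, d). if b \<noteq> 0 then 0 else if c \<noteq> 0 then 1 else 2)"

definition imaginary_units :: "quat set" where
  "imaginary_units = {(0,1,0,0), (0,-1,0,0), (0,0,1,0), (0,0,-1,0), (0,0,0,1), (0,0,0,-1)}"

text \<open>The value of \<open>colour\<close> on the eigenlines of the axis: the product of the two
  components is 0 for i, 2 or - 2 for j, and 1 or - 1 for k.\<close>

definition axis_colour :: "nat \<Rightarrow> 5" where
  "axis_colour m = (if m = 0 then 0 else if m = 1 then 4 else 1)"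

lemma inj_on_axis_colour: "inj_on axis_colour {..<3}"
proof (rule inj_onI)
  fix x y assume "x \<in> {..<3::nat}" "y \<in> {..<3}" and e: "axis_colour x = axis_colour y"
  then have "(x = 0 \<or> x = 1 \<or> x = 2) \<and> (y = 0 \<or> y = 1 \<or> y = 2)" by auto
  then show "x = y" using e by (elim conjE disjE) (simp_all add: axis_colour_def)
qed

text \<open>An imaginary unit squares to - 1 and has determinant 1, so its eigenvalues are 2 and -
  2. The six witnesses run through the six lines of the plane.\<close>

lemma quat_eigenvector:
  assumes "q \<in> imaginary_units"
  obtains y where "y \<noteq> 0" "y v* quat_matrix q = 2 *s y" "colour y = axis_colour (quat_axis q)"
proof -
  have "\<exists>a b. vector [a, b] \<noteq> (0 :: 5^2) \<and> vector [a, b] v* quat_matrix q = 2 *s vector [a, b] \<and>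
      colour (vector [a, b]) = axis_colour (quat_axis q)"
  proof -
    note comps = colour_def vec_eq_iff forall_2 vector_matrix_mult_def sum_2 quat_matrix_nth axis_colour_def quat_axis_def
    from assms show ?thesis
      unfolding imaginary_units_def
    proof (elim insertE emptyE, goal_cases)
      case 1 then show ?case by (intro exI[of _ 1] exI[of _ 0]) (simp add: comps)
    next
      case 2 then show ?case by (intro exI[of _ 0] exI[of _ 1]) (simp add: comps)
    next
      case 3 then show ?case by (intro exI[of _ 1] exI[of _ 3]) (simp add: comps)
    next
      case 4 then show ?case by (intro exI[of _ 1] exI[of _ 2]) (simp add: comps)
    next
      case 5 then show ?case by (intro exI[of _ 1] exI[of _ 1]) (simp add: comps)
    next
      case 6 then show ?case by (intro exI[of _ 1] exI[of _ 4]) (simp add: comps)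
    qed
  qed
  then show thesis using that by blast
qed

text \<open>By freeness of \<open>Q8\<close> on non-zero vectors, a coefficient is determined by the
  image of one such vector.\<close>

lemma quat_matrix_cancel:
  assumes q: "q \<in> carrier Q8" "q' \<in> carrier Q8" and y: "y \<noteq> 0" and e: "y v* quat_matrix q = y v* quat_matrix q'"
  shows "q = q'"
proof -
  interpret Q: group Q8 by (rule group_Q8)
  have "y v* quat_matrix (q \<otimes>\<^bsub>Q8\<^esub> inv\<^bsub>Q8\<^esub> q') = y v* quat_matrix q' v* quat_matrix (inv\<^bsub>Q8\<^esub> q')"
    by (simp add: Q8_def quat_matrix_mult e flip: vector_matrix_mul_assoc)
  also have "\<dots> = y v* quat_matrix (q' \<otimes>\<^bsub>Q8\<^esub> inv\<^bsub>Q8\<^esub> q')"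
    by (simp add: Q8_def quat_matrix_mult vector_matrix_mul_assoc)
  also have "\<dots> = y"
    unfolding Q.r_inv[OF q(2)]
    by (simp add: Q8_def quat_matrix_nth vec_eq_iff vector_matrix_mult_def sum_2 forall_2)
  finally have "q \<otimes>\<^bsub>Q8\<^esub> inv\<^bsub>Q8\<^esub> q' = \<one>\<^bsub>Q8\<^esub>"
    using quat_matrix_fixed_point_free[of "q \<otimes>\<^bsub>Q8\<^esub> inv\<^bsub>Q8\<^esub> q'" y] q y by (metis Q.inv_closed Q.m_closed)
  then show ?thesis using q by (metis Q.inv_closed Q.inv_equality Q.inv_inv)
qed

section \<open>Coordinates with respect to a quaternion frame\<close>

locale quat_framed = linear_two_group G smul act UNIV
  for G :: "('g, 'm) monoid_scheme" (structure)
    and smul :: "'k::field \<Rightarrow> 'v::ab_group_add \<Rightarrow> 'v" (infixr \<open>*\<^sub>k\<close> 75)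
    and act :: "'v \<Rightarrow> 'g \<Rightarrow> 'v" +
  fixes n :: nat and f :: "nat \<Rightarrow> 'v \<times> 'v"
  assumes card5: "CARD('k) = 5"
    and card_V: "25 ^ n \<le> CARD('v)"
    and span_V: "UNIV \<subseteq> span (frame_points (f ` {1..n}))"
    and frame: "\<And>j g. j \<in> {1..n} \<Longrightarrow> g \<in> carrier G \<Longrightarrow>
      \<exists>q\<in>carrier Q8. \<exists>i\<in>{1..n}. (act (fst (f j)) g, act (snd (f j)) g) = quat_pair smul q (f i)"
    and faithful: "\<And>g. g \<in> carrier G \<Longrightarrow> \<forall>v. act v g = v \<Longrightarrow> g = \<one>"
    and eig: "eigenvectors_on smul G act UNIV"
begin

definition comb :: "(nat \<Rightarrow> 5^2) \<Rightarrow> 'v" where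
  "comb v = (\<Sum>i\<in>{1..n}. pair_comb smul (v i) (f i))"

definition act_pair :: "'v \<times> 'v \<Rightarrow> 'g \<Rightarrow> 'v \<times> 'v" where
  "act_pair p g = (act (fst p) g, act (snd p) g)"

lemma comb_cong: "(\<And>i. i \<in> {1..n} \<Longrightarrow> v i = w i) \<Longrightarrow> comb v = comb w"
  unfolding comb_def by (rule sum.cong) auto

lemma comb_single:
  assumes "i \<in> {1..n}"
  shows "comb (\<lambda>j. if j = i then y else 0) = pair_comb smul y (f i)"
proof -
  have "comb (\<lambda>j. if j = i then y else 0) = (\<Sum>j\<in>{1..n}. if j = i then pair_comb smul y (f i) else 0)"
    unfolding comb_def by (rule sum.cong) (auto simp: pair_comb_0[OF card5])
  then show ?thesis using assms by simp
qed

lemma comb_add: "comb (\<lambda>i. v i + w i) = comb v + comb w"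
  by (simp add: comb_def pair_comb_add[OF card5] sum.distrib)

lemma comb_scale: "comb (\<lambda>i. c *s v i) = five_cast c *\<^sub>k comb v"
  by (simp add: comb_def pair_comb_scale[OF card5] scale_sum_right)

text \<open>Spanning gives surjectivity; the bound on the size of the space then leaves no room for
  collisions. The domain consists of extensional families so that it can be counted.\<close>

lemma bij_comb: "bij_betw comb ({1..n} \<rightarrow>\<^sub>E UNIV) UNIV"
proof -
  have "subspace (range comb)"
  proof (rule subspaceI)
    have "comb (\<lambda>_. 0) = 0" by (simp add: comb_def pair_comb_0[OF card5])
    then show "0 \<in> range comb" by (metis rangeI)
    show "x + y \<in> range comb" if xy: "x \<in> range comb" "y \<in> range comb" for x y
    proof -
      obtain v w where vw: "x = comb v" "y = comb w" using xy by blast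
      show ?thesis unfolding vw comb_add[symmetric] by (rule rangeI)
    qed
    show "c *\<^sub>k x \<in> range comb" if x: "x \<in> range comb" for c x
    proof -
      obtain c' where "c = five_cast c'" using five_cast_hom(6)[OF card5] by (metis surjD)
      moreover obtain v where "x = comb v" using x by blast
      ultimately have "c *\<^sub>k x = comb (\<lambda>i. c' *s v i)" using comb_scale[of c' v] by simp
      then show ?thesis by simp
    qed
  qed
  moreover have "frame_points (f ` {1..n}) \<subseteq> range comb"
  proof -
    have "fst (f i) \<in> range comb" "snd (f i) \<in> range comb" if i: "i \<in> {1..n}" for i
    proof -
      have "pair_comb smul (vector [1, 0]) (f i) = fst (f i)" "pair_comb smul (vector [0, 1]) (f i) = snd (f i)"
        by (simp_all add: pair_comb_def five_cast_hom(3,4)[OF card5])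
      then have e: "fst (f i) = comb (\<lambda>j. if j = i then vector [1, 0] else 0)" "snd (f i) = comb (\<lambda>j. if j = i then vector [0, 1] else 0)"
        using comb_single[OF i] by simp_all
      show "fst (f i) \<in> range comb" unfolding e(1) by (rule rangeI)
      show "snd (f i) \<in> range comb" unfolding e(2) by (rule rangeI)
    qed
    then show ?thesis by (auto simp: frame_points_def)
  qed
  ultimately have "range comb = UNIV" using span_V span_minimal by blast
  moreover have "comb ` ({1..n} \<rightarrow>\<^sub>E UNIV) = range comb"
  proof
    show "range comb \<subseteq> comb ` ({1..n} \<rightarrow>\<^sub>E UNIV)"
    proof
      fix x assume "x \<in> range comb"
      then obtain v where "x = comb v" by blast
      also have "comb v = comb (restrict v {1..n})" by (rule comb_cong) simp
      finally show "x \<in> comb ` ({1..n} \<rightarrow>\<^sub>E UNIV)" by auto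
    qed
  qed auto
  ultimately have surj: "comb ` ({1..n} \<rightarrow>\<^sub>E UNIV) = UNIV" by simp
  have c: "card ({1..n} \<rightarrow>\<^sub>E (UNIV :: (5^2) set)) = 25 ^ n"
    by (simp add: card_PiE)
  then have fin: "finite ({1..n} \<rightarrow>\<^sub>E (UNIV :: (5^2) set))" by (intro finite_PiE) auto
  have "card (comb ` ({1..n} \<rightarrow>\<^sub>E UNIV)) = card ({1..n} \<rightarrow>\<^sub>E (UNIV :: (5^2) set))"
    using card_V card_image_le[OF fin, of comb] surj c by simp
  then have "inj_on comb ({1..n} \<rightarrow>\<^sub>E UNIV)" using fin by (simp add: inj_on_iff_eq_card)
  with surj show ?thesis by (simp add: bij_betw_def)
qed

lemma comb_eqD:
  assumes "comb v = comb w" "i \<in> {1..n}" shows "v i = w i"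
proof -
  have "comb (restrict v {1..n}) = comb (restrict w {1..n})"
    using assms(1) comb_cong[of v "restrict v {1..n}"] comb_cong[of w "restrict w {1..n}"] by simp
  then have "restrict v {1..n} = restrict w {1..n}"
    using bij_comb by (auto simp: bij_betw_def inj_on_def)
  then show ?thesis using assms(2) by (metis restrict_apply')
qed

lemma card_V_eq: "CARD('v) = 25 ^ n"
  using bij_betw_same_card[OF bij_comb] by (simp add: card_PiE)

lemma quat_pair_one: "quat_pair smul \<one>\<^bsub>Q8\<^esub> p = p"
  by (cases p) (simp add: Q8_def quat_pair_def)

lemma quat_pair_mult_Q8: "quat_pair smul (q \<otimes>\<^bsub>Q8\<^esub> q') p = quat_pair smul q (quat_pair smul q' p)"
  using quat_pair_mult[OF card5] by (simp add: Q8_def)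

lemma act_pair_quat: "act_pair (quat_pair smul q p) g = quat_pair smul q (act_pair p g)" if "g \<in> carrier G"
  using quat_pair_act[of "fst p" "snd p" g q] that by (simp add: act_pair_def)

lemma act_pair_mult: "g \<in> carrier G \<Longrightarrow> h \<in> carrier G \<Longrightarrow> act_pair p (g \<otimes> h) = act_pair (act_pair p g) h"
  by (simp add: act_pair_def act_mult)

lemma act_pair_one: "act_pair p \<one> = p"
  by (simp add: act_pair_def act_one)

lemma act_pair_comb: "g \<in> carrier G \<Longrightarrow> act (pair_comb smul y p) g = pair_comb smul y (act_pair p g)"
  by (simp add: act_pair_def pair_comb_def act_add act_scale)

text \<open>Comparing first components suffices: that of the left side has its only non-zero
  coordinate at \<open>i\<close>, and freeness of \<open>Q8\<close> then recovers
  \<open>q\<close>.\<close>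

lemma quat_frame_unique:
  assumes "i \<in> {1..n}" "i' \<in> {1..n}" "q \<in> carrier Q8" "q' \<in> carrier Q8"
    "quat_pair smul q (f i) = quat_pair smul q' (f i')"
  shows "i = i' \<and> q = q'"
proof -
  interpret Q: group Q8 by (rule group_Q8)
  define y :: "5^2" where "y = vector [1, 0]"
  have y0: "y \<noteq> 0" by (simp add: y_def vec_eq_iff forall_2)
  have "pair_comb smul (y v* quat_matrix q) (f i) = pair_comb smul (y v* quat_matrix q') (f i')"
    using assms(5) by (simp flip: pair_comb_quat_pair[OF card5])
  then have e: "comb (\<lambda>j. if j = i then y v* quat_matrix q else 0) = comb (\<lambda>j. if j = i' then y v* quat_matrix q' else 0)"
    using comb_single assms(1,2) by simp
  have nz: "y v* quat_matrix q \<noteq> 0"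
  proof
    assume z: "y v* quat_matrix q = 0"
    have "y v* quat_matrix (q \<otimes>\<^bsub>Q8\<^esub> inv\<^bsub>Q8\<^esub> q) = y v* quat_matrix q v* quat_matrix (inv\<^bsub>Q8\<^esub> q)"
      by (simp add: Q8_def quat_matrix_mult vector_matrix_mul_assoc)
    also have "\<dots> = 0" unfolding z by (simp add: vector_matrix_mult_def vec_eq_iff)
    finally have "y v* quat_matrix (1,0,0,0) = 0" unfolding Q.r_inv[OF assms(3)] by (simp add: Q8_def)
    then have "y = 0" by (simp add: quat_matrix_nth vec_eq_iff vector_matrix_mult_def sum_2 forall_2)
    with y0 show False ..
  qed
  have "i = i'"
    using comb_eqD[OF e assms(1)] nz by (auto split: if_splits)
  moreover have "y v* quat_matrix q = y v* quat_matrix q'"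
    using comb_eqD[OF e assms(1)] \<open>i = i'\<close> by simp
  then have "q = q'" using quat_matrix_cancel[OF assms(3,4) y0] by simp
  ultimately show ?thesis ..
qed

text \<open>\<open>j\<close> is the pair from which \<open>g\<close> arrives at \<open>i\<close>.
  With this direction the coordinate at \<open>i\<close> after \<open>g\<close> comes from position
  \<open>j\<close>, as in \<open>permute_coords\<close>, and composition of permutations follows the
  product in \<open>G\<close>.\<close>

definition moves :: "'g \<Rightarrow> nat \<Rightarrow> nat \<Rightarrow> quat \<Rightarrow> bool" where
  "moves g i j q \<longleftrightarrow> j \<in> {1..n} \<and> q \<in> carrier Q8 \<and> act_pair (f j) g = quat_pair smul q (f i)"

text \<open>The frame property tells where a pair goes, whereas the source of pair \<open>i\<close>
  is wanted; so it is applied to \<open>inv g\<close>.\<close>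

lemma moves_ex1:
  assumes g: "g \<in> carrier G" and i: "i \<in> {1..n}"
  shows "\<exists>!p. moves g i (fst p) (snd p)"
proof -
  interpret Q: group Q8 by (rule group_Q8)
  obtain q j where q: "q \<in> carrier Q8" "j \<in> {1..n}" "act_pair (f i) (inv g) = quat_pair smul q (f j)"
    using frame[OF i, of "inv g"] g by (auto simp: act_pair_def)
  have "quat_pair smul q (act_pair (f j) g) = act_pair (act_pair (f i) (inv g)) g"
    using act_pair_quat[OF g] q(3) by simp
  also have "\<dots> = f i" using act_pair_mult[of "inv g" g "f i"] act_pair_one g by simp
  finally have "quat_pair smul (inv\<^bsub>Q8\<^esub> q) (quat_pair smul q (act_pair (f j) g)) = quat_pair smul (inv\<^bsub>Q8\<^esub> q) (f i)" by simp
  then have "act_pair (f j) g = quat_pair smul (inv\<^bsub>Q8\<^esub> q) (f i)"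
    using q(1) by (simp add: quat_pair_one flip: quat_pair_mult_Q8)
  then have 1: "moves g i j (inv\<^bsub>Q8\<^esub> q)" using q by (simp add: moves_def)
  have 2: "j' = j \<and> q' = inv\<^bsub>Q8\<^esub> q" if m: "moves g i j' q'" for j' q'
  proof -
    have m': "j' \<in> {1..n}" "q' \<in> carrier Q8" "act_pair (f j') g = quat_pair smul q' (f i)" using m by (auto simp: moves_def)
    have "f j' = act_pair (act_pair (f j') g) (inv g)" using act_pair_mult[of g "inv g" "f j'"] act_pair_one g by simp
    also have "\<dots> = quat_pair smul (q' \<otimes>\<^bsub>Q8\<^esub> q) (f j)" using m'(3) act_pair_quat[of "inv g"] q(3) g by (simp add: quat_pair_mult_Q8)
    finally have "quat_pair smul \<one>\<^bsub>Q8\<^esub> (f j') = quat_pair smul (q' \<otimes>\<^bsub>Q8\<^esub> q) (f j)" by (simp add: quat_pair_one)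
    then have "j' = j \<and> \<one>\<^bsub>Q8\<^esub> = q' \<otimes>\<^bsub>Q8\<^esub> q" using quat_frame_unique[OF m'(1) q(2) Q.one_closed Q.m_closed[OF m'(2) q(1)]] by blast
    then show ?thesis using Q.inv_equality[of q' q] m'(2) q(1) by simp
  qed
  show ?thesis
  proof (rule ex1I[of _ "(j, inv\<^bsub>Q8\<^esub> q)"])
    show "moves g i (fst (j, inv\<^bsub>Q8\<^esub> q)) (snd (j, inv\<^bsub>Q8\<^esub> q))" using 1 by simp
    show "p = (j, inv\<^bsub>Q8\<^esub> q)" if "moves g i (fst p) (snd p)" for p
      using 2[OF that] by (simp add: prod_eq_iff)
  qed
qed

text \<open>Extended by the identity beyond the index set, as membership in \<open>sym_group\<close>
  requires.\<close>

definition perm_of :: "'g \<Rightarrow> nat \<Rightarrow> nat" where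
  "perm_of g i = (if i \<in> {1..n} then fst (THE p. moves g i (fst p) (snd p)) else i)"

definition coeff_of :: "'g \<Rightarrow> nat \<Rightarrow> quat" where
  "coeff_of g i = snd (THE p. moves g i (fst p) (snd p))"

lemma moves_of:
  assumes "g \<in> carrier G" "i \<in> {1..n}"
  shows "perm_of g i \<in> {1..n}" "coeff_of g i \<in> carrier Q8"
    "act_pair (f (perm_of g i)) g = quat_pair smul (coeff_of g i) (f i)"
  using theI'[OF moves_ex1[OF assms]] assms(2) by (auto simp: moves_def perm_of_def coeff_of_def)

lemma moves_eqI:
  assumes "g \<in> carrier G" "i \<in> {1..n}" "j \<in> {1..n}" "q \<in> carrier Q8" "act_pair (f j) g = quat_pair smul q (f i)"
  shows "perm_of g i = j \<and> coeff_of g i = q"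
proof -
  have "(THE p. moves g i (fst p) (snd p)) = (j, q)"
    by (rule the1_equality[OF moves_ex1[OF assms(1,2)]]) (use assms in \<open>simp add: moves_def\<close>)
  then show ?thesis using assms(2) by (simp add: perm_of_def coeff_of_def)
qed

lemma perm_of_permutes:
  assumes g: "g \<in> carrier G" shows "perm_of g permutes {1..n}"
proof (rule bij_imp_permutes)
  have "inj_on (perm_of g) {1..n}"
  proof (rule inj_onI)
    fix i i' assume i: "i \<in> {1..n}" "i' \<in> {1..n}" "perm_of g i = perm_of g i'"
    then have "quat_pair smul (coeff_of g i) (f i) = quat_pair smul (coeff_of g i') (f i')"
      using moves_of(3)[OF g] by metis
    then show "i = i'" using quat_frame_unique i moves_of(2)[OF g] by blast
  qed
  moreover have "perm_of g ` {1..n} \<subseteq> {1..n}" using moves_of(1)[OF g] by blast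
  ultimately show "bij_betw (perm_of g) {1..n} {1..n}"
    by (metis bij_betw_def endo_inj_surj finite_atLeastAtMost)
qed (auto simp: perm_of_def)

lemma moves_of_mult:
  assumes g: "g \<in> carrier G" and h: "h \<in> carrier G" and i: "i \<in> {1..n}"
  shows "perm_of (g \<otimes> h) i = perm_of g (perm_of h i) \<and>
    coeff_of (g \<otimes> h) i = coeff_of g (perm_of h i) \<otimes>\<^bsub>Q8\<^esub> coeff_of h i"
proof (rule moves_eqI)
  note j = moves_of[OF h i]
  note l = moves_of[OF g j(1)]
  show "act_pair (f (perm_of g (perm_of h i))) (g \<otimes> h) =
      quat_pair smul (coeff_of g (perm_of h i) \<otimes>\<^bsub>Q8\<^esub> coeff_of h i) (f i)"
    using g h j l by (simp add: act_pair_mult act_pair_quat quat_pair_mult_Q8)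
  show "coeff_of g (perm_of h i) \<otimes>\<^bsub>Q8\<^esub> coeff_of h i \<in> carrier Q8"
    using j l group.is_monoid[OF group_Q8] by (simp add: monoid.m_closed)
qed (use g h i moves_of in auto)

lemma perm_of_mult:
  assumes "g \<in> carrier G" "h \<in> carrier G"
  shows "perm_of (g \<otimes> h) = perm_of g \<circ> perm_of h"
proof
  fix i show "perm_of (g \<otimes> h) i = (perm_of g \<circ> perm_of h) i"
    using moves_of_mult[OF assms] by (cases "i \<in> {1..n}") (auto simp: perm_of_def)
qed

lemma act_comb:
  assumes g: "g \<in> carrier G"
  shows "act (comb v) g = comb (\<lambda>i. v (perm_of g i) v* quat_matrix (coeff_of g i))"
proof -
  have sum: "act (\<Sum>i\<in>A. w i) g = (\<Sum>i\<in>A. act (w i) g)" if "finite A" for A and w :: "nat \<Rightarrow> 'v"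
    using that by induction (simp_all add: act_zero[OF g] act_add g)
  have "act (comb v) g = (\<Sum>j\<in>{1..n}. pair_comb smul (v j) (act_pair (f j) g))"
    unfolding comb_def by (simp add: sum act_pair_comb g)
  also have "\<dots> = (\<Sum>i\<in>{1..n}. pair_comb smul (v (perm_of g i)) (act_pair (f (perm_of g i)) g))"
    by (rule sum.permute[OF perm_of_permutes[OF g], unfolded comp_def])
  also have "\<dots> = comb (\<lambda>i. v (perm_of g i) v* quat_matrix (coeff_of g i))"
    unfolding comb_def by (rule sum.cong) (simp_all add: moves_of(3)[OF g] pair_comb_quat_pair[OF card5])
  finally show ?thesis .
qed

lemma moves_inject:
  assumes g: "g \<in> carrier G" and h: "h \<in> carrier G"
    and e: "\<And>i. i \<in> {1..n} \<Longrightarrow> perm_of g i = perm_of h i \<and> coeff_of g i = coeff_of h i"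
  shows "g = h"
proof -
  have eq: "act v g = act v h" for v
  proof -
    obtain x where "v = comb x" using bij_comb by (auto simp: bij_betw_def)
    then show ?thesis using g h e by (auto simp: act_comb intro!: comb_cong)
  qed
  have "act v (g \<otimes> inv h) = v" for v using eq g h act_inv_right[of v h] by (simp add: act_mult)
  then have "g \<otimes> inv h = \<one>" using faithful g h by simp
  then show ?thesis using g h by (metis inv_closed inv_equality inv_inv)
qed

lemma moves_one: "i \<in> {1..n} \<Longrightarrow> perm_of \<one> i = i \<and> coeff_of \<one> i = \<one>\<^bsub>Q8\<^esub>"
  by (rule moves_eqI) (auto simp: act_pair_one quat_pair_one group.is_monoid[OF group_Q8] monoid.one_closed)

lemma perm_of_one: "perm_of \<one> = id"
proof
  fix i show "perm_of \<one> i = id i" using moves_one by (cases "i \<in> {1..n}") (auto simp: perm_of_def)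
qed

abbreviation "perms \<equiv> perm_of ` carrier G"

lemma group_hom_perm_of: "group_hom G (sym_group n) perm_of"
  using perm_of_permutes perm_of_mult
  by (auto simp: group_hom_def group_hom_axioms_def is_group sym_group_is_group hom_def sym_group_carrier sym_group_mult)

lemma perms_subgroup: "subgroup perms (sym_group n)"
  by (rule group_hom.img_is_subgroup[OF group_hom_perm_of])

lemma perms_two_group: "two_group ((sym_group n)\<lparr>carrier := perms\<rparr>)"
proof -
  have gr: "group ((sym_group n)\<lparr>carrier := perms\<rparr>)"
    by (rule subgroup.subgroup_is_group[OF perms_subgroup sym_group_is_group])
  then have "group_hom G ((sym_group n)\<lparr>carrier := perms\<rparr>) perm_of"
    using perm_of_mult by (auto simp: group_hom_def group_hom_axioms_def is_group hom_def sym_group_def)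
  then have "order ((sym_group n)\<lparr>carrier := perms\<rparr>) dvd order G"
    by (rule group_hom.order_dvd_if_surj) simp
  moreover obtain k where "order G = 2 ^ k" using two_power_order by blast
  ultimately have "order ((sym_group n)\<lparr>carrier := perms\<rparr>) dvd 2 ^ k" by simp
  then show ?thesis using gr divides_primepow_nat[OF two_is_prime_nat] unfolding two_group_def by blast
qed

end

section \<open>The base group\<close>

lemma imaginary_units_axis:
  assumes "q \<in> imaginary_units" shows "q \<in> carrier Q8" "quat_axis q < 3"
  using assms by (auto simp: imaginary_units_def Q8_def quat_axis_def)

definition axis_unit :: "nat \<Rightarrow> quat" where
  "axis_unit m = (if m = 0 then (0,1,0,0) else if m = 1 then (0,0,1,0) else (0,0,0,1))"

lemma axis_unit:
  assumes "m < 3" shows "axis_unit m \<in> imaginary_units" "quat_axis (axis_unit m) = m"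
  using assms by (auto simp: axis_unit_def imaginary_units_def quat_axis_def)

text \<open>For any axis \<open>a\<close> other than that of \<open>t\<close> the product lies on
  the third axis. The two axes have to differ because they will be the two colours of one
  coordinate.\<close>

lemma imaginary_unit_quotient:
  assumes "t \<in> imaginary_units"
  obtains a r where "a < 3" "r \<in> imaginary_units" "quat_axis r \<noteq> a" "r = axis_unit a \<otimes>\<^bsub>Q8\<^esub> t"
proof -
  define a where "a = (if quat_axis t = 0 then 1 else 0 :: nat)"
  have "a < 3 \<and> axis_unit a \<otimes>\<^bsub>Q8\<^esub> t \<in> imaginary_units \<and> quat_axis (axis_unit a \<otimes>\<^bsub>Q8\<^esub> t) \<noteq> a"
    using assms by (auto simp: a_def axis_unit_def imaginary_units_def quat_axis_def Q8_def)
  then show thesis using that by blast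
qed

text \<open>Closure under products is enough: - 1 is i times i, and 1 is i times - i.\<close>

lemma quat_generated:
  assumes imag: "\<And>t. t \<in> imaginary_units \<Longrightarrow> P t"
    and mult: "\<And>s t. s \<in> carrier Q8 \<Longrightarrow> t \<in> carrier Q8 \<Longrightarrow> P s \<Longrightarrow> P t \<Longrightarrow> P (s \<otimes>\<^bsub>Q8\<^esub> t)"
    and q: "q \<in> carrier Q8"
  shows "P q"
proof -
  have i: "(0,1,0,0) \<in> imaginary_units" and i': "(0,-1,0,0) \<in> imaginary_units" by (auto simp: imaginary_units_def)
  have "P ((0,1,0,0) \<otimes>\<^bsub>Q8\<^esub> (0,1,0,0))"
    by (rule mult) (use i imag imaginary_units_axis in auto)
  then have "P (-1,0,0,0)" by (simp add: Q8_def)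
  moreover have "P ((0,1,0,0) \<otimes>\<^bsub>Q8\<^esub> (0,-1,0,0))"
    by (rule mult) (use i i' imag imaginary_units_axis in auto)
  then have "P (1,0,0,0)" by (simp add: Q8_def)
  moreover have "q = (1,0,0,0) \<or> q = (-1,0,0,0) \<or> q \<in> imaginary_units"
    using q by (auto simp: Q8_def imaginary_units_def)
  ultimately show ?thesis using imag by blast
qed

lemma ex_permutation_mapping_two:
  assumes "a \<noteq> d" "a' \<noteq> d'" "a < 3" "d < 3" "a' < 3" "d' < (3::nat)"
  obtains \<pi> where "\<pi> permutes {..<3}" "\<pi> a = a'" "\<pi> d = d'"
proof -
  let ?t = "Transposition.transpose a a'" and ?u = "Transposition.transpose (Transposition.transpose a a' d) d'"
  have "?t permutes {..<3}" using assms by (intro permutes_swap_id) auto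
  moreover from this have "?t d < 3" using permutes_in_image[of ?t "{..<3}" d] assms by simp
  then have "?u permutes {..<3}" using assms by (intro permutes_swap_id) auto
  ultimately have "(?u \<circ> ?t) permutes {..<3}" by (rule permutes_compose)
  moreover have "?t d \<noteq> a'" using assms(1) by (metis transpose_apply_first transpose_eq_iff)
  then have "(?u \<circ> ?t) a = a'" "(?u \<circ> ?t) d = d'" using assms(2) by (auto simp: transpose_apply_other)
  ultimately show thesis by (rule that)
qed

context quat_framed
begin

lemma perms_permutation_group: "permutation_group perms {1..n}"
proof -
  have "group ((sym_group n)\<lparr>carrier := perms\<rparr>)"
    by (rule subgroup.subgroup_is_group[OF perms_subgroup sym_group_is_group])
  then show ?thesis using perm_of_permutes by (auto simp: permutation_group_def sym_group_def)
qed

definition in_base :: "(nat \<Rightarrow> quat) \<Rightarrow> bool" where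
  "in_base x \<longleftrightarrow> (\<exists>g\<in>carrier G. perm_of g = id \<and> (\<forall>i\<in>{1..n}. coeff_of g i = x i))"

text \<open>An eigenvector for the eigenvalue 2 all of whose components lie on eigenlines of imaginary
  units, coloured asymmetrically, forces its eigenvalue to be taken on the base group.\<close>

lemma in_base_colouring:
  assumes c: "asymmetric_colouring perms {1..n} c"
    and q: "\<And>i. i \<in> {1..n} \<Longrightarrow> q i \<in> imaginary_units \<and> quat_axis (q i) = c i"
  shows "in_base q"
proof -
  have "\<forall>i\<in>{1..n}. \<exists>y. y \<noteq> 0 \<and> y v* quat_matrix (q i) = 2 *s y \<and> colour y = axis_colour (c i)"
    using q quat_eigenvector by metis
  then obtain v where v: "\<And>i. i \<in> {1..n} \<Longrightarrow> v i \<noteq> 0 \<and> v i v* quat_matrix (q i) = 2 *s v i \<and> colour (v i) = axis_colour (c i)"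
    by metis
  have two: "five_cast 2 = (2::'k)" using five_cast_of_int[OF card5, of 2] by simp
  have "(2::'k) \<noteq> 0" using two five_cast_hom(5)[OF card5, of 2] by simp
  then obtain g where g: "g \<in> carrier G" "act (comb v) g = 2 *\<^sub>k comb v"
    using eig by (auto simp: eigenvectors_on_def)
  then have "comb (\<lambda>i. v (perm_of g i) v* quat_matrix (coeff_of g i)) = comb (\<lambda>i. 2 *s v i)"
    using act_comb[OF g(1)] comb_scale[of 2 v] two by simp
  then have e: "v (perm_of g i) v* quat_matrix (coeff_of g i) = 2 *s v i" if "i \<in> {1..n}" for i
    using comb_eqD that by blast
  \<comment> \<open>Neither a quaternion coefficient nor doubling changes \<open>colour\<close>, so
    equation \<open>e\<close> makes the permutation of \<open>g\<close> preserve
    \<open>c\<close>.\<close>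
  have "c (perm_of g i) = c i" if i: "i \<in> {1..n}" for i
  proof -
    have "axis_colour (c (perm_of g i)) = axis_colour (c i)"
      using arg_cong[OF e[OF i], of colour] colour_quat[OF moves_of(2)[OF g(1) i]] v[OF i] v[OF moves_of(1)[OF g(1) i]]
      by (simp add: colour_scale)
    moreover have "c i < 3" "c (perm_of g i) < 3" using c i moves_of(1)[OF g(1) i] by (auto simp: asymmetric_colouring_def)
    ultimately show ?thesis using inj_on_axis_colour by (auto simp: inj_on_def)
  qed
  then have id: "perm_of g = id" using c g(1) by (auto simp: asymmetric_colouring_def)
  have "coeff_of g i = q i" if i: "i \<in> {1..n}" for i
  proof (rule quat_matrix_cancel)
    show "coeff_of g i \<in> carrier Q8" using moves_of(2)[OF g(1) i] .
    show "q i \<in> carrier Q8" using q[OF i] imaginary_units_axis by blast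
    show "v i \<noteq> 0" using v[OF i] by blast
    show "v i v* quat_matrix (coeff_of g i) = v i v* quat_matrix (q i)" using e[OF i] v[OF i] id by simp
  qed
  then show ?thesis using g(1) id by (auto simp: in_base_def)
qed

lemma in_base_mult:
  assumes "in_base x" "in_base y"
  shows "in_base (\<lambda>i. x i \<otimes>\<^bsub>Q8\<^esub> y i)"
proof -
  obtain g h where g: "g \<in> carrier G" "perm_of g = id" "\<And>i. i \<in> {1..n} \<Longrightarrow> coeff_of g i = x i"
    and h: "h \<in> carrier G" "perm_of h = id" "\<And>i. i \<in> {1..n} \<Longrightarrow> coeff_of h i = y i"
    using assms by (auto simp: in_base_def)
  show ?thesis
    unfolding in_base_def
    using perm_of_mult[OF g(1) h(1)] moves_of_mult[OF g(1) h(1)] g h by (intro bexI[of _ "g \<otimes> h"]) auto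
qed

lemma in_base_quotient:
  assumes "in_base x" "in_base (\<lambda>i. x i \<otimes>\<^bsub>Q8\<^esub> y i)" "\<And>i. i \<in> {1..n} \<Longrightarrow> y i \<in> carrier Q8"
  shows "in_base y"
proof -
  interpret Q: group Q8 by (rule group_Q8)
  obtain g h where g: "g \<in> carrier G" "perm_of g = id" "\<And>i. i \<in> {1..n} \<Longrightarrow> coeff_of g i = x i"
    and h: "h \<in> carrier G" "perm_of h = id" "\<And>i. i \<in> {1..n} \<Longrightarrow> coeff_of h i = x i \<otimes>\<^bsub>Q8\<^esub> y i"
    using assms(1,2) by (auto simp: in_base_def)
  define d where "d = inv g \<otimes> h"
  have d: "d \<in> carrier G" "g \<otimes> d = h" using g(1) h(1) by (auto simp: d_def cancel_inv_left)
  then have pd: "perm_of d = id" using perm_of_mult[OF g(1) d(1)] g(2) h(2) by simp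
  have "coeff_of d i = y i" if i: "i \<in> {1..n}" for i
  proof -
    have "x i \<otimes>\<^bsub>Q8\<^esub> coeff_of d i = x i \<otimes>\<^bsub>Q8\<^esub> y i"
      using moves_of_mult[OF g(1) d(1) i] d(2) pd g(3) h(3) i by simp
    moreover have "x i \<in> carrier Q8" using moves_of(2)[OF g(1) i] g(3)[OF i] by simp
    ultimately show ?thesis using moves_of(2)[OF d(1) i] assms(3)[OF i] Q.l_cancel by blast
  qed
  then show ?thesis using d(1) pd by (auto simp: in_base_def)
qed

lemma in_base_one: "in_base (\<lambda>i. \<one>\<^bsub>Q8\<^esub>)"
  using moves_one perm_of_one by (auto simp: in_base_def intro!: bexI[of _ "\<one>"])

lemma in_base_cong: "in_base x \<Longrightarrow> (\<And>i. i \<in> {1..n} \<Longrightarrow> x i = y i) \<Longrightarrow> in_base y"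
  by (auto simp: in_base_def)

text \<open>Two elements of the base group with equal coefficients away from \<open>\<omega>\<close>
  have a quotient concentrated at \<open>\<omega>\<close>. They are obtained from two colourings
  that differ only there.\<close>

lemma in_base_single:
  assumes \<omega>: "\<omega> \<in> {1..n}" and t: "t \<in> carrier Q8"
  shows "in_base (\<lambda>i. if i = \<omega> then t else \<one>\<^bsub>Q8\<^esub>)"
proof -
  interpret Q: group Q8 by (rule group_Q8)
  obtain k where "card perms = 2 ^ k"
    using perms_two_group by (auto simp: two_group_def order_def)
  then obtain c d where cd: "c \<omega> \<noteq> d" "asymmetric_colouring perms {1..n} c" "asymmetric_colouring perms {1..n} (c(\<omega> := d))"
    using distinguishing_colourings[OF _ perms_permutation_group _ \<omega>] by blast
  have c3: "c \<omega> < 3" and d3: "d < 3"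
    using cd(2,3) \<omega> unfolding asymmetric_colouring_def by (blast, metis fun_upd_same)
  have transfer: "asymmetric_colouring perms {1..n} (\<lambda>i. \<pi> (e i))"
    if pi: "\<pi> permutes {..<3}" and e: "asymmetric_colouring perms {1..n} e" for \<pi> e
  proof -
    have "\<pi> x < 3 \<longleftrightarrow> x < 3" for x using permutes_in_image[OF pi, of x] by simp
    moreover have "\<pi> x = \<pi> y \<longleftrightarrow> x = y" for x y using permutes_inj[OF pi] by (auto simp: inj_def)
    ultimately show ?thesis using e by (simp add: asymmetric_colouring_def)
  qed
  show ?thesis
  proof (rule quat_generated[where P = "\<lambda>t. in_base (\<lambda>i. if i = \<omega> then t else \<one>\<^bsub>Q8\<^esub>)", OF _ _ t])
    fix t assume t: "t \<in> imaginary_units"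
    obtain a r where ar: "a < 3" "r \<in> imaginary_units" "quat_axis r \<noteq> a" "r = axis_unit a \<otimes>\<^bsub>Q8\<^esub> t"
      using imaginary_unit_quotient[OF t] by blast
    \<comment> \<open>Renaming colours by \<open>\<pi>\<close> puts \<open>axis_unit a\<close> at
      \<open>\<omega>\<close> for the first colouring and \<open>r\<close> for the second; the
      coefficient of the quotient at \<open>\<omega>\<close> is then \<open>t\<close>.\<close>
    obtain \<pi> where pi: "\<pi> permutes {..<3}" "\<pi> (c \<omega>) = a" "\<pi> d = quat_axis r"
      using ex_permutation_mapping_two[OF cd(1) ar(3)[symmetric] c3 d3 ar(1) imaginary_units_axis(2)[OF ar(2)]] by blast
    define x where "x = (\<lambda>i. axis_unit (\<pi> (c i)))"
    have pc: "\<pi> (c i) < 3" if "i \<in> {1..n}" for i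
      using transfer[OF pi(1) cd(2)] that by (simp add: asymmetric_colouring_def)
    have "in_base x"
      by (rule in_base_colouring[OF transfer[OF pi(1) cd(2)]]) (simp add: x_def axis_unit pc)
    moreover have "in_base (\<lambda>i. if i = \<omega> then r else x i)"
      by (rule in_base_colouring[OF transfer[OF pi(1) cd(3)]]) (simp add: x_def axis_unit pc pi ar(2))
    then have "in_base (\<lambda>i. x i \<otimes>\<^bsub>Q8\<^esub> (if i = \<omega> then t else \<one>\<^bsub>Q8\<^esub>))"
      by (rule in_base_cong) (use pi ar(4) axis_unit(1)[OF pc] imaginary_units_axis(1) in \<open>auto simp: x_def\<close>)
    ultimately show "in_base (\<lambda>i. if i = \<omega> then t else \<one>\<^bsub>Q8\<^esub>)"
      by (rule in_base_quotient) (use imaginary_units_axis(1)[OF t] in auto)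
  next
    fix s t assume "s \<in> carrier Q8" "t \<in> carrier Q8" and
      st: "in_base (\<lambda>i. if i = \<omega> then s else \<one>\<^bsub>Q8\<^esub>)" "in_base (\<lambda>i. if i = \<omega> then t else \<one>\<^bsub>Q8\<^esub>)"
    show "in_base (\<lambda>i. if i = \<omega> then s \<otimes>\<^bsub>Q8\<^esub> t else \<one>\<^bsub>Q8\<^esub>)"
      by (rule in_base_cong[OF in_base_mult[OF st]]) auto
  qed
qed

lemma in_base_all:
  assumes "\<And>i. i \<in> {1..n} \<Longrightarrow> x i \<in> carrier Q8"
  shows "in_base x"
proof -
  interpret Q: group Q8 by (rule group_Q8)
  have "in_base (\<lambda>i. if i \<in> J then x i else \<one>\<^bsub>Q8\<^esub>)" if "finite J" "J \<subseteq> {1..n}" for J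
    using that
  proof induction
    case empty
    show ?case using in_base_one by simp
  next
    case (insert j J)
    have b: "in_base (\<lambda>i. if i \<in> J then x i else \<one>\<^bsub>Q8\<^esub>)" using insert by auto
    have j: "j \<in> {1..n}" using insert by blast
    show ?case
      by (rule in_base_cong[OF in_base_mult[OF b in_base_single[OF j assms[OF j]]]])
        (use assms insert.hyps in auto)
  qed
  from this[of "{1..n}"] show ?thesis by (auto elim: in_base_cong)
qed

text \<open>Any element with the right permutation is corrected by an element of the base
  group.\<close>

lemma ex_moves:
  assumes "\<sigma> \<in> perms" "\<And>i. i \<in> {1..n} \<Longrightarrow> x i \<in> carrier Q8"
  obtains g where "g \<in> carrier G" "perm_of g = \<sigma>" "\<And>i. i \<in> {1..n} \<Longrightarrow> coeff_of g i = x i"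
proof -
  interpret Q: group Q8 by (rule group_Q8)
  obtain h where h: "h \<in> carrier G" "perm_of h = \<sigma>" using assms(1) by blast
  have "in_base (\<lambda>i. inv\<^bsub>Q8\<^esub> (coeff_of h i) \<otimes>\<^bsub>Q8\<^esub> x i)"
    by (rule in_base_all) (use assms(2) moves_of(2)[OF h(1)] in auto)
  then obtain b where b: "b \<in> carrier G" "perm_of b = id"
    "\<And>i. i \<in> {1..n} \<Longrightarrow> coeff_of b i = inv\<^bsub>Q8\<^esub> (coeff_of h i) \<otimes>\<^bsub>Q8\<^esub> x i" by (auto simp: in_base_def)
  show thesis
  proof (rule that[of "h \<otimes> b"])
    show "h \<otimes> b \<in> carrier G" using h b by simp
    show "perm_of (h \<otimes> b) = \<sigma>" using perm_of_mult[OF h(1) b(1)] h(2) b(2) by simp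
    show "coeff_of (h \<otimes> b) i = x i" if i: "i \<in> {1..n}" for i
      using moves_of_mult[OF h(1) b(1) i] b(2,3) i moves_of(2)[OF h(1) i] assms(2)[OF i] by (simp add: Q.cancel_inv_left)
  qed
qed

section \<open>Isomorphisms onto the wreath products\<close>

lemma carrier_wreath: "carrier (wreath H n K) = ({1..n} \<rightarrow>\<^sub>E carrier H) \<times> K"
  by (simp add: wreath_def semidirect_def)

lemma mult_wreath:
  assumes "\<And>i. i \<in> {1..n} \<Longrightarrow> \<tau> i \<in> {1..n}"
  shows "(x, \<sigma>) \<otimes>\<^bsub>wreath H n K\<^esub> (y, \<tau>) = (\<lambda>i\<in>{1..n}. x (\<tau> i) \<otimes>\<^bsub>H\<^esub> y i, \<sigma> \<circ> \<tau>)"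
  by (auto simp: wreath_def semidirect_def product_group_def permute_coords_def sym_group_def fun_eq_iff)

text \<open>Shared by \<open>G\<close> and by the semidirect product: both have the same permutation
  part and differ only in what \<open>a\<close> records at each coordinate.\<close>

lemma iso_wreathI:
  assumes a: "\<And>s i. s \<in> carrier S \<Longrightarrow> i \<in> {1..n} \<Longrightarrow> a s i \<in> carrier H"
    and \<sigma>: "\<And>s. s \<in> carrier S \<Longrightarrow> \<sigma> s \<in> perms"
    and mult: "\<And>s t. s \<in> carrier S \<Longrightarrow> t \<in> carrier S \<Longrightarrow> \<sigma> (s \<otimes>\<^bsub>S\<^esub> t) = \<sigma> s \<circ> \<sigma> t \<and>
      (\<forall>i\<in>{1..n}. a (s \<otimes>\<^bsub>S\<^esub> t) i = a s (\<sigma> t i) \<otimes>\<^bsub>H\<^esub> a t i)"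
    and inj: "\<And>s t. s \<in> carrier S \<Longrightarrow> t \<in> carrier S \<Longrightarrow> \<sigma> s = \<sigma> t \<Longrightarrow>
      (\<And>i. i \<in> {1..n} \<Longrightarrow> a s i = a t i) \<Longrightarrow> s = t"
    and surj: "\<And>x \<tau>. (\<And>i. i \<in> {1..n} \<Longrightarrow> x i \<in> carrier H) \<Longrightarrow> \<tau> \<in> perms \<Longrightarrow>
      \<exists>s\<in>carrier S. \<sigma> s = \<tau> \<and> (\<forall>i\<in>{1..n}. a s i = x i)"
  shows "S \<cong> wreath H n perms"
proof -
  define \<psi> where "\<psi> s = (\<lambda>i\<in>{1..n}. a s i, \<sigma> s)" for s
  have closed: "\<psi> s \<in> carrier (wreath H n perms)" if "s \<in> carrier S" for s
    using a \<sigma> that by (simp add: \<psi>_def carrier_wreath)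
  have "\<psi> \<in> hom S (wreath H n perms)"
  proof (rule homI)
    fix s t assume s: "s \<in> carrier S" and t: "t \<in> carrier S"
    have st: "\<sigma> t i \<in> {1..n}" if "i \<in> {1..n}" for i using \<sigma>[OF t] moves_of(1) that by auto
    have mw: "(x, \<sigma> s) \<otimes>\<^bsub>wreath H n perms\<^esub> (y, \<sigma> t) = (\<lambda>i\<in>{1..n}. x (\<sigma> t i) \<otimes>\<^bsub>H\<^esub> y i, \<sigma> s \<circ> \<sigma> t)" for x y
      by (rule mult_wreath[OF st])
    show "\<psi> (s \<otimes>\<^bsub>S\<^esub> t) = \<psi> s \<otimes>\<^bsub>wreath H n perms\<^esub> \<psi> t"
      unfolding \<psi>_def mw using mult[OF s t] st by (auto simp: fun_eq_iff)
  qed (rule closed)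
  moreover have "bij_betw \<psi> (carrier S) (carrier (wreath H n perms))"
  proof (rule bij_betwI'[OF _ closed])
    show "(\<psi> s = \<psi> t) = (s = t)" if "s \<in> carrier S" "t \<in> carrier S" for s t
    proof
      assume "\<psi> s = \<psi> t"
      then have e: "\<sigma> s = \<sigma> t" "(\<lambda>i\<in>{1..n}. a s i) = (\<lambda>i\<in>{1..n}. a t i)" by (simp_all add: \<psi>_def)
      have "a s i = a t i" if "i \<in> {1..n}" for i
        using fun_cong[OF e(2), of i] that by simp
      with inj[OF that e(1)] show "s = t" by blast
    qed simp
    fix y assume "y \<in> carrier (wreath H n perms)"
    then obtain x \<tau> where y: "y = (x, \<tau>)" "x \<in> {1..n} \<rightarrow>\<^sub>E carrier H" "\<tau> \<in> perms" by (auto simp: carrier_wreath)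
    then obtain s where s: "s \<in> carrier S" "\<sigma> s = \<tau>" "\<And>i. i \<in> {1..n} \<Longrightarrow> a s i = x i"
      using surj[of x \<tau>] by (auto simp: PiE_def Pi_def)
    have "(\<lambda>i\<in>{1..n}. a s i) = x" using y(2) s(3) by (auto simp: fun_eq_iff PiE_def extensional_def)
    then show "\<exists>s\<in>carrier S. y = \<psi> s" using s y(1) by (auto simp: \<psi>_def)
  qed
  ultimately show ?thesis by (auto simp: is_iso_def iso_def)
qed

lemma iso_wreath_Q8: "G \<cong> wreath Q8 n perms"
proof (rule iso_wreathI[where a = coeff_of and \<sigma> = perm_of])
  fix x \<tau> assume "\<And>i. i \<in> {1..n} \<Longrightarrow> x i \<in> carrier Q8" "\<tau> \<in> perms"
  then show "\<exists>g\<in>carrier G. perm_of g = \<tau> \<and> (\<forall>i\<in>{1..n}. coeff_of g i = x i)"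
    using ex_moves[of \<tau> x] by metis
qed (use moves_of(2) perm_of_mult moves_of_mult moves_inject in auto)

definition coords :: "'v \<Rightarrow> nat \<Rightarrow> 5^2" where
  "coords = inv_into ({1..n} \<rightarrow>\<^sub>E UNIV) comb"

lemma comb_coords: "comb (coords v) = v"
  using bij_comb by (simp add: coords_def bij_betw_def f_inv_into_f)

lemma coords_eqI: "comb x = v \<Longrightarrow> i \<in> {1..n} \<Longrightarrow> coords v i = x i"
  using comb_eqD[of "coords v" x i] comb_coords[of v] by simp

lemma iso_wreath_frob200: "semidirect additive_group G act \<cong> wreath frob200 n perms" (is "?S \<cong> _")
proof (rule iso_wreathI[where a = "\<lambda>p i. (coords (fst p) i, coeff_of (snd p) i)" and \<sigma> = "\<lambda>p. perm_of (snd p)"])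
  have car: "p \<in> carrier ?S \<longleftrightarrow> snd p \<in> carrier G" for p
    by (cases p) (simp add: semidirect_def additive_group_def)
  have carF: "carrier frob200 = UNIV \<times> carrier Q8" by (simp add: frob200_def semidirect_def additive_group_def)
  have multF: "(v, q) \<otimes>\<^bsub>frob200\<^esub> (w, q') = (v v* quat_matrix q' + w, q \<otimes>\<^bsub>Q8\<^esub> q')" for v w q q'
    by (simp add: frob200_def semidirect_def additive_group_def)
  fix p r assume p: "p \<in> carrier ?S"
  show "perm_of (snd p) \<in> perms" using p car by blast
  show "(coords (fst p) i, coeff_of (snd p) i) \<in> carrier frob200" if "i \<in> {1..n}" for i
    using moves_of(2)[of "snd p", OF _ that] p by (simp add: car carF)
  assume r: "r \<in> carrier ?S"
  obtain v g w h where vg: "p = (v, g)" "r = (w, h)" "g \<in> carrier G" "h \<in> carrier G"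
    using p r by (metis car prod.collapse)
  have pr: "p \<otimes>\<^bsub>?S\<^esub> r = (act v h + w, g \<otimes> h)" by (simp add: vg semidirect_def additive_group_def)
  \<comment> \<open>By \<open>act_comb\<close>, in coordinates \<open>h\<close> permutes positions
    and then multiplies by quaternion matrices, which is exactly the twist in the product of
    \<open>frob200\<close>.\<close>
  have "coords (act v h + w) i = coords v (perm_of h i) v* quat_matrix (coeff_of h i) + coords w i" if "i \<in> {1..n}" for i
  proof (rule coords_eqI[OF _ that])
    show "comb (\<lambda>i. coords v (perm_of h i) v* quat_matrix (coeff_of h i) + coords w i) = act v h + w"
      unfolding comb_add comb_coords using act_comb[OF vg(4), of "coords v"] comb_coords by simp
  qed
  then show "perm_of (snd (p \<otimes>\<^bsub>?S\<^esub> r)) = perm_of (snd p) \<circ> perm_of (snd r) \<and>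
      (\<forall>i\<in>{1..n}. (coords (fst (p \<otimes>\<^bsub>?S\<^esub> r)) i, coeff_of (snd (p \<otimes>\<^bsub>?S\<^esub> r)) i) =
        (coords (fst p) (perm_of (snd r) i), coeff_of (snd p) (perm_of (snd r) i)) \<otimes>\<^bsub>frob200\<^esub> (coords (fst r) i, coeff_of (snd r) i))"
    unfolding pr unfolding vg fst_conv snd_conv multF using perm_of_mult[OF vg(3,4)] moves_of_mult[OF vg(3,4)] by simp
  assume e: "perm_of (snd p) = perm_of (snd r)"
    "\<And>i. i \<in> {1..n} \<Longrightarrow> (coords (fst p) i, coeff_of (snd p) i) = (coords (fst r) i, coeff_of (snd r) i)"
  have "snd p = snd r" using p r e by (intro moves_inject) (auto simp: car)
  moreover have "comb (coords (fst p)) = comb (coords (fst r))" by (rule comb_cong) (use e(2) in blast)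
  ultimately show "p = r" by (simp add: comb_coords prod_eq_iff)
next
  fix x \<tau> assume x: "\<And>i. i \<in> {1..n} \<Longrightarrow> x i \<in> carrier frob200" and \<tau>: "\<tau> \<in> perms"
  have "snd (x i) \<in> carrier Q8" if "i \<in> {1..n}" for i
    using x[OF that] by (auto simp: frob200_def semidirect_def)
  then obtain g where g: "g \<in> carrier G" "perm_of g = \<tau>" "\<And>i. i \<in> {1..n} \<Longrightarrow> coeff_of g i = snd (x i)"
    using ex_moves[OF \<tau>, of "\<lambda>i. snd (x i)"] by blast
  then show "\<exists>p\<in>carrier ?S. perm_of (snd p) = \<tau> \<and> (\<forall>i\<in>{1..n}. (coords (fst p) i, coeff_of (snd p) i) = x i)"
    using coords_eqI[OF refl, of _ "\<lambda>i. fst (x i)"]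
    by (intro bexI[of _ "(comb (\<lambda>i. fst (x i)), g)"]) (auto simp: semidirect_def additive_group_def)
qed

end

section \<open>From rationality to balance, and the conclusion\<close>

lemma rational_two_group_balanced:
  fixes G :: "('g, 'm) monoid_scheme" and smul :: "'k::field \<Rightarrow> 'v::ab_group_add \<Rightarrow> 'v"
  assumes lin: "linear_two_group G smul act UNIV" and rat: "rational_group G"
  shows "balanced_on smul G act UNIV"
proof -
  interpret L: linear_two_group G smul act UNIV by fact
  obtain k where k: "order G = 2 ^ k" using L.two_power_order by blast
  have le: "card {y \<in> Y. act y g = smul l y} \<le> card {y \<in> Y. act y g = smul (- l) y}"
    if Y: "L.subspace Y" and st: "\<And>y x. y \<in> Y \<Longrightarrow> x \<in> carrier G \<Longrightarrow> act y x \<in> Y"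
      and g: "g \<in> carrier G" and l: "l \<noteq> 0" "l * l \<noteq> 1" for Y g and l :: 'k
  proof -
    have fin: "finite Y" by (rule finite_subset[OF subset_UNIV L.finite_U])
    show ?thesis
    proof (cases "\<exists>v\<in>Y. v \<noteq> 0 \<and> act v g = smul l v")
      case False
      then have "{y \<in> Y. act y g = smul l y} \<subseteq> {0}" by blast
      moreover have "0 \<in> {y \<in> Y. act y g = smul (- l) y}"
        using L.subspace_0[OF Y] L.act_zero[OF g] by simp
      ultimately show ?thesis using fin by (intro card_mono) auto
    next
      case True
      then obtain v where v: "v \<in> Y" "v \<noteq> 0" "act v g = smul l v" by blast
      have "smul (l ^ (2 ^ k)) v = smul 1 v"
        using L.act_pow[OF _ g v(3), of "2 ^ k"] L.pow_order_eq_1[OF g] k L.act_one by simp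
      then have l1: "l ^ (2 ^ k) = 1" using v(2) unfolding L.scale_cancel_right by simp
      have l2: "l ^ (2 ^ 1) \<noteq> 1" using l(2) by (simp add: power2_eq_square)
      obtain j where j: "j \<ge> 1" "l ^ (2 ^ j) = - 1" using power_two_power_eq_minus_one[OF l1 l2] by blast
      \<comment> \<open>As \<open>j\<close> is at least 1, \<open>m\<close> is odd, so the power of
        \<open>g\<close> with exponent \<open>m\<close> generates the same subgroup as
        \<open>g\<close>. At the same time the power of \<open>l\<close> with this exponent is -
        l.\<close>
      define m where "m = (2::nat) ^ j + 1"
      have "odd m" using j(1) by (simp add: m_def)
      have lm: "l ^ m = - l" using j(2) by (simp add: m_def)
      have ordg: "L.ord g dvd 2 ^ k" using L.ord_dvd_group_order[OF g] k by simp
      have "coprime m (L.ord g)"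
      proof -
        have "coprime m (2 ^ k)" using \<open>odd m\<close> by simp
        then show ?thesis using ordg by (meson coprime_divisors dvd_refl)
      qed
      then have "L.ord (g [^]\<^bsub>G\<^esub> m) = L.ord g"
        using L.pow_ord_eq_ord_iff[OF _ g, of m] rat by (simp add: rational_group_def)
      then have "card (generate G {g [^]\<^bsub>G\<^esub> m}) = card (generate G {g})"
        using L.generate_pow_card[OF g] L.generate_pow_card[of "g [^]\<^bsub>G\<^esub> m"] g by simp
      moreover have mem: "g [^]\<^bsub>G\<^esub> m \<in> generate G {g}"
        unfolding L.generate_pow[OF g] using int_pow_int[of G g m] by (metis (mono_tags, lifting) UNIV_I mem_Collect_eq)
      then have "generate G {g [^]\<^bsub>G\<^esub> m} \<subseteq> generate G {g}"
        using L.generate_subgroup_incl[OF _ L.generate_is_subgroup, of "{g [^]\<^bsub>G\<^esub> m}" "{g}"] g by simp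
      moreover have "finite (generate G {g})"
        using rat L.generate_incl[of "{g}"] g by (auto simp: rational_group_def intro: finite_subset)
      ultimately have "generate G {g [^]\<^bsub>G\<^esub> m} = generate G {g}" by (simp add: card_subset_eq)
      then obtain h where h: "h \<in> carrier G" "g [^]\<^bsub>G\<^esub> m = inv\<^bsub>G\<^esub> h \<otimes>\<^bsub>G\<^esub> g \<otimes>\<^bsub>G\<^esub> h"
        using rat g mem unfolding rational_group_def by blast
      have hg: "inv\<^bsub>G\<^esub> h \<otimes>\<^bsub>G\<^esub> g = g [^]\<^bsub>G\<^esub> m \<otimes>\<^bsub>G\<^esub> inv\<^bsub>G\<^esub> h"
        unfolding h(2) using h(1) g by (simp add: L.m_assoc)
      show ?thesis
      \<comment> \<open>The element that conjugates \<open>g\<close> to its power carries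
        eigenvectors of \<open>g\<close> for \<open>l\<close> injectively to eigenvectors for - l,
        and stays inside \<open>Y\<close> because \<open>Y\<close> is stable.\<close>
      proof (rule card_inj_on_le[where f = "\<lambda>y. act y (inv\<^bsub>G\<^esub> h)"])
        show "inj_on (\<lambda>y. act y (inv\<^bsub>G\<^esub> h)) {y \<in> Y. act y g = smul l y}"
          by (rule inj_onI) (metis L.act_inv_left UNIV_I h(1))
        show "(\<lambda>y. act y (inv\<^bsub>G\<^esub> h)) ` {y \<in> Y. act y g = smul l y} \<subseteq> {y \<in> Y. act y g = smul (- l) y}"
        proof (rule image_subsetI)
          fix y assume "y \<in> {y \<in> Y. act y g = smul l y}"
          then have y: "y \<in> Y" "act y g = smul l y" by auto
          have "act (act y (inv\<^bsub>G\<^esub> h)) g = act (act y (g [^]\<^bsub>G\<^esub> m)) (inv\<^bsub>G\<^esub> h)"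
            using L.act_mult[of y "inv\<^bsub>G\<^esub> h" g] L.act_mult[of y "g [^]\<^bsub>G\<^esub> m" "inv\<^bsub>G\<^esub> h"] hg h(1) g by simp
          also have "act y (g [^]\<^bsub>G\<^esub> m) = smul (- l) y" using L.act_pow[OF _ g y(2), of m] lm by simp
          also have "act (smul (- l) y) (inv\<^bsub>G\<^esub> h) = smul (- l) (act y (inv\<^bsub>G\<^esub> h))"
            using L.act_scale h(1) by blast
          finally show "act y (inv\<^bsub>G\<^esub> h) \<in> {y \<in> Y. act y g = smul (- l) y}" using st[OF y(1)] h(1) by simp
        qed
      qed (use fin in simp)
    qed
  qed
  show ?thesis
    unfolding balanced_on_def
  proof (intro allI impI antisym)
    fix Y g and l :: 'k
    assume Y: "L.subspace Y" "Y \<subseteq> UNIV" and st: "\<forall>y\<in>Y. \<forall>x\<in>carrier G. act y x \<in> Y"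
      and g: "g \<in> carrier G" and l: "l \<noteq> 0" "l * l \<noteq> 1"
    show "card {y \<in> Y. act y g = smul l y} \<le> card {y \<in> Y. act y g = smul (- l) y}"
      using le[OF Y(1) _ g l] st by blast
    show "card {y \<in> Y. act y g = smul (- l) y} \<le> card {y \<in> Y. act y g = smul l y}"
      using le[OF Y(1) _ g, of "- l"] st l by simp
  qed
qed

theorem theoremA:
  fixes p :: nat
    and G :: "('g, 'm) monoid_scheme"
    and smul :: "'k::field \<Rightarrow> 'v::ab_group_add \<Rightarrow> 'v"
    and act :: "'v \<Rightarrow> 'g \<Rightarrow> 'v"
  assumes "Factorial_Ring.prime p" and "p \<ge> 5"
    and "CARD('k) = p"
    and "two_group G" and "rational_group G"
    and "vector_space smul"
    and "\<exists>B. finite B \<and> module.span smul B = UNIV"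
    and "\<exists>v::'v. v \<noteq> 0"
    and "right_linear_action smul G act"
    and "faithful_right_action G act"
    and "eigenvector_property smul G act"
  shows "p = 5 \<and>
    (\<exists>n K. n > 0 \<and> subgroup K (sym_group n) \<and> two_group ((sym_group n)\<lparr>carrier := K\<rparr>) \<and>
       G \<cong> wreath Q8 n K \<and>
       vector_space.dim smul (UNIV :: 'v set) = 2 * n \<and>
       semidirect additive_group G act \<cong> wreath frob200 n K)"
proof -
  interpret V: vector_space smul by fact
  have finK: "finite (UNIV :: 'k set)" using assms(2,3) card.infinite by force
  obtain B where "finite B" "V.span B = (UNIV :: 'v set)" using assms(7) by blast
  then have finV: "finite (UNIV :: 'v set)" using V.finite_span finK by metis
  have linear: "Vector_Spaces.linear smul smul (\<lambda>v. act v g)" if "g \<in> carrier G" for g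
    using assms(9) that by (simp add: right_linear_action_def)
  have lin: "linear_two_group G smul act UNIV"
  proof (intro linear_two_group.intro linear_two_group_axioms.intro assms(6))
    show "group G" "\<exists>k. order G = 2 ^ k" using assms(4) by (auto simp: two_group_def)
    show "act (u + v) g = act u g + act v g" if "g \<in> carrier G" for u v g
      using linear[OF that] by (simp add: Vector_Spaces.linear_def module_hom_def module_hom_axioms_def)
    show "act (smul l u) g = smul l (act u g)" if "g \<in> carrier G" for u l g
      using linear[OF that] by (simp add: Vector_Spaces.linear_def module_hom_def module_hom_axioms_def)
  qed (use assms(9) finV in \<open>auto simp: right_linear_action_def V.subspace_UNIV\<close>)
  have eig: "eigenvectors_on smul G act UNIV"
    using assms(11) by (simp add: eigenvector_property_def eigenvectors_on_def)
  have "p = 5 \<and> has_quat_frame smul G act UNIV"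
    by (rule has_quat_frame_exists[OF assms(1-3) lin eig rational_two_group_balanced[OF lin assms(5)]]) (use assms(8) in simp)
  then obtain F where p5: "p = 5" and F: "finite F" "UNIV \<subseteq> V.span (frame_points F)" "25 ^ card F \<le> CARD('v)"
    "\<And>f g. f \<in> F \<Longrightarrow> g \<in> carrier G \<Longrightarrow> \<exists>q\<in>carrier Q8. \<exists>f'\<in>F. (act (fst f) g, act (snd f) g) = quat_pair smul q f'"
    unfolding has_quat_frame_def quat_stable_def by blast
  obtain f where f: "bij_betw f {1..card F} F" using ex_bij_betw_nat_finite_1[OF F(1)] by blast
  then have fF: "f ` {1..card F} = F" by (simp add: bij_betw_def)
  interpret Q: quat_framed G smul act "card F" f
  proof (intro quat_framed.intro quat_framed_axioms.intro lin eig)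
    show "CARD('k) = 5" using assms(3) p5 by simp
    show "UNIV \<subseteq> V.span (frame_points (f ` {1..card F}))" using F(2) fF by simp
    show "\<exists>q\<in>carrier Q8. \<exists>i\<in>{1..card F}. (act (fst (f j)) g, act (snd (f j)) g) = quat_pair smul q (f i)"
      if j: "j \<in> {1..card F}" and g: "g \<in> carrier G" for j g
    proof -
      have "f j \<in> F" using j fF by blast
      then obtain q f' where "q \<in> carrier Q8" "f' \<in> F" "(act (fst (f j)) g, act (snd (f j)) g) = quat_pair smul q f'"
        using F(4) g by blast
      moreover from this obtain i where "i \<in> {1..card F}" "f' = f i" using fF by blast
      ultimately show ?thesis by blast
    qed
    show "g = \<one>\<^bsub>G\<^esub>" if "g \<in> carrier G" "\<forall>v. act v g = v" for g
      using assms(10) that by (simp add: faithful_right_action_def)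
  qed (use F(3) in simp)
  \<comment> \<open>The dimension is read off by counting the space in two ways, by a basis and by
    quaternion coordinates.\<close>
  have "CARD('v) = 5 ^ V.dim (UNIV :: 'v set)"
    using V.card_subspace[OF finV V.subspace_UNIV finK] assms(3) p5 by simp
  then have "(5::nat) ^ V.dim (UNIV :: 'v set) = 5 ^ (2 * card F)"
    using Q.card_V_eq by (simp add: power_mult)
  then have dim: "V.dim (UNIV :: 'v set) = 2 * card F" by simp
  have "card F > 0"
  proof (rule ccontr)
    assume "\<not> card F > 0"
    then have "CARD('v) = 1" using Q.card_V_eq by simp
    then obtain a :: 'v where "UNIV = {a}" by (rule card_1_singletonE)
    then show False using assms(8) by (metis UNIV_I singletonD)
  qed
  then show ?thesis
    using p5 dim Q.perms_subgroup Q.perms_two_group Q.iso_wreath_Q8 Q.iso_wreath_frob200 by blast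
qed

end
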